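(* Let $c>0$ and let $Q_N(\zeta)=\tfrac12\xi^2+\tfrac1{2c^2}N^{1/3}\eta^2$ for $\zeta=\xi+i\eta\in\mathbb{C}$. Let $\{\zeta_j\}_1^N$ be a random sample from the Gibbs measure associated with $Q_N$ (at $\beta=1$), with $1$-point function $\mathbf{R}_N$. Put $p_N=2(1+c^2N^{-1/3})^{-1/2}$ and rescale about $p_N$ by $$z=\sqrt{N\Delta Q_N}\,(\zeta-p_N)=\tfrac{N^{2/3}}{2c}(1+c^2N^{-1/3})^{1/2}(\zeta-p_N),\qquad R_N(z)=\frac1{N\Delta Q_N}\mathbf{R}_N(\zeta).$$ Then, as $N\to\infty$, $R_N$ converges locally uniformly on $\mathbb{C}$ to $$R(z)=\sqrt{2\pi}\,4c^2\,e^{\frac43c^6-2(\operatorname{Im}z)^2}\int_0^\infty e^{4c^3(u+\operatorname{Re}z)}\,\bigl|\operatorname{Ai}(2c(z+u)+c^4)\bigr|^2\,du,$$ where $\operatorname{Ai}$ is the Airy function.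
   Context: $dA(\zeta)=\tfrac1\pi\,d\xi\,d\eta$ is normalized Lebesgue measure on $\mathbb{C}$, $dA_N=(dA)^{\otimes N}$, and $\Delta=\tfrac14\left(\frac{\partial^2}{\partial\xi^2}+\frac{\partial^2}{\partial\eta^2}\right)$ (one quarter of the usual Laplacian; for the present potential $\Delta Q_N$ is a constant). For a potential $Q_N$ put $H_N=\sum_{j\ne k}\log\frac1{|\zeta_j-\zeta_k|}+N\sum_{j=1}^NQ_N(\zeta_j)$. The Gibbs measure at $\beta=1$ is $d\mathbf{P}_N=\frac1{Z_N}e^{-H_N}\,dA_N$ on $\mathbb{C}^N$. The $1$-point function is $\mathbf{R}_N(\zeta)=\lim_{\varepsilon\to0}\varepsilon^{-2}\,\mathbf{E}_N[\#(\{\zeta_j\}_1^N\cap D(\zeta,\varepsilon))]$, where $D(\zeta,\varepsilon)$ is the open disc with center $\zeta$ and radius $\varepsilon$. The point $p_N$ is the right end-point of the droplet (the support of the equilibrium measure) of $Q_N$. *)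

theory Defs
  imports "HOL-Analysis.Analysis"
begin

section \<open>Planar Coulomb gas at inverse temperature one\<close>

definition dA :: "complex measure" where
  "dA = density lborel (\<lambda>_. ennreal (1 / pi))"

text \<open>A configuration of \<open>N\<close> points is an extensional function on \<open>{..<N}\<close>.\<close>

definition dA_prod :: "nat \<Rightarrow> (nat \<Rightarrow> complex) measure" where
  "dA_prod N = PiM {..<N} (\<lambda>_. dA)"

text \<open>One quarter of the usual Laplacian.\<close>

definition quarter_laplacian :: "(complex \<Rightarrow> real) \<Rightarrow> complex \<Rightarrow> real" where
  "quarter_laplacian f \<zeta> =
     1/4 * (deriv (deriv (\<lambda>\<xi>. f (Complex \<xi> (Im \<zeta>)))) (Re \<zeta>)
          + deriv (deriv (\<lambda>\<eta>. f (Complex (Re \<zeta>) \<eta>))) (Im \<zeta>))"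

text \<open>The sum runs over ordered pairs, so every unordered pair is counted twice. On configurations
  with coinciding points, a null set for \<^const>\<open>dA_prod\<close>, the energy should be infinite; here
  it has the finite value resulting from \<open>ln (1 / 0) = 0\<close>, which does not affect the Gibbs
  measure.\<close>

definition energy :: "nat \<Rightarrow> (complex \<Rightarrow> real) \<Rightarrow> (nat \<Rightarrow> complex) \<Rightarrow> real" where
  "energy N Q x =
     (\<Sum>(j, k) \<in> {(j, k). j < N \<and> k < N \<and> j \<noteq> k}. ln (1 / cmod (x j - x k)))
     + real N * (\<Sum>j<N. Q (x j))"

definition partition_function :: "nat \<Rightarrow> (complex \<Rightarrow> real) \<Rightarrow> real" where
  "partition_function N Q = (LINT x|dA_prod N. exp (- energy N Q x))"

definition gibbs :: "nat \<Rightarrow> (complex \<Rightarrow> real) \<Rightarrow> (nat \<Rightarrow> complex) measure" where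
  "gibbs N Q =
     density (dA_prod N) (\<lambda>x. ennreal (exp (- energy N Q x) / partition_function N Q))"

definition one_point :: "nat \<Rightarrow> (complex \<Rightarrow> real) \<Rightarrow> complex \<Rightarrow> real" where
  "one_point N Q \<zeta> =
     Lim (at_right 0)
       (\<lambda>\<epsilon>. (LINT x|gibbs N Q. real (card {j. j < N \<and> x j \<in> ball \<zeta> \<epsilon>})) / \<epsilon>\<^sup>2)"

text \<open>The \<open>1\<close>-point function as a function of
  \<open>z = sqrt (N * quarter_laplacian Q p) * (\<zeta> - p)\<close>, where \<open>p\<close> is the point of magnification.\<close>

definition rescaled_one_point ::
    "nat \<Rightarrow> (complex \<Rightarrow> real) \<Rightarrow> complex \<Rightarrow> complex \<Rightarrow> real" where
  "rescaled_one_point N Q p z =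
     one_point N Q (p + z / of_real (sqrt (real N * quarter_laplacian Q p)))
       / (real N * quarter_laplacian Q p)"

section \<open>The almost-Hermitian Gaussian potential\<close>

definition potential :: "real \<Rightarrow> nat \<Rightarrow> complex \<Rightarrow> real" where
  "potential c N \<zeta> =
     1/2 * (Re \<zeta>)\<^sup>2 + 1 / (2 * c\<^sup>2) * real N powr (1/3) * (Im \<zeta>)\<^sup>2"

text \<open>The right end-point of the droplet of \<^term>\<open>potential c N\<close>, which is an ellipse.\<close>

definition right_endpoint :: "real \<Rightarrow> nat \<Rightarrow> real" where
  "right_endpoint c N = 2 * (1 + c\<^sup>2 * real N powr (-1/3)) powr (-1/2)"

lemma quarter_laplacian_potential:
  "quarter_laplacian (potential c N) \<zeta> = 1/4 * (1 + real N powr (1/3) / c\<^sup>2)"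
proof -
  have D: "deriv (deriv (\<lambda>t::real. a * t\<^sup>2 + b)) x = 2 * a" for a b x :: real
  proof -
    have "deriv (\<lambda>t::real. a * t\<^sup>2 + b) = (\<lambda>t. 2 * a * t)"
      by (rule ext, rule DERIV_imp_deriv) (auto intro!: derivative_eq_intros)
    moreover have "deriv (\<lambda>t::real. 2 * a * t) x = 2 * a"
      by (rule DERIV_imp_deriv) (auto intro!: derivative_eq_intros)
    ultimately show ?thesis by simp
  qed
  show ?thesis
    using D[of "1/2" "1 / (2 * c\<^sup>2) * real N powr (1/3) * (Im \<zeta>)\<^sup>2" "Re \<zeta>"]
      D[of "1 / (2 * c\<^sup>2) * real N powr (1/3)" "1/2 * (Re \<zeta>)\<^sup>2" "Im \<zeta>"]
    by (simp add: quarter_laplacian_def potential_def add.commute)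
qed

lemma rescaling_factor:
  assumes "c > 0" and "N > 0"
  shows "sqrt (real N * quarter_laplacian (potential c N) \<zeta>) =
    real N powr (2/3) / (2 * c) * (1 + c\<^sup>2 * real N powr (-1/3)) powr (1/2)"
proof -
  define t where "t = real N powr (1/3)"
  have t: "t > 0" using assms by (simp add: t_def)
  have t3: "real N = t ^ 3"
    using assms by (simp add: t_def powr_powr flip: powr_realpow)
  have t2: "real N powr (2/3) = t\<^sup>2"
    using assms by (simp add: t_def powr_powr flip: powr_realpow)
  have ti: "real N powr (-1/3) = 1 / t"
    by (simp add: t_def powr_minus_divide)
  have "real N * quarter_laplacian (potential c N) \<zeta> = (t\<^sup>2 / (2 * c))\<^sup>2 * (1 + c\<^sup>2 / t)"
    unfolding quarter_laplacian_potential t_def[symmetric] unfolding t3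
    using t assms by (simp add: field_simps power2_eq_square power3_eq_cube)
  then show ?thesis
    using t assms unfolding t2 ti
    by (simp add: real_sqrt_mult powr_half_sqrt add_pos_pos)
qed

section \<open>The Airy function\<close>

text \<open>The standard contour integral
  \<open>Ai z = 1 / (2 \<pi> \<i>) \<integral> exp (t^3 / 3 - z t) dt\<close>, where \<open>t\<close> comes from infinity along the ray of
  argument \<open>- \<pi> / 3\<close> to the origin, and then goes to infinity along the ray of argument
  \<open>\<pi> / 3\<close>. On both rays the integral converges absolutely for every complex \<open>z\<close>
  (\<open>airy_ray_integrable\<close>).\<close>

definition airy_ray :: "real \<Rightarrow> complex \<Rightarrow> complex" where
  "airy_ray \<theta> z =
     (LBINT r:{0..}. exp ((of_real r * cis \<theta>) ^ 3 / 3 - z * (of_real r * cis \<theta>)) * cis \<theta>)"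

definition Ai :: "complex \<Rightarrow> complex" where
  "Ai z = (airy_ray (pi / 3) z - airy_ray (- pi / 3) z) / (2 * of_real pi * \<i>)"

lemma airy_ray_integrable:
  assumes "\<theta> = pi / 3 \<or> \<theta> = - pi / 3"
  shows "set_integrable lborel {0..}
    (\<lambda>r. exp ((of_real r * cis \<theta>) ^ 3 / 3 - z * (of_real r * cis \<theta>)) * cis \<theta>)"
proof -
  define C where "C = exp ((cmod z + 2)\<^sup>2)"
  have "cis \<theta> ^ 3 = -1"
    using assms unfolding Complex.DeMoivre by (elim disjE) (simp_all add: complex_eq_iff mult.commute)
  then have cube: "(of_real r * cis \<theta>) ^ 3 = - of_real (r ^ 3)" for r :: real
    by (simp add: power_mult_distrib)
  have bound: "cmod (exp ((of_real r * cis \<theta>) ^ 3 / 3 - z * (of_real r * cis \<theta>)) * cis \<theta>)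
      \<le> C * exp (- r)" if "r \<ge> 0" for r :: real
  proof -
    have "Re (- (z * (of_real r * cis \<theta>))) \<le> cmod z * r"
      using complex_Re_le_cmod[of "- (z * (of_real r * cis \<theta>))"] that
      by (simp add: norm_mult)
    moreover have "(cmod z + 1) * r - r ^ 3 / 3 \<le> (cmod z + 2)\<^sup>2"
    proof (cases "r \<le> cmod z + 2")
      case True
      have "(cmod z + 1) * r \<le> (cmod z + 2) * (cmod z + 2)"
        using True that by (intro mult_mono) auto
      moreover have "r ^ 3 \<ge> 0" using that by simp
      ultimately show ?thesis unfolding power2_eq_square by linarith
    next
      case False
      define m where "m = cmod z"
      have m: "m \<ge> 0" "r > m + 2" using False by (auto simp: m_def)
      have "3 * (m + 1) \<le> (m + 2) * (m + 2)" using m by (simp add: algebra_simps)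
      also have "\<dots> \<le> r * r" using m by (intro mult_mono) auto
      finally have "3 * (m + 1) * r \<le> r * r * r"
        using m by (intro mult_right_mono) auto
      then have "(m + 1) * r - r ^ 3 / 3 \<le> 0" by (simp add: power3_eq_cube algebra_simps)
      then show ?thesis unfolding m_def by (smt (verit) zero_le_power2)
    qed
    ultimately have "Re ((of_real r * cis \<theta>) ^ 3 / 3 - z * (of_real r * cis \<theta>))
        \<le> (cmod z + 2)\<^sup>2 - r"
      unfolding cube by (simp add: algebra_simps)
    then have "exp (Re ((of_real r * cis \<theta>) ^ 3 / 3 - z * (of_real r * cis \<theta>)))
        \<le> exp ((cmod z + 2)\<^sup>2 - r)"
      by (simp only: exp_le_cancel_iff)
    then show ?thesis
      by (simp only: norm_mult norm_exp_eq_Re norm_cis mult_1_right C_def)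
         (simp add: exp_diff exp_minus field_simps)
  qed
  have "set_integrable lborel {0..} (\<lambda>r::real. C * exp (- r))"
  proof -
    have "(\<lambda>r::real. exp (- 1 * r)) absolutely_integrable_on {0..}"
      using integrable_on_exp_minus_to_infinity[of 1 0]
      by (intro nonnegative_absolutely_integrable_1) auto
    then have "set_integrable lborel {0..} (\<lambda>r::real. exp (- r))"
      unfolding set_integrable_def by (simp add: integrable_completion)
    then show ?thesis by simp
  qed
  then show ?thesis
  proof (rule set_integrable_bound)
    show "set_borel_measurable lborel {0..}
        (\<lambda>r. exp ((of_real r * cis \<theta>) ^ 3 / 3 - z * (of_real r * cis \<theta>)) * cis \<theta>)"
      unfolding set_borel_measurable_def
      by measurable
    show "AE r in lborel. r \<in> {0..} \<longrightarrow>
        cmod (exp ((of_real r * cis \<theta>) ^ 3 / 3 - z * (of_real r * cis \<theta>)) * cis \<theta>)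
          \<le> norm (C * exp (- r))"
      using bound by (auto simp: C_def)
  qed
qed

end

theory Submission
  imports Defs "HOL-Complex_Analysis.Complex_Analysis" "HOL-Probability.Probability" "Jordan_Normal_Form.Determinant"
begin

text \<open>
  At inverse temperature one the Gibbs density is the square of a Vandermonde determinant times a
  product weight. Column operations replace the monomials by any monic polynomials, and for monic
  polynomials that are orthogonal for the weight all mixed terms of the expanded determinant
  integrate to zero. So the one-point function is the weight times the sum of the squared
  normalised polynomials (\<open>one_point_eq_kernel\<close>).

  For a Gaussian weight \<open>exp (- a x\<^sup>2 - b y\<^sup>2)\<close> the orthogonal polynomials are rescaled Hermite
  polynomials \<open>P\<^sub>k\<close> (\<open>gauss_inner_hpoly\<close>). They satisfy \<open>P\<^sub>k' = k P\<^bsub>k-1\<^esub>\<close>, and with the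
  three-term recurrence this makes the derivative of the weighted sum along the real direction
  telescope to a single product \<open>P\<^sub>n cnj P\<^bsub>n-1\<^esub>\<close> (\<open>hpoly_christoffel_darboux\<close>). Integrating back
  from infinity turns the one-point function into an integral over a half-line that contains
  only two polynomials (\<open>one_point_gauss_integral\<close>). This half-line becomes the integral over
  \<open>u\<close> in the limit.

  Each \<open>P\<^sub>k\<close> is a Gaussian integral of \<open>v\<^sup>k\<close> over an arbitrary vertical line
  (\<open>hpoly_vertical_integral\<close>). At the edge its two saddle points nearly coincide; in the scale
  \<open>\<epsilon> = N\<^bsup>-1/3\<^esup>\<close> around them the integrand is
  \<open>(1 + \<epsilon> v)\<^sup>k exp (v\<^sup>2 / (2 \<epsilon>) - v / \<epsilon>\<^sup>2 - \<kappa> v)\<close>, which tends to \<open>exp (v\<^sup>3 / 3 - \<kappa> v)\<close>. The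
  Airy function is the integral of the latter over any vertical line in the right half-plane
  (\<open>Ai_vertical_integral\<close>), where it decays like a Gaussian. As the integrands before the limit
  have Gaussian bounds on the same line, dominated convergence gives the limit of the polynomials
  (\<open>airyN_tendsto\<close>) without any deformation of contours.

  It remains to exchange the limit with the integral over \<open>u\<close>. The quadratic exponents of the
  weight and of the two polynomials do not cancel exactly: a factor
  \<open>exp ((1 + h) \<epsilon> (Re \<kappa>)\<^sup>2 / 2)\<close> is left, where \<open>\<kappa>\<close> grows linearly in \<open>u\<close>, and bounds from a fixed
  line of integration do not beat it. The line is free, however, and moving it to the abscissa
  \<open>\<delta> + \<epsilon> Re \<kappa> / 2\<close> bounds the integrand by a multiple of \<open>exp (- Re \<kappa>)\<close> for all \<open>u \<ge> 0\<close>
  (\<open>shifted_line_exponent_bound\<close>, \<open>edge_integrand_bound\<close>).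

  The constants come from an exact identity at finite \<open>N\<close> (\<open>rescaled_one_point_formula\<close>), from
  Stirling's formula, and from \<open>N (ln (1 - h) - ln (1 + h) + 2 h) \<longlonglongrightarrow> - 2 c\<^sup>6 / 3\<close> for
  \<open>h = c\<^sup>2 N\<^bsup>-1/3\<^esup>\<close>. The limit is taken along arbitrary sequences \<open>N\<^sub>n \<longlonglongrightarrow> \<infinity>\<close> and \<open>z\<^sub>n \<longlonglongrightarrow> z\<close>,
  which on compact sets amounts to uniform convergence.
\<close>

section \<open>Determinants in monic polynomials\<close>

text \<open>The matrix of values is the Vandermonde matrix times the matrix of coefficients, and the latter is
  upper triangular with ones on the diagonal.\<close>

lemma det_monic_polynomials:
  fixes p :: "nat \<Rightarrow> 'a::comm_ring_1 poly" and x :: "nat \<Rightarrow> 'a"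
  assumes "\<And>k. k < n \<Longrightarrow> degree (p k) \<le> k \<and> coeff (p k) k = 1"
  shows "det (mat n n (\<lambda>(i, j). poly (p j) (x i))) = det (mat n n (\<lambda>(i, j). x i ^ j))"
proof -
  let ?V = "mat n n (\<lambda>(i, j). x i ^ j)" and ?U = "mat n n (\<lambda>(i, j). coeff (p j) i)"
  have "mat n n (\<lambda>(i, j). poly (p j) (x i)) = ?V * ?U"
  proof (rule eq_matI)
    fix i j assume ij: "i < dim_row (?V * ?U)" "j < dim_col (?V * ?U)"
    then have j: "i < n" "j < n" by auto
    have "degree (p j) < n" using assms[OF j(2)] j by linarith
    then have "poly (p j) (x i) = (\<Sum>k<n. coeff (p j) k * x i ^ k)"
      unfolding poly_altdef by (intro sum.mono_neutral_left) (auto simp: coeff_eq_0)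
    then show "mat n n (\<lambda>(i, j). poly (p j) (x i)) $$ (i, j) = (?V * ?U) $$ (i, j)"
      using j by (simp add: scalar_prod_def atLeast0LessThan mult.commute)
  qed auto
  moreover have "det ?U = 1"
  proof (subst det_upper_triangular[where n = n])
    show "upper_triangular ?U"
      unfolding upper_triangular_def
    proof (intro allI impI)
      fix i j assume "i < dim_row ?U" "j < i"
      then show "?U $$ (i, j) = 0"
        using assms[of j] by (auto intro!: coeff_eq_0)
    qed
    show "prod_list (diag_mat ?U) = 1"
      using assms by (auto simp: prod_list_diag_prod)
  qed auto
  ultimately show ?thesis by (simp add: det_mult[of _ n])
qed

text \<open>In the Newton polynomials \<open>(t - x\<^sub>0) \<cdots> (t - x\<^bsub>k-1\<^esub>)\<close>, which are monic, the matrix is triangular.\<close>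

lemma det_vandermonde:
  fixes x :: "nat \<Rightarrow> 'a::comm_ring_1"
  shows "det (mat n n (\<lambda>(i, j). x i ^ j)) = (\<Prod>j<n. \<Prod>i<j. x j - x i)"
proof -
  define p where "p = (\<lambda>k. \<Prod>i<k. [:- x i, 1:])"
  have deg: "degree (p k) \<le> k \<and> coeff (p k) k = 1" for k
  proof (induction k)
    case (Suc k)
    have P: "p (Suc k) = pCons 0 (p k) - Polynomial.smult (x k) (p k)" by (simp add: p_def mult.commute)
    have "degree (p (Suc k)) \<le> Suc k"
      unfolding P using Suc
      by (intro degree_diff_le order.trans[OF degree_pCons_le] order.trans[OF degree_smult_le]) auto
    moreover have "coeff (p k) (Suc k) = 0" using Suc by (intro coeff_eq_0) auto
    ultimately show ?case using Suc by (simp add: P)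
  qed (simp add: p_def)
  have "det (mat n n (\<lambda>(i, j). x i ^ j)) = det (mat n n (\<lambda>(i, j). poly (p j) (x i)))"
    using det_monic_polynomials[of n p x] deg by simp
  also have "\<dots> = (\<Prod>j<n. \<Prod>i<j. x j - x i)"
  proof (subst det_lower_triangular[where n = n])
    show "mat n n (\<lambda>(i, j). poly (p j) (x i)) $$ (i, j) = 0" if "i < j" "j < n" for i j
      using that by (auto simp: p_def poly_prod intro!: prod_zero)
    show "prod_list (diag_mat (mat n n (\<lambda>(i, j). poly (p j) (x i)))) = (\<Prod>j<n. \<Prod>i<j. x j - x i)"
      by (auto simp: prod_list_diag_prod p_def poly_prod atLeast0LessThan)
  qed auto
  finally show ?thesis .
qed

section \<open>Ensembles with a squared Vandermonde density\<close>

lemma cmod_det_square_expand: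
  fixes f :: "nat \<Rightarrow> 'a \<Rightarrow> complex"
  shows "of_real ((cmod (det (mat n n (\<lambda>(i, j). f j (x i)))))\<^sup>2) =
    (\<Sum>\<sigma> | \<sigma> permutes {0..<n}. \<Sum>\<pi> | \<pi> permutes {0..<n}. signof \<sigma> * signof \<pi> *
       (\<Prod>i<n. f (\<sigma> i) (x i) * cnj (f (\<pi> i) (x i))))"
proof -
  have D: "det (mat n n (\<lambda>(i, j). f j (x i))) =
    (\<Sum>\<sigma> | \<sigma> permutes {0..<n}. signof \<sigma> * (\<Prod>i<n. f (\<sigma> i) (x i)))"
    by (subst det_def'[of _ n]) (auto simp: atLeast0LessThan permutes_in_image[of _ "{..<n}", simplified] intro!: sum.cong prod.cong)
  have S: "cnj (signof \<sigma>) = signof \<sigma>" for \<sigma> :: "nat \<Rightarrow> nat"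
    by (simp add: sign_def)
  show ?thesis
    unfolding complex_norm_square D cnj_sum complex_cnj_mult cnj_prod S
    unfolding sum_product prod.distrib
    by (intro sum.cong refl) (simp only: mult_ac)
qed

text \<open>Off-diagonal terms of the expanded determinant are to vanish even when one of the factors is
  perturbed; this is why two distinct permutations have to differ at a second place.\<close>

lemma permutes_eqI_except_one:
  assumes "\<sigma> permutes A" "\<pi> permutes A" "i \<in> A" "\<And>j. j \<in> A \<Longrightarrow> j \<noteq> i \<Longrightarrow> \<sigma> j = \<pi> j"
  shows "\<sigma> = \<pi>"
proof -
  obtain k where k: "k \<in> A" "\<sigma> k = \<pi> i"
    using assms permutes_in_image[OF assms(2), of i] permutes_image[OF assms(1)] by (metis imageE)
  have "k = i"
  proof (rule ccontr)
    assume "k \<noteq> i"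
    then have "\<pi> k = \<pi> i" using assms(4)[of k] k by simp
    then show False using \<open>k \<noteq> i\<close> permutes_inj[OF assms(2)] by (auto dest: injD)
  qed
  then have "\<sigma> j = \<pi> j" for j
    using assms k by (cases "j \<in> A"; cases "j = i") (auto simp: permutes_def)
  then show ?thesis by blast
qed

text \<open>The test function \<open>g\<close> sees one of the points only. By orthogonality a pair \<open>(\<sigma>, \<pi>)\<close> of
  permutations contributes zero as soon as \<open>\<sigma> j \<noteq> \<pi> j\<close> for some \<open>j \<noteq> i\<close>, so only the diagonal
  pairs survive. The case \<open>g = 1\<close> gives the partition function, the case of an indicator the
  expected number of points in a set.\<close>

lemma orthogonal_det_integral:
  fixes M :: "'a measure" and f :: "nat \<Rightarrow> 'a \<Rightarrow> complex" and w g :: "'a \<Rightarrow> real" and m :: "nat \<Rightarrow> real"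
  assumes M: "sigma_finite_measure M"
    and int: "\<And>j k. integrable M (\<lambda>y. of_real (w y) * (f j y * cnj (f k y)))"
    and intg: "\<And>j k. integrable M (\<lambda>y. of_real (g y) * (of_real (w y) * (f j y * cnj (f k y))))"
    and orth: "\<And>j k. (LINT y|M. of_real (w y) * (f j y * cnj (f k y))) = (if j = k then of_real (m k) else 0)"
    and m: "\<And>k. m k > 0" and i: "i < n"
  shows "integrable (PiM {..<n} (\<lambda>_. M)) (\<lambda>x. g (x i) *
            ((cmod (det (mat n n (\<lambda>(i, j). f j (x i)))))\<^sup>2 * (\<Prod>i<n. w (x i))))" (is ?I)
    and "(LINT x|PiM {..<n} (\<lambda>_. M). g (x i) *
            ((cmod (det (mat n n (\<lambda>(i, j). f j (x i)))))\<^sup>2 * (\<Prod>i<n. w (x i)))) =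
      (\<Prod>k<n. m k) * (\<Sum>\<sigma> | \<sigma> permutes {0..<n}.
          (LINT y|M. g y * (w y * (cmod (f (\<sigma> i) y))\<^sup>2)) / m (\<sigma> i))" (is "?L = ?R")
proof -
  interpret product_sigma_finite "\<lambda>_::nat. M"
    using M by (simp add: product_sigma_finite_def)
  define P where "P = {\<sigma>. \<sigma> permutes {0..<n}}"
  define h where "h = (\<lambda>j a b y. (if j = i then of_real (g y) else 1) *
     (of_real (w y) * (f a y * cnj (f b y))))"
  define H where "H = (\<lambda>\<sigma> \<pi> x. signof \<sigma> * signof \<pi> * (\<Prod>j<n. h j (\<sigma> j) (\<pi> j) (x j)) :: complex)"
  have "finite P" unfolding P_def by (simp add: finite_permutations)
  have inth: "integrable M (h j a b)" for j a b
    using int[of a b] intg[of a b] unfolding h_def by (cases "j = i") simp_all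
  have eq: "of_real (g (x i) * ((cmod (det (mat n n (\<lambda>(i, j). f j (x i)))))\<^sup>2 * (\<Prod>i<n. w (x i))))
      = (\<Sum>\<sigma>\<in>P. \<Sum>\<pi>\<in>P. H \<sigma> \<pi> x)" for x
  proof -
    have G: "of_real (g (x i)) = (\<Prod>j<n. if j = i then of_real (g (x j)) else (1::complex))"
      using i by (simp add: prod.delta)
    show ?thesis
      unfolding of_real_mult cmod_det_square_expand G H_def h_def P_def of_real_prod sum_distrib_left sum_distrib_right
      by (intro sum.cong refl) (simp add: prod.distrib mult_ac)
  qed
  have intH: "integrable (PiM {..<n} (\<lambda>_. M)) (H \<sigma> \<pi>)" for \<sigma> \<pi>
    unfolding H_def using inth by (intro integrable_mult_right product_integrable_prod) auto
  have intHS: "integrable (PiM {..<n} (\<lambda>_. M)) (\<lambda>x. \<Sum>\<sigma>\<in>P. \<Sum>\<pi>\<in>P. H \<sigma> \<pi> x)"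
    using intH by auto
  show ?I
    using integrable_Re[OF intHS] unfolding eq[symmetric] Re_complex_of_real .
  have I: "(LINT x|PiM {..<n} (\<lambda>_. M). H \<sigma> \<pi> x) = signof \<sigma> * signof \<pi> * (\<Prod>j<n. LINT y|M. h j (\<sigma> j) (\<pi> j) y)"
    for \<sigma> \<pi>
    unfolding H_def integral_mult_right_zero using inth by (subst product_integral_prod) auto
  have hj: "(LINT y|M. h j a b y) = (if a = b then of_real (m b) else 0)" if "j \<noteq> i" for j a b
    using orth that by (simp add: h_def)
  have hi: "(LINT y|M. h i a a y) = of_real (LINT y|M. g y * (w y * (cmod (f a y))\<^sup>2))" for a
  proof -
    have "h i a a y = of_real (g y * (w y * (cmod (f a y))\<^sup>2))" for y
      by (simp add: h_def complex_norm_square[symmetric])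
    then show ?thesis by (simp only: integral_complex_of_real)
  qed
  \<comment> \<open>Two distinct permutations differ at some index other than \<open>i\<close>, where the factor is zero.\<close>
  have off: "(LINT x|PiM {..<n} (\<lambda>_. M). H \<sigma> \<pi> x) = 0" if "\<sigma> \<in> P" "\<pi> \<in> P" "\<sigma> \<noteq> \<pi>" for \<sigma> \<pi>
  proof -
    have "\<exists>j\<in>{0..<n}. j \<noteq> i \<and> \<sigma> j \<noteq> \<pi> j"
    proof (rule ccontr)
      assume "\<not> ?thesis"
      then have "\<sigma> = \<pi>"
        using that i by (intro permutes_eqI_except_one[of \<sigma> "{0..<n}" \<pi> i]) (auto simp: P_def)
      then show False using that by simp
    qed
    then obtain j where "j < n" "j \<noteq> i" "\<sigma> j \<noteq> \<pi> j" by auto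
    then show ?thesis unfolding I by (auto simp: hj intro!: bexI[of _ j])
  qed
  have diag: "(LINT x|PiM {..<n} (\<lambda>_. M). H \<sigma> \<sigma> x) =
     of_real ((\<Prod>k<n. m k) * ((LINT y|M. g y * (w y * (cmod (f (\<sigma> i) y))\<^sup>2)) / m (\<sigma> i)))" if "\<sigma> \<in> P" for \<sigma>
  proof -
    have perm: "\<sigma> permutes {..<n}" using that by (simp add: P_def atLeast0LessThan)
    have "(\<Prod>j<n. LINT y|M. h j (\<sigma> j) (\<sigma> j) y)
      = (LINT y|M. h i (\<sigma> i) (\<sigma> i) y) * (\<Prod>j\<in>{..<n}-{i}. LINT y|M. h j (\<sigma> j) (\<sigma> j) y)"
      using i by (subst prod.remove[of _ i]) auto
    also have "(\<Prod>j\<in>{..<n}-{i}. LINT y|M. h j (\<sigma> j) (\<sigma> j) y) = (\<Prod>j\<in>{..<n}-{i}. of_real (m (\<sigma> j)))"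
      by (intro prod.cong) (auto simp: hj)
    also have "(\<Prod>j\<in>{..<n}-{i}. of_real (m (\<sigma> j))) = of_real (\<Prod>k<n. m k) / (of_real (m (\<sigma> i)) :: complex)"
    proof -
      have "(\<Prod>k<n. m k) = (\<Prod>j<n. m (\<sigma> j))" using prod.permute[OF perm, of m] by (simp add: o_def)
      also have "\<dots> = m (\<sigma> i) * (\<Prod>j\<in>{..<n}-{i}. m (\<sigma> j))"
        using i by (subst prod.remove[of _ i]) auto
      finally show ?thesis using m[of "\<sigma> i"] by simp
    qed
    finally have "(\<Prod>j<n. LINT y|M. h j (\<sigma> j) (\<sigma> j) y) =
       of_real ((\<Prod>k<n. m k) * ((LINT y|M. g y * (w y * (cmod (f (\<sigma> i) y))\<^sup>2)) / m (\<sigma> i)))"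
      unfolding hi by (simp add: field_simps)
    moreover have "signof \<sigma> * signof \<sigma> = (1::complex)" by (simp add: sign_def)
    ultimately show ?thesis unfolding I by simp
  qed
  have "of_real ?L = (LINT x|PiM {..<n} (\<lambda>_. M). (\<Sum>\<sigma>\<in>P. \<Sum>\<pi>\<in>P. H \<sigma> \<pi> x))"
    unfolding eq[symmetric] by (simp only: integral_complex_of_real)
  also have "\<dots> = (\<Sum>\<sigma>\<in>P. \<Sum>\<pi>\<in>P. LINT x|PiM {..<n} (\<lambda>_. M). H \<sigma> \<pi> x)"
    using intH by (simp add: Bochner_Integration.integral_sum)
  also have "\<dots> = (\<Sum>\<sigma>\<in>P. LINT x|PiM {..<n} (\<lambda>_. M). H \<sigma> \<sigma> x)"
  proof (intro sum.cong refl)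
    fix \<sigma> assume "\<sigma> \<in> P"
    then show "(\<Sum>\<pi>\<in>P. LINT x|PiM {..<n} (\<lambda>_. M). H \<sigma> \<pi> x) = (LINT x|PiM {..<n} (\<lambda>_. M). H \<sigma> \<sigma> x)"
      using off \<open>finite P\<close> by (subst sum.remove[of _ \<sigma>]) (auto intro!: sum.neutral)
  qed
  also have "\<dots> = of_real ?R"
    using diag by (simp add: sum_distrib_left P_def)
  finally show "?L = ?R" using of_real_eq_iff by blast
qed

text \<open>Each unordered pair occurs twice in the energy, which produces the square of the Vandermonde
  product. The points have to be distinct since the logarithmic terms are finite also at
  coinciding points.\<close>

lemma exp_neg_energy:
  assumes inj: "inj_on x {..<n}"
  shows "exp (- energy n Q x) =
    (cmod (det (mat n n (\<lambda>(i, j). x i ^ j))))\<^sup>2 * (\<Prod>i<n. exp (- real n * Q (x i)))"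
proof -
  define A where "A = (SIGMA j:{..<n}. {..<j})"
  define S where "S = {(j, k). j < n \<and> k < n \<and> j \<noteq> k}"
  have fin: "finite A" by (simp add: A_def)
  have S: "S = A \<union> prod.swap ` A" by (auto simp: S_def A_def image_iff)
  have disj: "A \<inter> prod.swap ` A = {}" by (auto simp: A_def)
  have fS: "finite S" using fin S by simp
  have pos: "cmod (x j - x k) > 0" if "(j, k) \<in> S" for j k
    using that inj by (auto simp: S_def inj_on_def)
  have "exp (- (\<Sum>(j, k)\<in>S. ln (1 / cmod (x j - x k)))) = exp (\<Sum>(j, k)\<in>S. ln (cmod (x j - x k)))"
    unfolding sum_negf[symmetric] using pos by (intro arg_cong[of _ _ exp] sum.cong) (auto simp: ln_div)
  also have "\<dots> = (\<Prod>(j, k)\<in>S. cmod (x j - x k))"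
    unfolding exp_sum[OF fS] using pos by (intro prod.cong) auto
  also have "\<dots> = (\<Prod>(j, k)\<in>A. cmod (x j - x k)) * (\<Prod>(j, k)\<in>prod.swap ` A. cmod (x j - x k))"
    unfolding S using fin disj by (intro prod.union_disjoint) auto
  also have "(\<Prod>(j, k)\<in>prod.swap ` A. cmod (x j - x k)) = (\<Prod>(j, k)\<in>A. cmod (x j - x k))"
    by (subst prod.reindex) (auto intro!: prod.cong simp: norm_minus_commute)
  also have "(\<Prod>(j, k)\<in>A. cmod (x j - x k)) = (\<Prod>j<n. \<Prod>i<j. cmod (x j - x i))"
    unfolding A_def by (subst prod.Sigma) auto
  also have "\<dots> = cmod (det (mat n n (\<lambda>(i, j). x i ^ j)))"
    unfolding det_vandermonde by (simp add: prod_norm)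
  finally have E: "exp (- (\<Sum>(j, k)\<in>S. ln (1 / cmod (x j - x k)))) =
     (cmod (det (mat n n (\<lambda>(i, j). x i ^ j))))\<^sup>2" by (simp add: power2_eq_square)
  have "- energy n Q x = - (\<Sum>(j, k)\<in>S. ln (1 / cmod (x j - x k))) + (\<Sum>i<n. - real n * Q (x i))"
    by (simp add: energy_def S_def sum_distrib_left sum_negf)
  then show ?thesis unfolding E[symmetric] by (simp only: exp_add exp_sum[OF finite_lessThan])
qed

lemma sigma_finite_dA: "sigma_finite_measure dA"
  unfolding dA_def
  by (subst sigma_finite_measure.sigma_finite_iff_density_finite[OF sigma_finite_lborel]) auto

lemma sets_dA [simp, measurable_cong]: "sets dA = sets borel"
  by (simp add: dA_def)

lemma borel_measurable_dA [simp]: "borel_measurable dA = borel_measurable borel"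
  by (rule measurable_cong_sets) simp_all

lemma measurable_PiM_dA_component:
  "j < (n::nat) \<Longrightarrow> (\<lambda>x. x j) \<in> borel_measurable (PiM {..<n} (\<lambda>_. dA))"
  using measurable_component_singleton[of j "{..<n}" "\<lambda>_. dA"] by (simp only: measurable_cong_sets[OF refl sets_dA] lessThan_iff)

lemma AE_PiM_dA_inj: "AE x in PiM {..<n} (\<lambda>_. dA). inj_on x {..<n::nat}"
proof -
  interpret product_sigma_finite "\<lambda>_::nat. dA"
    using sigma_finite_dA by (simp add: product_sigma_finite_def)
  have null: "emeasure dA {y} = 0" for y
    by (simp add: dA_def emeasure_density nn_integral_cmult_indicator)
  have "AE x in PiM {..<n} (\<lambda>_. dA). x j \<noteq> x k" if "j < n" "k < n" "j \<noteq> k" for j k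
  proof (rule AE_I)
    let ?J = "{..<n} - {j}"
    let ?N = "{x \<in> space (PiM {..<n} (\<lambda>_. dA)). \<not> x j \<noteq> x k}"
    have ins: "insert j ?J = {..<n}" using that by auto
    show N: "?N \<in> sets (PiM {..<n} (\<lambda>_. dA))" using that measurable_PiM_dA_component[of j n] measurable_PiM_dA_component[of k n] by simp measurable
    have "emeasure (PiM {..<n} (\<lambda>_. dA)) ?N = (\<integral>\<^sup>+x. indicator ?N x \<partial>PiM (insert j ?J) (\<lambda>_. dA))"
      unfolding ins using N by simp
    also have "\<dots> = (\<integral>\<^sup>+x. (\<integral>\<^sup>+y. indicator ?N (x(j := y)) \<partial>dA) \<partial>PiM ?J (\<lambda>_. dA))"
      by (rule product_nn_integral_insert[of ?J j "indicator ?N"]) (use N in \<open>auto simp only: ins intro!: borel_measurable_indicator\<close>)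
    also have "\<dots> \<le> (\<integral>\<^sup>+x. (\<integral>\<^sup>+y. indicator {x k} y \<partial>dA) \<partial>PiM ?J (\<lambda>_. dA))"
      using that by (intro nn_integral_mono) (auto simp: indicator_def)
    also have "\<dots> = 0" using null by simp
    finally show "emeasure (PiM {..<n} (\<lambda>_. dA)) ?N = 0" by simp
  qed auto
  then have "AE x in PiM {..<n} (\<lambda>_. dA). \<forall>j\<in>{..<n}. \<forall>k\<in>{..<n} - {j}. x j \<noteq> x k"
    by (intro AE_finite_allI) auto
  then show ?thesis by eventually_elim (auto simp: inj_on_def)
qed

lemma emeasure_dA_ball: "r \<ge> 0 \<Longrightarrow> emeasure dA (ball z r) = ennreal (r\<^sup>2)"
  by (simp add: dA_def emeasure_density nn_integral_cmult_indicator emeasure_ball unit_ball_vol_2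
     flip: ennreal_mult)

text \<open>The normalisation of \<^const>\<open>dA\<close> gives a disc of radius \<open>r\<close> the mass \<open>r\<^sup>2\<close>.\<close>

lemma dA_ball_average_tendsto:
  fixes K :: "complex \<Rightarrow> real"
  assumes K: "continuous_on UNIV K"
  shows "((\<lambda>r. (LINT y|dA. indicator (ball z r) y * K y) / r\<^sup>2) \<longlongrightarrow> K z) (at_right 0)"
proof (rule tendstoI)
  fix e :: real assume "e > 0"
  have "isCont K z" using K by (simp add: continuous_on_eq_continuous_at)
  then obtain d where d: "d > 0" "\<And>y. dist y z < d \<Longrightarrow> dist (K y) (K z) < e / 2"
    unfolding continuous_at_eps_delta using \<open>e > 0\<close> by (metis half_gt_zero)
  have "eventually (\<lambda>r. 0 < r \<and> r < d) (at_right (0::real))"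
    using d by (auto simp: eventually_at_right_field)
  then show "eventually (\<lambda>r. dist ((LINT y|dA. indicator (ball z r) y * K y) / r\<^sup>2) (K z) < e) (at_right 0)"
  proof eventually_elim
    case (elim r)
    let ?i = "indicator (ball z r) :: complex \<Rightarrow> real"
    have fin: "emeasure dA (ball z r) < \<infinity>" using elim by (simp add: emeasure_dA_ball)
    have meas: "measure dA (ball z r) = r\<^sup>2" using elim by (simp add: measure_def emeasure_dA_ball)
    have [measurable]: "K \<in> borel_measurable borel" using K by (rule borel_measurable_continuous_onI)
    have ii: "integrable dA ?i" using fin by simp
    have ik: "integrable dA (\<lambda>y. ?i y * K y)"
    proof (rule Bochner_Integration.integrable_bound)
      show "integrable dA (\<lambda>y. (\<bar>K z\<bar> + e) * ?i y)" using ii by simp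
      show "AE y in dA. norm (?i y * K y) \<le> norm ((\<bar>K z\<bar> + e) * ?i y)"
      proof (intro always_eventually allI)
        fix y show "norm (?i y * K y) \<le> norm ((\<bar>K z\<bar> + e) * ?i y)"
          using d(2)[of y] elim \<open>e > 0\<close> by (cases "y \<in> ball z r") (simp_all add: dist_commute dist_real_def, smt (verit) field_sum_of_halves)
      qed
      show "(\<lambda>y. ?i y * K y) \<in> borel_measurable dA" unfolding borel_measurable_dA
          by (intro borel_measurable_times borel_measurable_indicator) auto
    qed
    have "(LINT y|dA. ?i y * K y) - r\<^sup>2 * K z = (LINT y|dA. ?i y * K y - ?i y * K z)"
      using ik ii meas by (simp add: Bochner_Integration.integral_diff)
    also have "norm \<dots> \<le> (LINT y|dA. e / 2 * ?i y)"
    proof (rule Bochner_Integration.integral_norm_bound_integral)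
      show "norm (?i y * K y - ?i y * K z) \<le> e / 2 * ?i y" for y
        using d(2)[of y] elim by (auto simp: indicator_def dist_norm norm_minus_commute)
    qed (use ik ii in auto)
    also have "\<dots> = e / 2 * r\<^sup>2" using meas by simp
    finally have "\<bar>(LINT y|dA. ?i y * K y) - r\<^sup>2 * K z\<bar> \<le> e / 2 * r\<^sup>2" by simp
    then have "\<bar>(LINT y|dA. ?i y * K y) / r\<^sup>2 - K z\<bar> \<le> e / 2"
      using elim by (simp add: abs_le_iff field_simps)
    then show ?case using \<open>e > 0\<close> by (simp add: dist_norm)
  qed
qed

text \<open>Summing \<open>orthogonal_det_integral\<close> over the index \<open>i\<close> of the observed point makes every permutation
  contribute the same sum over \<open>k\<close>; the number of permutations cancels with the one in the
  partition function.\<close>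

theorem one_point_eq_kernel:
  fixes Q :: "complex \<Rightarrow> real" and p :: "nat \<Rightarrow> complex poly" and m :: "nat \<Rightarrow> real"
  assumes n: "n > 0" and Q: "continuous_on UNIV Q"
    and p: "\<And>k. degree (p k) \<le> k \<and> coeff (p k) k = 1"
    and int: "\<And>j k. integrable dA (\<lambda>y. of_real (exp (- real n * Q y)) * (poly (p j) y * cnj (poly (p k) y)))"
    and orth: "\<And>j k. (LINT y|dA. of_real (exp (- real n * Q y)) * (poly (p j) y * cnj (poly (p k) y)))
        = (if j = k then of_real (m k) else 0)"
    and m: "\<And>k. m k > 0"
  shows "one_point n Q z = exp (- real n * Q z) * (\<Sum>k<n. (cmod (poly (p k) z))\<^sup>2 / m k)"
proof -
  define w where "w = (\<lambda>y. exp (- real n * Q y))"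
  define f where "f = (\<lambda>k. poly (p k))"
  define P where "P = {\<sigma>. \<sigma> permutes {0..<n}}"
  define G where "G = (\<lambda>x. (cmod (det (mat n n (\<lambda>(i, j). f j (x i)))))\<^sup>2 * (\<Prod>i<n. w (x i)))"
  define K where "K = (\<lambda>y. w y * (\<Sum>k<n. (cmod (f k y))\<^sup>2 / m k))"
  let ?M = "PiM {..<n} (\<lambda>_. dA)"
  have fin: "finite P" by (simp add: P_def finite_permutations)
  have [measurable]: "Q \<in> borel_measurable borel" using Q by (rule borel_measurable_continuous_onI)
  have fcont: "continuous_on UNIV (f k)" for k unfolding f_def by (intro continuous_intros)
  then have [measurable]: "f k \<in> borel_measurable borel" for k by (rule borel_measurable_continuous_onI)
  have [measurable]: "w \<in> borel_measurable borel" unfolding w_def by measurable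
  have AE: "AE x in ?M. exp (- energy n Q x) = G x"
    using AE_PiM_dA_inj
  proof eventually_elim
    case (elim x)
    then show ?case
      using exp_neg_energy[of x n Q] det_monic_polynomials[of n p x] p by (simp add: G_def f_def w_def)
  qed
  have [measurable]: "(\<lambda>x. energy n Q x) \<in> borel_measurable ?M"
    unfolding energy_def
    by (intro borel_measurable_add borel_measurable_sum borel_measurable_times) (auto, measurable)
  have intw: "integrable dA (\<lambda>y. of_real (w y) * (f j y * cnj (f k y)))" for j k
    using int by (simp add: w_def f_def)
  have orthw: "(LINT y|dA. of_real (w y) * (f j y * cnj (f k y))) = (if j = k then of_real (m k) else 0)" for j k
    using orth by (simp add: w_def f_def)
  have sq: "of_real (w y * (cmod (f k y))\<^sup>2) = of_real (w y) * (f k y * cnj (f k y))" for k y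
    by (simp only: of_real_mult complex_norm_square)
  have intsq: "integrable dA (\<lambda>y. w y * (cmod (f k y))\<^sup>2)" for k
    using integrable_Re[OF intw[of k k]] unfolding sq[symmetric] Re_complex_of_real .
  have norm2: "(LINT y|dA. w y * (cmod (f k y))\<^sup>2) = m k" for k
  proof -
    have "complex_of_real (LINT y|dA. w y * (cmod (f k y))\<^sup>2) = of_real (m k)"
      using orthw[of k k] unfolding sq[symmetric] integral_complex_of_real by simp
    then show ?thesis using of_real_eq_iff by blast
  qed
  have cardP: "card P = fact n" unfolding P_def by (subst card_permutations[of _ n]) auto
  have GA: "(cmod (det (mat n n (\<lambda>(i, j). f j (x i)))))\<^sup>2 * (\<Prod>i<n. w (x i)) = G x" for x
    by (simp add: G_def)
  have intw1: "integrable dA (\<lambda>y. of_real 1 * (of_real (w y) * (f j y * cnj (f k y))))" for j k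
    using intw by simp
  note od1 = orthogonal_det_integral[where g = "\<lambda>_. 1", OF sigma_finite_dA intw intw1 orthw m n, unfolded GA, folded P_def]
  have GM [measurable]: "G \<in> borel_measurable ?M"
    using borel_measurable_integrable[OF od1(1)] by simp
  have "(LINT x|?M. G x) = (\<Prod>k<n. m k) * fact n"
    using od1(2) less_imp_neq[OF m, symmetric] by (simp add: norm2 cardP)
  moreover have "partition_function n Q = (LINT x|?M. G x)"
    unfolding partition_function_def dA_prod_def using AE by (intro integral_cong_AE) measurable
  ultimately have Z: "partition_function n Q = (\<Prod>k<n. m k) * fact n" by simp
  have prodm: "(\<Prod>k<n. m k) > 0" using m by (simp add: prod_pos)
  have Zpos: "partition_function n Q > 0" unfolding Z using prodm by simp
  have main: "(LINT x|gibbs n Q. real (card {j. j < n \<and> x j \<in> ball z r})) = (LINT y|dA. indicator (ball z r) y * K y)"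
    for r
  proof -
    let ?i = "indicator (ball z r) :: complex \<Rightarrow> real"
    define c where "c = (\<lambda>k. (LINT y|dA. ?i y * (w y * (cmod (f k y))\<^sup>2)) / m k)"
    have ints: "integrable dA (\<lambda>y. ?i y * (w y * (cmod (f k y))\<^sup>2))" for k
      using integrable_real_mult_indicator[of "ball z r" dA "\<lambda>y. w y * (cmod (f k y))\<^sup>2"] intsq
      by (simp add: mult.commute)
    have intg: "integrable dA (\<lambda>y. of_real (?i y) * (of_real (w y) * (f j y * cnj (f k y))))" for j k
      using integrable_mult_indicator[of "ball z r" dA, OF _ intw[of j k]] by (simp add: scaleR_conv_of_real)
    note odi = orthogonal_det_integral[OF sigma_finite_dA intw intg orthw m, of _ n, unfolded GA, folded P_def]
    have card: "real (card {j. j < n \<and> x j \<in> ball z r}) = (\<Sum>j<n. ?i (x j))" for x :: "nat \<Rightarrow> complex"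
    proof -
      have "{j. j < n \<and> x j \<in> ball z r} = {..<n} \<inter> {j. x j \<in> ball z r}" by auto
      then show ?thesis by (simp only: indicator_def sum_of_bool_eq finite_lessThan)
    qed
    have iM: "(\<lambda>x. ?i (x j)) \<in> borel_measurable ?M" if "j < n" for j
      by (rule measurable_compose[OF measurable_PiM_dA_component[OF that]], rule borel_measurable_indicator) simp
    have siM [measurable]: "(\<lambda>x. \<Sum>j<n. ?i (x j)) \<in> borel_measurable ?M"
      by (rule borel_measurable_sum, rule iM) simp
    have eM: "(\<lambda>x. exp (- energy n Q x) / partition_function n Q) \<in> borel_measurable ?M" by measurable
    have "(LINT x|gibbs n Q. real (card {j. j < n \<and> x j \<in> ball z r}))
       = (LINT x|gibbs n Q. (\<Sum>j<n. ?i (x j)))"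
      by (simp only: card)
    also have "\<dots> = (LINT x|?M. exp (- energy n Q x) / partition_function n Q * (\<Sum>j<n. ?i (x j)))"
      unfolding gibbs_def dA_prod_def
      by (rule integral_real_density[OF eM _ siM]) (use Zpos in simp)
    also have "\<dots> = (LINT x|?M. (\<Sum>j<n. ?i (x j) * G x) / partition_function n Q)"
    proof (rule integral_cong_AE)
      show "AE x in ?M. exp (- energy n Q x) / partition_function n Q * (\<Sum>j<n. ?i (x j)) =
          (\<Sum>j<n. ?i (x j) * G x) / partition_function n Q"
        using AE
      proof eventually_elim
        case (elim x)
        have "(\<Sum>j<n. ?i (x j) * G x) = (\<Sum>j<n. ?i (x j)) * G x" by (rule sum_distrib_right[symmetric])
        then show ?case unfolding elim by (simp only: times_divide_eq_left mult.commute)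
      qed
      show "(\<lambda>x. (\<Sum>j<n. ?i (x j) * G x) / partition_function n Q) \<in> borel_measurable ?M"
        by (intro borel_measurable_divide borel_measurable_sum borel_measurable_times iM borel_measurable_const GM) simp
    qed (intro borel_measurable_times eM siM)
    also have "(LINT x|?M. (\<Sum>j<n. ?i (x j) * G x) / partition_function n Q) = (\<Sum>j<n. LINT x|?M. ?i (x j) * G x) / partition_function n Q"
      unfolding integral_divide_zero
      by (rule arg_cong[where f = "\<lambda>t. t / _"], rule Bochner_Integration.integral_sum) (use odi(1) in simp)
    also have "(\<Sum>j<n. LINT x|?M. ?i (x j) * G x) = (\<Prod>k<n. m k) * (\<Sum>j<n. \<Sum>\<sigma>\<in>P. c (\<sigma> j))"
      using odi(2) by (simp add: sum_distrib_left c_def)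
    also have "(\<Sum>j<n. \<Sum>\<sigma>\<in>P. c (\<sigma> j)) = (\<Sum>\<sigma>\<in>P. \<Sum>j<n. c (\<sigma> j))" by (rule sum.swap)
    also have "\<dots> = (\<Sum>\<sigma>\<in>P. \<Sum>k<n. c k)"
    proof (rule sum.cong)
      fix \<sigma> assume "\<sigma> \<in> P"
      then have "\<sigma> permutes {..<n}" by (simp add: P_def atLeast0LessThan)
      then show "(\<Sum>j<n. c (\<sigma> j)) = (\<Sum>k<n. c k)" using sum.permute[of \<sigma> "{..<n}" c] unfolding o_def by metis
    qed simp
    also have "\<dots> = fact n * (\<Sum>k<n. c k)" by (simp add: cardP)
    finally have "(LINT x|gibbs n Q. real (card {j. j < n \<and> x j \<in> ball z r})) =
        (\<Prod>k<n. m k) * (fact n * (\<Sum>k<n. c k)) / partition_function n Q" .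
    also have "\<dots> = (\<Sum>k<n. c k)"
      using Zpos unfolding Z mult.assoc[symmetric] by (intro nonzero_mult_div_cancel_left) linarith
    also have "\<dots> = (LINT y|dA. (\<Sum>k<n. ?i y * (w y * (cmod (f k y))\<^sup>2) / m k))"
      unfolding c_def integral_divide_zero[symmetric]
      by (rule Bochner_Integration.integral_sum[symmetric]) (use ints in simp)
    also have "\<dots> = (LINT y|dA. ?i y * K y)"
      unfolding K_def sum_distrib_left times_divide_eq_right ..
    finally show ?thesis .
  qed
  have m0: "m k \<noteq> 0" for k using m[of k] by simp
  have "continuous_on UNIV w"
    unfolding w_def by (rule continuous_on_exp, rule continuous_on_mult, rule continuous_on_const, rule Q)
  moreover have "continuous_on UNIV (\<lambda>y. \<Sum>k<n. (cmod (f k y))\<^sup>2 / m k)"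
    by (rule continuous_on_sum, rule continuous_on_divide, rule continuous_on_power,
        rule continuous_on_norm, rule fcont, rule continuous_on_const) (use m0 in simp)
  ultimately have "continuous_on UNIV K"
    unfolding K_def by (rule continuous_on_mult)
  then have "one_point n Q z = K z"
    unfolding one_point_def main by (rule tendsto_Lim[OF trivial_limit_at_right_real dA_ball_average_tendsto])
  then show ?thesis by (simp add: K_def w_def f_def)
qed

section \<open>Gaussian integrals on the line\<close>

lemma integrable_gauss:
  fixes a :: real assumes "a > 0"
  shows "integrable lborel (\<lambda>t. exp (- a * t\<^sup>2))"
proof -
  define \<sigma> where "\<sigma> = sqrt (1 / (2 * a))"
  have s: "\<sigma> > 0" "\<sigma>\<^sup>2 = 1 / (2 * a)" using assms by (auto simp: \<sigma>_def)
  have "integrable lborel (\<lambda>t. sqrt (2 * pi * \<sigma>\<^sup>2) * normal_density 0 \<sigma> t)"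
    using integrable_normal_density[OF s(1), of 0] by simp
  also have "(\<lambda>t. sqrt (2 * pi * \<sigma>\<^sup>2) * normal_density 0 \<sigma> t) = (\<lambda>t. exp (- a * t\<^sup>2))"
    using assms unfolding normal_density_def s(2) by (simp add: field_simps)
  finally show ?thesis .
qed

lemma integral_gauss:
  fixes a :: real assumes "a > 0"
  shows "(LBINT t. exp (- a * t\<^sup>2)) = sqrt (pi / a)"
proof -
  define \<sigma> where "\<sigma> = sqrt (1 / (2 * a))"
  have s: "\<sigma> > 0" "\<sigma>\<^sup>2 = 1 / (2 * a)" using assms by (auto simp: \<sigma>_def)
  have "(LBINT t. sqrt (2 * pi * \<sigma>\<^sup>2) * normal_density 0 \<sigma> t) = sqrt (2 * pi * \<sigma>\<^sup>2)"
    using integral_normal_density[OF s(1), of 0] by simp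
  also have "(\<lambda>t. sqrt (2 * pi * \<sigma>\<^sup>2) * normal_density 0 \<sigma> t) = (\<lambda>t. exp (- a * t\<^sup>2))"
    using assms unfolding normal_density_def s(2) by (simp add: field_simps)
  finally show ?thesis using s(2) assms by (simp add: field_simps)
qed

text \<open>Completing the square lets a Gaussian absorb every exponential of a linear function, hence all
  polynomials.\<close>

lemma linear_minus_square_le:
  fixes a B t :: real assumes "a > 0"
  shows "B * \<bar>t\<bar> - a * t\<^sup>2 \<le> B\<^sup>2 / (2 * a) - a / 2 * t\<^sup>2"
proof -
  have "0 \<le> (a * \<bar>t\<bar> - B)\<^sup>2 / (2 * a)" using assms by simp
  also have "\<dots> = a / 2 * t\<^sup>2 - B * \<bar>t\<bar> + B\<^sup>2 / (2 * a)"
    using assms by (simp add: power2_eq_square field_simps)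
  finally show ?thesis by linarith
qed

lemma integrable_exp_linear_gauss:
  fixes a B :: real assumes "a > 0"
  shows "integrable lborel (\<lambda>t. exp (B * \<bar>t\<bar> - a * t\<^sup>2))"
proof (rule Bochner_Integration.integrable_bound)
  show "integrable lborel (\<lambda>t. exp (B\<^sup>2 / (2 * a)) * exp (- (a / 2) * t\<^sup>2))"
    using integrable_gauss[of "a / 2"] assms by simp
  show "AE t in lborel. norm (exp (B * \<bar>t\<bar> - a * t\<^sup>2))
      \<le> norm (exp (B\<^sup>2 / (2 * a)) * exp (- (a / 2) * t\<^sup>2))"
    using linear_minus_square_le[OF assms, of B] by (simp flip: exp_add)
qed measurable

lemma exp_linear_gauss_tendsto_0:
  fixes a B :: real assumes "a > 0"
  shows "((\<lambda>t. exp (B * \<bar>t\<bar> - a * t\<^sup>2)) \<longlongrightarrow> 0) at_top"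
    and "((\<lambda>t. exp (B * \<bar>t\<bar> - a * t\<^sup>2)) \<longlongrightarrow> 0) at_bot"
proof -
  have E: "((\<lambda>t. exp (B * t - a * t\<^sup>2)) \<longlongrightarrow> 0) at_top"
  proof (rule filterlim_compose[OF exp_at_bot])
    show "filterlim (\<lambda>t. B * t - a * t\<^sup>2) at_bot at_top"
      using assms by real_asymp
  qed
  show A: "((\<lambda>t. exp (B * \<bar>t\<bar> - a * t\<^sup>2)) \<longlongrightarrow> 0) at_top"
    using E by (rule Lim_transform_eventually)
       (auto intro: eventually_mono[OF eventually_ge_at_top[of 0]])
  show "((\<lambda>t. exp (B * \<bar>t\<bar> - a * t\<^sup>2)) \<longlongrightarrow> 0) at_bot"
    using A unfolding at_bot_mirror filterlim_filtermap by simp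
qed

lemma integral_deriv_line_eq_0:
  fixes F f :: "real \<Rightarrow> complex"
  assumes F: "\<And>t. (F has_vector_derivative f t) (at t)"
    and cont: "continuous_on UNIV f" and int: "integrable lborel f"
    and lim: "(F \<longlongrightarrow> 0) at_top" "(F \<longlongrightarrow> 0) at_bot"
  shows "(LBINT t. f t) = 0"
proof -
  have "(LBINT x=-\<infinity>..\<infinity>. f x) = 0 - 0"
  proof (rule interval_integral_FTC_integrable)
    show "isCont f x" for x using cont by (simp add: continuous_on_eq_continuous_at)
    show "set_integrable lborel (einterval (-\<infinity>) \<infinity>) f"
      using int by (simp add: set_integrable_def)
    show "((F \<circ> real_of_ereal) \<longlongrightarrow> 0) (at_right (- \<infinity>))"
      "((F \<circ> real_of_ereal) \<longlongrightarrow> 0) (at_left \<infinity>)"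
      using lim by (simp_all add: ereal_tendsto_simps1)
  qed (use F in auto)
  then show ?thesis
    by (simp add: interval_lebesgue_integral_def set_lebesgue_integral_def)
qed

text \<open>The imaginary part of \<open>b\<close> disappears by translation; for real \<open>b\<close> this is the characteristic
  function of the normal distribution.\<close>

lemma integral_complex_gauss:
  fixes b :: complex and s :: real
  assumes s: "s > 0"
  shows "(LBINT t. exp ((b + \<i> * of_real t)\<^sup>2 / (2 * of_real s))) = of_real (sqrt (2 * pi * s))"
proof -
  define x where "x = Re b / sqrt s"
  have rs: "sqrt s > 0" "sqrt s * sqrt s = s" using s by auto
  have "char std_normal_distribution x = of_real (exp (- (x^2) / 2))"
    using char_std_normal_distribution by meson
  moreover have "char std_normal_distribution x =
     (LBINT t. std_normal_density t *\<^sub>R iexp (x * t))"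
    unfolding char_def by (subst integral_density) (auto simp: normal_density_nonneg)
  ultimately have C: "(LBINT t. std_normal_density t *\<^sub>R iexp (x * t)) = of_real (exp (- (x^2) / 2))"
    by simp
  have "(LBINT t. exp ((b + \<i> * of_real t)\<^sup>2 / (2 * of_real s)))
    = sqrt s *\<^sub>R (LBINT t. exp ((b + \<i> * of_real (- Im b + sqrt s * t))\<^sup>2 / (2 * of_real s)))"
    using lborel_integral_real_affine[of "sqrt s" "\<lambda>t. exp ((b + \<i> * of_real t)\<^sup>2 / (2 * of_real s))" "- Im b"] rs
    by simp
  also have "(\<lambda>t. exp ((b + \<i> * of_real (- Im b + sqrt s * t))\<^sup>2 / (2 * of_real s)))
    = (\<lambda>t. of_real (exp (x\<^sup>2 / 2) * sqrt (2 * pi)) * (std_normal_density t *\<^sub>R iexp (x * t)))"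
  proof
    fix t :: real
    have "b + \<i> * of_real (- Im b + sqrt s * t) = of_real (sqrt s) * (of_real x + \<i> * of_real t)"
      using rs by (simp add: complex_eq_iff x_def)
    then have "(b + \<i> * of_real (- Im b + sqrt s * t))\<^sup>2 / (2 * of_real s)
       = of_real (sqrt s * sqrt s) * (of_real x + \<i> * of_real t)\<^sup>2 / (2 * of_real s)"
      by (simp only: power_mult_distrib of_real_mult power2_eq_square[of "of_real (sqrt s)"])
    also have "\<dots> = (of_real x + \<i> * of_real t)\<^sup>2 / 2" using s unfolding rs by simp
    also have "\<dots> = of_real (x\<^sup>2 / 2) + of_real (- t\<^sup>2 / 2) + \<i> * of_real (x * t)"
      by (simp add: power2_eq_square field_simps complex_eq_iff)
    finally have E: "(b + \<i> * of_real (- Im b + sqrt s * t))\<^sup>2 / (2 * of_real s) = \<dots>" .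
    show "exp ((b + \<i> * of_real (- Im b + sqrt s * t))\<^sup>2 / (2 * of_real s)) =
      of_real (exp (x\<^sup>2 / 2) * sqrt (2 * pi)) * (std_normal_density t *\<^sub>R iexp (x * t))"
      unfolding E exp_add std_normal_density_def
      by (simp add: scaleR_conv_of_real exp_of_real[symmetric])
  qed
  also have "(LBINT t. of_real (exp (x\<^sup>2 / 2) * sqrt (2 * pi)) * (std_normal_density t *\<^sub>R iexp (x * t)))
     = of_real (exp (x\<^sup>2 / 2) * sqrt (2 * pi)) * of_real (exp (- (x^2) / 2))"
    unfolding integral_mult_right_zero C ..
  finally show ?thesis
    by (simp add: scaleR_conv_of_real real_sqrt_mult flip: of_real_mult)
       (simp add: exp_minus)
qed

lemma set_integral_atLeast_eq_greaterThan:
  fixes f :: "real \<Rightarrow> 'a::{banach, second_countable_topology}"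
  assumes "f \<in> borel_measurable borel"
  shows "(LBINT u:{0..}. f u) = (LBINT u:{0<..}. f u)"
  unfolding set_lebesgue_integral_def
proof (rule integral_cong_AE)
  show "AE u in lborel. indicator {0..} u *\<^sub>R f u = indicator {0<..} u *\<^sub>R f u"
    using AE_lborel_singleton[of 0] by eventually_elim (auto simp: indicator_def)
qed (use assms in measurable)

section \<open>Orthogonal polynomials for Gaussian weights in the plane\<close>

text \<open>Rescaled Hermite polynomials: with \<open>He\<^sub>k\<close> the monic Hermite polynomials of the standard normal
  distribution, \<open>P\<^sub>k(w) = s\<^bsup>k/2\<^esup> He\<^sub>k(w / \<surd>s)\<close> for \<open>s > 0\<close>. The parameter \<open>s\<close> will be the mean of \<open>w\<^sup>2\<close>
  under the Gaussian weight.\<close>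

fun hpoly :: "real \<Rightarrow> nat \<Rightarrow> complex poly" where
  "hpoly s 0 = 1"
| "hpoly s (Suc 0) = [:0, 1:]"
| "hpoly s (Suc (Suc k)) = pCons 0 (hpoly s (Suc k)) - Polynomial.smult (of_real (s * real (Suc k))) (hpoly s k)"

lemma hpoly_Suc: "hpoly s (Suc k) = pCons 0 (hpoly s k) - Polynomial.smult (of_real (s * real k)) (hpoly s (k - 1))"
  by (cases k) auto

lemma poly_hpoly_Suc:
  "poly (hpoly s (Suc k)) w = w * poly (hpoly s k) w - of_real (s * real k) * poly (hpoly s (k - 1)) w"
  by (simp only: hpoly_Suc) simp

lemma degree_hpoly: "degree (hpoly s k) \<le> k \<and> coeff (hpoly s k) k = 1"
proof (induction s k rule: hpoly.induct)
  case (3 s k)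
  have "degree (hpoly s (Suc (Suc k))) \<le> Suc (Suc k)"
    using 3 by (auto intro!: degree_diff_le order.trans[OF degree_pCons_le] order.trans[OF degree_smult_le])
  moreover have "coeff (hpoly s k) (Suc (Suc k)) = 0" using 3 by (intro coeff_eq_0) auto
  ultimately show ?case using 3 by simp
qed auto

lemma pderiv_hpoly: "pderiv (hpoly s k) = Polynomial.smult (of_nat k) (hpoly s (k - 1))"
proof (induction s k rule: hpoly.induct)
  case (3 s k)
  have "pderiv (hpoly s (Suc (Suc k))) = hpoly s (Suc k) + pCons 0 (Polynomial.smult (of_nat (Suc k)) (hpoly s k))
     - Polynomial.smult (of_real (s * real (Suc k))) (Polynomial.smult (of_nat k) (hpoly s (k - 1)))"
    using 3 by (simp add: pderiv_diff pderiv_smult pderiv_pCons)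
  also have "\<dots> = hpoly s (Suc k) + Polynomial.smult (of_nat (Suc k))
      (pCons 0 (hpoly s k) - Polynomial.smult (of_real (s * real k)) (hpoly s (k - 1)))"
    by (simp add: smult_diff_right mult_ac)
  also have "\<dots> = Polynomial.smult (of_nat (Suc (Suc k))) (hpoly s (Suc k))"
    unfolding hpoly_Suc[symmetric] of_nat_Suc[of "Suc k"] smult_add_left by simp
  finally show ?case by (simp only: diff_Suc_1)
qed (auto simp: pderiv_pCons)

text \<open>This crude bound suffices for all integrability questions below, because Gaussian weights absorb
  exponentials.\<close>

lemma poly_exp_bound:
  fixes p :: "complex poly"
  shows "\<exists>C B. C \<ge> 0 \<and> B \<ge> 0 \<and> (\<forall>w. cmod (poly p w) \<le> C * exp (B * cmod w))"
proof (induction p)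
  case (pCons a p)
  then obtain C B where CB: "C \<ge> 0" "B \<ge> 0" "\<And>w. cmod (poly p w) \<le> C * exp (B * cmod w)" by auto
  have "cmod (poly (pCons a p) w) \<le> (cmod a + C) * exp ((B + 1) * cmod w)" for w
  proof -
    have "cmod (poly (pCons a p) w) \<le> cmod a + cmod w * cmod (poly p w)"
      by (simp add: norm_triangle_le norm_mult)
    also have "\<dots> \<le> cmod a * exp ((B + 1) * cmod w) + exp (cmod w) * (C * exp (B * cmod w))"
    proof (intro add_mono mult_mono CB)
      show "cmod a \<le> cmod a * exp ((B + 1) * cmod w)" using CB by (simp add: mult_le_cancel_left1)
      show "cmod w \<le> exp (cmod w)" using exp_ge_add_one_self[of "cmod w"] by linarith
    qed auto
    also have "exp (cmod w) * (C * exp (B * cmod w)) = C * exp ((B + 1) * cmod w)"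
      by (simp add: distrib_right exp_add)
    finally show ?thesis by (simp add: distrib_right)
  qed
  then show ?case using CB by (intro exI[of _ "cmod a + C"] exI[of _ "B + 1"]) auto
qed (auto intro!: exI[of _ 0])

lemma borel_measurable_Complex [measurable]:
  "(\<lambda>(x, y). Complex x y) \<in> borel_measurable (lborel \<Otimes>\<^sub>M lborel)"
  unfolding lborel_prod measurable_lborel2
  by (intro borel_measurable_continuous_onI) (auto simp: case_prod_unfold Complex_eq intro!: continuous_intros)

lemma lborel_complex_eq_distr:
  "(lborel :: complex measure) = distr (lborel \<Otimes>\<^sub>M lborel) borel (\<lambda>(x, y). Complex x y)"
proof (rule lborel_eqI)
  fix l u :: complex assume le: "\<And>b. b \<in> Basis \<Longrightarrow> l \<bullet> b \<le> u \<bullet> b"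
  then have le': "Re l \<le> Re u" "Im l \<le> Im u"
    using le[of 1] le[of \<i>] by (auto simp: Basis_complex_def)
  have "(\<lambda>(x, y). Complex x y) -` box l u \<inter> space (lborel \<Otimes>\<^sub>M lborel)
     = {Re l<..<Re u} \<times> {Im l<..<Im u}"
    by (auto simp: box_def Basis_complex_def space_pair_measure)
  then have "emeasure (distr (lborel \<Otimes>\<^sub>M lborel) borel (\<lambda>(x, y). Complex x y)) (box l u)
     = emeasure (lborel \<Otimes>\<^sub>M lborel) ({Re l<..<Re u} \<times> {Im l<..<Im u})"
    by (subst emeasure_distr) auto
  also have "\<dots> = ennreal ((Re u - Re l) * (Im u - Im l))"
    using le' by (subst lborel.emeasure_pair_measure_Times) (auto simp: ennreal_mult)
  also have "(Re u - Re l) * (Im u - Im l) = (\<Prod>b\<in>Basis. (u - l) \<bullet> b)"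
    by (auto simp: Basis_complex_def)
  finally show "emeasure (distr (lborel \<Otimes>\<^sub>M lborel) borel (\<lambda>(x, y). Complex x y)) (box l u)
     = ennreal (\<Prod>b\<in>Basis. (u - l) \<bullet> b)" .
qed simp

lemma integrable_complex_iff:
  fixes f :: "complex \<Rightarrow> 'b::{banach, second_countable_topology}"
  assumes "f \<in> borel_measurable borel"
  shows "integrable lborel f \<longleftrightarrow> integrable (lborel \<Otimes>\<^sub>M lborel) (\<lambda>(x, y). f (Complex x y))"
  using assms unfolding lborel_complex_eq_distr
  by (subst integrable_distr_eq) (auto simp: case_prod_unfold)

lemma integral_complex_iterated:
  fixes f :: "complex \<Rightarrow> 'b::{banach, second_countable_topology}"
  assumes f: "integrable lborel f"
  shows "(LINT z|lborel. f z) = (LBINT y. LBINT x. f (Complex x y))"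
    and "(LINT z|lborel. f z) = (LBINT x. LBINT y. f (Complex x y))"
proof -
  have [measurable]: "f \<in> borel_measurable borel" using borel_measurable_integrable[OF f] by simp
  have I: "integrable (lborel \<Otimes>\<^sub>M lborel) (\<lambda>(x, y). f (Complex x y))"
    using f integrable_complex_iff[of f] by simp
  have E: "(LINT z|lborel. f z) = integral\<^sup>L (lborel \<Otimes>\<^sub>M lborel) (\<lambda>(x, y). f (Complex x y))"
    unfolding lborel_complex_eq_distr by (subst integral_distr) (auto simp: case_prod_unfold)
  show "(LINT z|lborel. f z) = (LBINT y. LBINT x. f (Complex x y))"
    unfolding E by (rule lborel_pair.integral_snd[OF I, symmetric])
  show "(LINT z|lborel. f z) = (LBINT x. LBINT y. f (Complex x y))"
    unfolding E by (rule lborel_pair.integral_fst[OF I, symmetric])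
qed

lemma integrable_complex_product:
  fixes u v :: "real \<Rightarrow> real"
  assumes u: "integrable lborel u" and v: "integrable lborel v"
  shows "integrable lborel (\<lambda>z. u (Re z) * v (Im z))"
proof -
  have [measurable]: "u \<in> borel_measurable borel" "v \<in> borel_measurable borel"
    using u v by (auto dest: borel_measurable_integrable)
  have "integrable (lborel \<Otimes>\<^sub>M lborel) (\<lambda>(x, y). u x * v y)"
  proof (rule lborel_pair.Fubini_integrable)
    show "integrable lborel (\<lambda>x. LBINT y. norm (case (x, y) of (x, y) \<Rightarrow> u x * v y))"
      using integrable_norm[OF u] by (simp add: abs_mult)
  qed (use v in auto)
  then show ?thesis by (subst integrable_complex_iff) (auto simp: case_prod_unfold)
qed

lemma integrable_complex_gauss_growth:
  fixes f :: "complex \<Rightarrow> complex" and a b :: real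
  assumes ab: "a > 0" "b > 0" and f: "f \<in> borel_measurable borel"
    and bound: "\<And>z. cmod (f z) \<le> C * exp (B * cmod z)" and C: "C \<ge> 0" and B: "B \<ge> 0"
  shows "integrable lborel (\<lambda>z. of_real (exp (- a * (Re z)\<^sup>2 - b * (Im z)\<^sup>2)) * f z)"
proof (rule Bochner_Integration.integrable_bound)
  show "integrable lborel (\<lambda>z. C * (exp (B * \<bar>Re z\<bar> - a * (Re z)\<^sup>2) * exp (B * \<bar>Im z\<bar> - b * (Im z)\<^sup>2)))"
    using integrable_complex_product[OF integrable_exp_linear_gauss[OF ab(1), of B] integrable_exp_linear_gauss[OF ab(2), of B]]
    by simp
  show "AE z in lborel. norm (of_real (exp (- a * (Re z)\<^sup>2 - b * (Im z)\<^sup>2)) * f z)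
      \<le> norm (C * (exp (B * \<bar>Re z\<bar> - a * (Re z)\<^sup>2) * exp (B * \<bar>Im z\<bar> - b * (Im z)\<^sup>2)))"
  proof (intro always_eventually allI)
    fix z
    have "B * cmod z \<le> B * (\<bar>Re z\<bar> + \<bar>Im z\<bar>)" using B cmod_le by (intro mult_left_mono)
    then have "C * exp (B * cmod z) \<le> C * exp (B * (\<bar>Re z\<bar> + \<bar>Im z\<bar>))"
      using C by (intro mult_left_mono) auto
    then have "cmod (f z) \<le> C * exp (B * (\<bar>Re z\<bar> + \<bar>Im z\<bar>))" using bound[of z] by linarith
    then have "exp (- a * (Re z)\<^sup>2 - b * (Im z)\<^sup>2) * cmod (f z)
       \<le> exp (- a * (Re z)\<^sup>2 - b * (Im z)\<^sup>2) * (C * exp (B * (\<bar>Re z\<bar> + \<bar>Im z\<bar>)))"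
      by (intro mult_left_mono) auto
    also have "\<dots> = C * (exp (B * \<bar>Re z\<bar> - a * (Re z)\<^sup>2) * exp (B * \<bar>Im z\<bar> - b * (Im z)\<^sup>2))"
      by (simp add: exp_add[symmetric] algebra_simps)
    finally show "norm (of_real (exp (- a * (Re z)\<^sup>2 - b * (Im z)\<^sup>2)) * f z)
      \<le> norm (C * (exp (B * \<bar>Re z\<bar> - a * (Re z)\<^sup>2) * exp (B * \<bar>Im z\<bar> - b * (Im z)\<^sup>2)))"
      using C by (simp add: norm_mult abs_mult)
  qed
  show "(\<lambda>z. of_real (exp (- a * (Re z)\<^sup>2 - b * (Im z)\<^sup>2)) * f z) \<in> borel_measurable lborel"
    using f by measurable
qed

lemma gauss_integration_by_parts:
  fixes F F' :: "real \<Rightarrow> complex" and a :: real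
  assumes a: "a > 0"
    and F: "\<And>t. (F has_vector_derivative F' t) (at t)" and cont: "continuous_on UNIV F'"
    and bF: "\<And>t. cmod (F t) \<le> C * exp (B * \<bar>t\<bar>)" and bF': "\<And>t. cmod (F' t) \<le> C * exp (B * \<bar>t\<bar>)"
    and C: "C \<ge> 0"
  shows "(LBINT t. of_real (exp (- a * t\<^sup>2)) * (of_real (2 * a * t) * F t - F' t)) = 0"
proof (rule integral_deriv_line_eq_0)
  let ?G = "\<lambda>t. - of_real (exp (- a * t\<^sup>2)) * F t"
  let ?g = "\<lambda>t. of_real (exp (- a * t\<^sup>2)) * (of_real (2 * a * t) * F t - F' t)"
  show "(?G has_vector_derivative ?g t) (at t)" for t
  proof -
    have "((\<lambda>t. - exp (- a * t\<^sup>2)) has_real_derivative 2 * a * t * exp (- a * t\<^sup>2)) (at t)"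
      by (auto intro!: derivative_eq_intros)
    then have "((\<lambda>t. complex_of_real (- exp (- a * t\<^sup>2))) has_vector_derivative of_real (2 * a * t * exp (- a * t\<^sup>2))) (at t)"
      by (intro has_vector_derivative_of_real) (simp add: has_real_derivative_iff_has_vector_derivative)
    from has_vector_derivative_mult[OF this F[of t]] show ?thesis by (simp add: algebra_simps)
  qed
  have contF: "continuous_on UNIV F"
    using F has_vector_derivative_continuous by (simp add: continuous_on_eq_continuous_at) blast
  show cg: "continuous_on UNIV ?g" by (intro continuous_intros contF cont)
  show "integrable lborel ?g"
  proof (rule Bochner_Integration.integrable_bound)
    show "integrable lborel (\<lambda>t. (2 * a + 1) * C * exp ((B + 1) * \<bar>t\<bar> - a * t\<^sup>2))"
      using integrable_exp_linear_gauss[OF a] by simp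
    show "?g \<in> borel_measurable lborel" using borel_measurable_continuous_onI[OF cg] by simp
    show "AE t in lborel. norm (?g t) \<le> norm ((2 * a + 1) * C * exp ((B + 1) * \<bar>t\<bar> - a * t\<^sup>2))"
    proof (intro always_eventually allI)
      fix t
      have "cmod (of_real (2 * a * t) * F t - F' t) \<le> cmod (of_real (2 * a * t) * F t) + cmod (F' t)"
        by (rule norm_triangle_ineq4)
      also have "\<dots> = 2 * a * \<bar>t\<bar> * cmod (F t) + cmod (F' t)"
        using a by (simp add: norm_mult abs_mult)
      also have "\<dots> \<le> 2 * a * \<bar>t\<bar> * (C * exp (B * \<bar>t\<bar>)) + C * exp (B * \<bar>t\<bar>)"
        using a by (intro add_mono mult_left_mono bF bF') auto
      also have "\<dots> = (2 * a * \<bar>t\<bar> + 1) * (C * exp (B * \<bar>t\<bar>))" by (simp add: algebra_simps)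
      also have "\<dots> \<le> ((2 * a + 1) * exp \<bar>t\<bar>) * (C * exp (B * \<bar>t\<bar>))"
      proof (rule mult_right_mono)
        have "\<bar>t\<bar> \<le> exp \<bar>t\<bar>" "1 \<le> exp \<bar>t\<bar>" using exp_ge_add_one_self[of "\<bar>t\<bar>"] abs_ge_zero[of t] by linarith+
        then have "2 * a * \<bar>t\<bar> + 1 \<le> 2 * a * exp \<bar>t\<bar> + exp \<bar>t\<bar>" using a by (intro add_mono mult_left_mono) auto
        then show "2 * a * \<bar>t\<bar> + 1 \<le> (2 * a + 1) * exp \<bar>t\<bar>" by (simp add: algebra_simps)
      qed (use C in simp)
      finally have "exp (- a * t\<^sup>2) * cmod (of_real (2 * a * t) * F t - F' t)
         \<le> exp (- a * t\<^sup>2) * (((2 * a + 1) * exp \<bar>t\<bar>) * (C * exp (B * \<bar>t\<bar>)))"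
        by (intro mult_left_mono) auto
      also have "\<dots> = (2 * a + 1) * C * exp ((B + 1) * \<bar>t\<bar> - a * t\<^sup>2)"
        by (simp add: exp_diff exp_add exp_minus algebra_simps field_simps)
      finally show "norm (?g t) \<le> norm ((2 * a + 1) * C * exp ((B + 1) * \<bar>t\<bar> - a * t\<^sup>2))"
        using a C by (simp add: norm_mult abs_mult)
    qed
  qed
  have bG: "norm (?G t) \<le> C * exp (B * \<bar>t\<bar> - a * t\<^sup>2)" for t
  proof -
    have "exp (- a * t\<^sup>2) * cmod (F t) \<le> exp (- a * t\<^sup>2) * (C * exp (B * \<bar>t\<bar>))"
      by (intro mult_left_mono bF) auto
    moreover have "exp (- a * t\<^sup>2) * (C * exp (B * \<bar>t\<bar>)) = C * exp (B * \<bar>t\<bar> - a * t\<^sup>2)"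
      by (simp add: exp_add[symmetric] algebra_simps)
    moreover have "norm (?G t) = exp (- a * t\<^sup>2) * cmod (F t)" by (simp add: norm_mult)
    ultimately show ?thesis by linarith
  qed
  have lim: "((\<lambda>t. C * exp (B * \<bar>t\<bar> - a * t\<^sup>2)) \<longlongrightarrow> 0) at_top" "((\<lambda>t. C * exp (B * \<bar>t\<bar> - a * t\<^sup>2)) \<longlongrightarrow> 0) at_bot"
    using exp_linear_gauss_tendsto_0[OF a, of B, THEN tendsto_mult_right_zero] by simp_all
  show "(?G \<longlongrightarrow> 0) at_top" by (rule Lim_null_comparison[OF always_eventually[OF allI[OF bG]] lim(1)])
  show "(?G \<longlongrightarrow> 0) at_bot" by (rule Lim_null_comparison[OF always_eventually[OF allI[OF bG]] lim(2)])
qed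

lemma has_vector_derivative_poly_cnj_poly:
  fixes p q :: "complex poly"
  assumes "(g has_vector_derivative g') (at x)"
  shows "((\<lambda>x. poly p (g x) * cnj (poly q (g x))) has_vector_derivative
      (g' * poly (pderiv p) (g x) * cnj (poly q (g x)) + poly p (g x) * cnj (g' * poly (pderiv q) (g x)))) (at x)"
  using has_vector_derivative_mult[OF field_vector_diff_chain_at[OF assms poly_DERIV[of p]]
     has_vector_derivative_cnj[OF field_vector_diff_chain_at[OF assms poly_DERIV[of q]]]]
  by (simp add: o_def add.commute)

lemma poly_product_line_bound:
  fixes p q :: "complex poly" and v e :: complex
  assumes e: "cmod e = 1"
  shows "\<exists>C B. C \<ge> 0 \<and> B \<ge> 0 \<and> (\<forall>t. cmod (poly p (v + e * of_real t)) * cmod (poly q (v + e * of_real t)) \<le> C * exp (B * \<bar>t\<bar>))"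
proof -
  have s: "\<exists>C B. C \<ge> 0 \<and> B \<ge> 0 \<and> (\<forall>t. cmod (poly p (v + e * of_real t)) \<le> C * exp (B * \<bar>t\<bar>))"
    for p :: "complex poly"
  proof -
    obtain C B where 1: "C \<ge> 0" "B \<ge> 0" "\<And>w. cmod (poly p w) \<le> C * exp (B * cmod w)"
      using poly_exp_bound by blast
    have "cmod (poly p (v + e * of_real t)) \<le> C * exp (B * cmod v) * exp (B * \<bar>t\<bar>)" for t
    proof -
      have "cmod (v + e * of_real t) \<le> cmod v + \<bar>t\<bar>"
        using norm_triangle_ineq[of v "e * of_real t"] e by (simp add: norm_mult)
      then have "C * exp (B * cmod (v + e * of_real t)) \<le> C * exp (B * (cmod v + \<bar>t\<bar>))"
        using 1 by (auto intro!: mult_left_mono)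
      then show ?thesis using 1(3)[of "v + e * of_real t"] by (simp add: exp_add distrib_left mult.assoc)
    qed
    then show ?thesis using 1 by (intro exI[of _ "C * exp (B * cmod v)"] exI[of _ B]) auto
  qed
  obtain C B where 1: "C \<ge> 0" "B \<ge> 0" "\<And>t. cmod (poly p (v + e * of_real t)) \<le> C * exp (B * \<bar>t\<bar>)"
    using s[of p] by blast
  obtain D E where 2: "D \<ge> 0" "E \<ge> 0" "\<And>t. cmod (poly q (v + e * of_real t)) \<le> D * exp (E * \<bar>t\<bar>)"
    using s[of q] by blast
  have "cmod (poly p (v + e * of_real t)) * cmod (poly q (v + e * of_real t)) \<le> (C * D) * exp ((B + E) * \<bar>t\<bar>)" for t
  proof -
    have "cmod (poly p (v + e * of_real t)) * cmod (poly q (v + e * of_real t))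
       \<le> (C * exp (B * \<bar>t\<bar>)) * (D * exp (E * \<bar>t\<bar>))"
      using 1 2 by (intro mult_mono) auto
    also have "\<dots> = (C * D) * exp ((B + E) * \<bar>t\<bar>)" by (simp add: exp_add distrib_right)
    finally show ?thesis .
  qed
  then show ?thesis using 1 2 by (intro exI[of _ "C * D"] exI[of _ "B + E"]) auto
qed

text \<open>One formula for both coordinate directions: \<open>e = 1\<close> and \<open>e = \<i>\<close> parametrise horizontal and
  vertical lines.\<close>

lemma gauss_poly_parts_line:
  fixes p q :: "complex poly" and v e :: complex
  assumes a: "a > 0" and e: "cmod e = 1"
  shows "(LBINT t. of_real (exp (- a * t\<^sup>2)) * (of_real (2 * a * t) * (poly p (v + e * of_real t) * cnj (poly q (v + e * of_real t)))
     - (e * poly (pderiv p) (v + e * of_real t) * cnj (poly q (v + e * of_real t))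
        + poly p (v + e * of_real t) * cnj (e * poly (pderiv q) (v + e * of_real t))))) = 0"
proof -
  let ?g = "\<lambda>t. v + e * of_real t"
  let ?p = "\<lambda>t. poly p (?g t)" and ?q = "\<lambda>t. poly q (?g t)"
  let ?p' = "\<lambda>t. poly (pderiv p) (?g t)" and ?q' = "\<lambda>t. poly (pderiv q) (?g t)"
  note bound = poly_product_line_bound[OF e]
  obtain C0 B0 where 0: "C0 \<ge> 0" "B0 \<ge> 0" "\<And>t. cmod (?p t) * cmod (?q t) \<le> C0 * exp (B0 * \<bar>t\<bar>)"
    using bound[where p = p and q = q] by blast
  obtain C1 B1 where 1: "C1 \<ge> 0" "B1 \<ge> 0" "\<And>t. cmod (?p' t) * cmod (?q t) \<le> C1 * exp (B1 * \<bar>t\<bar>)"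
    using bound[where p = "pderiv p" and q = q] by blast
  obtain C2 B2 where 2: "C2 \<ge> 0" "B2 \<ge> 0" "\<And>t. cmod (?p t) * cmod (?q' t) \<le> C2 * exp (B2 * \<bar>t\<bar>)"
    using bound[where p = p and q = "pderiv q"] by blast
  define C where "C = C0 + C1 + C2"
  define B where "B = B0 + B1 + B2"
  have mono: "D * exp (B' * \<bar>t\<bar>) \<le> D * exp (B * \<bar>t\<bar>)" if "B' \<le> B" "D \<ge> 0" for D B' t
    using that by (auto intro!: mult_left_mono mult_right_mono)
  have m0: "C0 * exp (B0 * \<bar>t\<bar>) \<le> C0 * exp (B * \<bar>t\<bar>)" and m1: "C1 * exp (B1 * \<bar>t\<bar>) \<le> C1 * exp (B * \<bar>t\<bar>)"
    and m2: "C2 * exp (B2 * \<bar>t\<bar>) \<le> C2 * exp (B * \<bar>t\<bar>)" for t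
    using 0(1,2) 1(1,2) 2(1,2) mono[of B0 C0 t] mono[of B1 C1 t] mono[of B2 C2 t] by (auto simp: B_def)
  have nn: "0 \<le> C0 * exp (B * \<bar>t\<bar>)" "0 \<le> C1 * exp (B * \<bar>t\<bar>)" "0 \<le> C2 * exp (B * \<bar>t\<bar>)" for t
    using 0 1 2 by auto
  show ?thesis
  proof (rule gauss_integration_by_parts[OF a, where C = C and B = B])
    have g: "((\<lambda>t. v + e * of_real t) has_vector_derivative e) (at t)" for t
      by (auto intro!: derivative_eq_intros)
    show "((\<lambda>t. ?p t * cnj (?q t)) has_vector_derivative
        (e * ?p' t * cnj (?q t)
        + ?p t * cnj (e * ?q' t))) (at t)" for t
      by (rule has_vector_derivative_poly_cnj_poly[OF g])
    show "continuous_on UNIV (\<lambda>t. e * ?p' t * cnj (?q t)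
        + ?p t * cnj (e * ?q' t))"
      by (intro continuous_intros)
    show "C \<ge> 0" using 0 1 2 by (simp add: C_def)
    show "cmod (?p t * cnj (?q t)) \<le> C * exp (B * \<bar>t\<bar>)" for t
      using 0(3)[of t] m0[of t] nn[of t] by (simp only: C_def distrib_right norm_mult complex_mod_cnj)
    show "cmod (e * ?p' t * cnj (?q t)
        + ?p t * cnj (e * ?q' t)) \<le> C * exp (B * \<bar>t\<bar>)" for t
      using norm_triangle_ineq[of "e * ?p' t * cnj (?q t)"
          "?p t * cnj (e * ?q' t)"]
        1(3)[of t] 2(3)[of t] m1[of t] m2[of t] nn[of t]
      by (simp only: C_def distrib_right norm_mult complex_mod_cnj e mult_1 mult.assoc)
  qed
qed

context
  fixes a b :: real
  assumes a: "a > 0" and b: "b > 0"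
begin

abbreviation (input) gw :: "complex \<Rightarrow> real" where
  "gw z \<equiv> exp (- a * (Re z)\<^sup>2 - b * (Im z)\<^sup>2)"

abbreviation (input) gp :: "complex poly \<Rightarrow> complex poly \<Rightarrow> complex \<Rightarrow> complex" where
  "gp p q z \<equiv> of_real (gw z) * (poly p z * cnj (poly q z))"

lemma integrable_gauss_poly:
  "integrable lborel (\<lambda>z. gp p q z)"
proof -
  obtain C B where 1: "C \<ge> 0" "B \<ge> 0" "\<And>w. cmod (poly p w) \<le> C * exp (B * cmod w)"
    using poly_exp_bound by blast
  obtain D E where 2: "D \<ge> 0" "E \<ge> 0" "\<And>w. cmod (poly q w) \<le> D * exp (E * cmod w)"
    using poly_exp_bound by blast
  show ?thesis
  proof (rule integrable_complex_gauss_growth[OF a b])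
    show "(\<lambda>z. poly p z * cnj (poly q z)) \<in> borel_measurable borel"
      by (intro borel_measurable_continuous_onI continuous_intros)
    fix z
    have "cmod (poly p z * cnj (poly q z)) \<le> (C * exp (B * cmod z)) * (D * exp (E * cmod z))"
      unfolding norm_mult complex_mod_cnj using 1 2 by (intro mult_mono) auto
    then show "cmod (poly p z * cnj (poly q z)) \<le> (C * D) * exp ((B + E) * cmod z)"
      by (simp add: exp_add algebra_simps)
  qed (use 1 2 in auto)
qed

definition gauss_inner :: "complex poly \<Rightarrow> complex poly \<Rightarrow> complex" where
  "gauss_inner p q = (LINT z|lborel. gp p q z)"

lemma gauss_inner_combination:
  "(LINT z|lborel. c1 * (gp p1 q1 z) + c2 * (gp p2 q2 z)
     - (c3 * (gp p3 q3 z) + c4 * (gp p4 q4 z)))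
   = c1 * gauss_inner p1 q1 + c2 * gauss_inner p2 q2 - (c3 * gauss_inner p3 q3 + c4 * gauss_inner p4 q4)" (is ?E)
  "integrable lborel (\<lambda>z. c1 * (gp p1 q1 z) + c2 * (gp p2 q2 z)
     - (c3 * (gp p3 q3 z) + c4 * (gp p4 q4 z)))" (is ?I)
proof -
  show ?I
    by (intro Bochner_Integration.integrable_diff Bochner_Integration.integrable_add integrable_mult_right integrable_gauss_poly)
  show ?E
    unfolding gauss_inner_def by (simp only: Bochner_Integration.integral_diff Bochner_Integration.integral_add integral_mult_right_zero
        Bochner_Integration.integrable_add integrable_mult_right integrable_gauss_poly)
qed

text \<open>Integration by parts in the real part, with \<open>2 Re z = z + cnj z\<close> so that all terms stay
  sesquilinear in polynomials.\<close>

lemma gauss_parts_Re: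
  "of_real a * gauss_inner (pCons 0 p) q + of_real a * gauss_inner p (pCons 0 q) = gauss_inner (pderiv p) q + gauss_inner p (pderiv q)"
proof -
  let ?W = "\<lambda>z. of_real a * (gp (pCons 0 p) q z) + of_real a * (gp p (pCons 0 q) z)
     - (1 * (gp (pderiv p) q z) + 1 * (gp p (pderiv q) z))"
  have "(LINT z|lborel. ?W z) = (LBINT y. LBINT x. ?W (Complex x y))"
    by (rule integral_complex_iterated(1)[OF gauss_inner_combination(2)])
  also have "\<dots> = (LBINT (y::real). 0)"
  proof (rule Bochner_Integration.integral_cong[OF refl])
    fix y
    have Z: "(LBINT x. of_real (exp (- a * x\<^sup>2)) * (of_real (2 * a * x) * (poly p (Complex x y) * cnj (poly q (Complex x y)))
       - (poly (pderiv p) (Complex x y) * cnj (poly q (Complex x y)) + poly p (Complex x y) * cnj (poly (pderiv q) (Complex x y))))) = 0"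
      using gauss_poly_parts_line[OF a, of 1 p "\<i> * of_real y" q] by (simp add: Complex_eq add.commute)
    have W: "?W (Complex x y) = of_real (exp (- b * y\<^sup>2)) * (of_real (exp (- a * x\<^sup>2)) * (of_real (2 * a * x) * (poly p (Complex x y) * cnj (poly q (Complex x y)))
       - (poly (pderiv p) (Complex x y) * cnj (poly q (Complex x y)) + poly p (Complex x y) * cnj (poly (pderiv q) (Complex x y)))))" for x
    proof -
      have 1: "complex_of_real (exp (- a * x\<^sup>2 - b * y\<^sup>2)) = of_real (exp (- b * y\<^sup>2)) * of_real (exp (- a * x\<^sup>2))"
        unfolding of_real_mult[symmetric] exp_add[symmetric] by simp
      have 2: "of_real (2 * a * x) = of_real a * (Complex x y + cnj (Complex x y))"
        by (simp add: complex_eq_iff)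
      show ?thesis unfolding complex.sel 1 2 by (simp add: algebra_simps)
    qed
    show "(LBINT x. ?W (Complex x y)) = 0" unfolding W integral_mult_right_zero Z by simp
  qed
  finally show ?thesis
    unfolding gauss_inner_combination(1) by simp
qed

text \<open>Integration by parts in the imaginary part, with \<open>2 \<i> Im z = z - cnj z\<close>.\<close>

lemma gauss_parts_Im:
  "of_real b * gauss_inner (pCons 0 p) q - of_real b * gauss_inner p (pCons 0 q) = gauss_inner p (pderiv q) - gauss_inner (pderiv p) q"
proof -
  let ?W = "\<lambda>z. of_real b * (gp (pCons 0 p) q z) + (- of_real b) * (gp p (pCons 0 q) z)
     - ((-1) * (gp (pderiv p) q z) + 1 * (gp p (pderiv q) z))"
  have "(LINT z|lborel. ?W z) = (LBINT x. LBINT y. ?W (Complex x y))"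
    by (rule integral_complex_iterated(2)[OF gauss_inner_combination(2)])
  also have "\<dots> = (LBINT (y::real). 0)"
  proof (rule Bochner_Integration.integral_cong[OF refl])
    fix x
    have Z: "(LBINT y. of_real (exp (- b * y\<^sup>2)) * (of_real (2 * b * y) * (poly p (Complex x y) * cnj (poly q (Complex x y)))
       - (\<i> * poly (pderiv p) (Complex x y) * cnj (poly q (Complex x y)) + poly p (Complex x y) * cnj (\<i> * poly (pderiv q) (Complex x y))))) = 0"
      using gauss_poly_parts_line[OF b, of \<i> p "of_real x" q] by (simp add: Complex_eq)
    have W: "?W (Complex x y) = \<i> * of_real (exp (- a * x\<^sup>2)) * (of_real (exp (- b * y\<^sup>2)) * (of_real (2 * b * y) * (poly p (Complex x y) * cnj (poly q (Complex x y)))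
       - (\<i> * poly (pderiv p) (Complex x y) * cnj (poly q (Complex x y)) + poly p (Complex x y) * cnj (\<i> * poly (pderiv q) (Complex x y)))))" for y
    proof -
      have 1: "complex_of_real (exp (- a * x\<^sup>2 - b * y\<^sup>2)) = of_real (exp (- b * y\<^sup>2)) * of_real (exp (- a * x\<^sup>2))"
        unfolding of_real_mult[symmetric] exp_add[symmetric] by simp
      have 2: "of_real (2 * b * y) = - \<i> * of_real b * (Complex x y - cnj (Complex x y))"
        by (simp add: complex_eq_iff)
      show ?thesis unfolding complex.sel 1 2 by (simp add: algebra_simps)
    qed
    show "(LBINT y. ?W (Complex x y)) = 0" unfolding W integral_mult_right_zero Z by simp
  qed
  finally show ?thesis
    unfolding gauss_inner_combination(1) by simp
qed

text \<open>Half the sum of the two integrations by parts. It expresses multiplication by \<open>z\<close> through the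
  derivatives in both arguments, with the weights \<open>s\<close> and \<open>m\<close>, the means of \<open>z\<^sup>2\<close> and \<open>\<bar>z\<bar>\<^sup>2\<close>.\<close>

lemma gauss_inner_multiply:
  "gauss_inner (pCons 0 p) q = of_real (1 / (2 * a) - 1 / (2 * b)) * gauss_inner (pderiv p) q + of_real (1 / (2 * a) + 1 / (2 * b)) * gauss_inner p (pderiv q)"
proof -
  define X Y P Q where "X = gauss_inner (pCons 0 p) q" "Y = gauss_inner p (pCons 0 q)" "P = gauss_inner (pderiv p) q" "Q = gauss_inner p (pderiv q)"
  have "of_real a * (X + Y) = P + Q" "of_real b * (X - Y) = Q - P"
    using gauss_parts_Re[of p q] gauss_parts_Im[of p q] by (simp_all add: X_Y_P_Q_def algebra_simps)
  then have *: "X + Y = (P + Q) / of_real a" "X - Y = (Q - P) / of_real b"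
    using a b by (simp_all add: eq_divide_eq mult.commute)
  have "X = ((X + Y) + (X - Y)) / 2" by simp
  also have "\<dots> = of_real (1 / (2 * a) - 1 / (2 * b)) * P + of_real (1 / (2 * a) + 1 / (2 * b)) * Q"
    unfolding * by (simp add: add_divide_distrib diff_divide_distrib algebra_simps)
  finally show ?thesis by (simp add: X_Y_P_Q_def)
qed

lemma gauss_inner_diff_left: "gauss_inner (p - Polynomial.smult c r) q = gauss_inner p q - c * gauss_inner r q"
  using gauss_inner_combination(1)[of 1 p q 0 p q c r q 0 r q] unfolding gauss_inner_def by (simp add: algebra_simps)

lemma gauss_inner_smult: "gauss_inner (Polynomial.smult c p) q = c * gauss_inner p q" "gauss_inner p (Polynomial.smult c q) = cnj c * gauss_inner p q"
proof -
  show "gauss_inner (Polynomial.smult c p) q = c * gauss_inner p q"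
    unfolding gauss_inner_def integral_mult_right_zero[symmetric] by (simp add: mult_ac)
  show "gauss_inner p (Polynomial.smult c q) = cnj c * gauss_inner p q"
    unfolding gauss_inner_def integral_mult_right_zero[symmetric] by (simp add: mult_ac)
qed

lemma gauss_inner_cnj: "gauss_inner q p = cnj (gauss_inner p q)"
proof -
  have "cnj (gauss_inner p q) = (LINT z|lborel. cnj (gp p q z))"
    unfolding gauss_inner_def
    by (rule integral_bounded_linear[OF bounded_linear_cnj integrable_gauss_poly, symmetric])
  also have "\<dots> = gauss_inner q p" unfolding gauss_inner_def by (simp add: mult_ac)
  finally show ?thesis by simp
qed

lemma gauss_inner_one: "gauss_inner 1 1 = of_real (pi / sqrt (a * b))"
proof -
  have "gauss_inner 1 1 = of_real (LINT z|lborel. gw z)" unfolding gauss_inner_def by simp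
  also have "(LINT z|lborel. gw z) = (LBINT y. LBINT x. gw (Complex x y))"
    using integrable_Re[OF integrable_gauss_poly[of 1 1]] by (intro integral_complex_iterated(1)) simp
  also have "\<dots> = (LBINT y. LBINT x. exp (- b * y\<^sup>2) * exp (- a * x\<^sup>2))"
    by (simp add: exp_add[symmetric] add.commute)
  also have "\<dots> = sqrt (pi / a) * sqrt (pi / b)"
    unfolding integral_mult_right_zero integral_mult_left_zero integral_gauss[OF a] integral_gauss[OF b] by (rule mult.commute)
  also have "\<dots> = pi / sqrt (a * b)"
    using a b by (simp add: real_sqrt_divide real_sqrt_mult)
  finally show ?thesis .
qed

text \<open>By \<open>gauss_inner_multiply\<close> and the recurrence, raising the degree on the left costs a derivative on
  the right: \<open>\<langle>P\<^bsub>j+1\<^esub>, q\<rangle> = m \<langle>P\<^sub>j, q'\<rangle>\<close>. As \<open>P\<^sub>k' = k P\<^bsub>k-1\<^esub>\<close>, both degrees descend together.\<close>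

lemma gauss_inner_hpoly:
  defines "s \<equiv> 1 / (2 * a) - 1 / (2 * b)" and "m \<equiv> 1 / (2 * a) + 1 / (2 * b)"
  shows "gauss_inner (hpoly s j) (hpoly s k) = (if j = k then of_real (fact k * m ^ k * (pi / sqrt (a * b))) else 0)"
proof (induction j arbitrary: k)
  have step: "gauss_inner (hpoly s (Suc j)) q = of_real m * gauss_inner (hpoly s j) (pderiv q)" for j q
  proof -
    have "gauss_inner (hpoly s (Suc j)) q = gauss_inner (pCons 0 (hpoly s j)) q - of_real (s * real j) * gauss_inner (hpoly s (j - 1)) q"
      unfolding hpoly_Suc gauss_inner_diff_left ..
    also have "\<dots> = of_real m * gauss_inner (hpoly s j) (pderiv q)"
      unfolding gauss_inner_multiply pderiv_hpoly gauss_inner_smult s_def[symmetric] m_def[symmetric] by simp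
    finally show ?thesis .
  qed
  have z: "gauss_inner (hpoly s (Suc j)) (hpoly s 0) = 0" for j unfolding step by (simp add: gauss_inner_def)
  {
    case 0
    show ?case
    proof (cases k)
      case 0 then show ?thesis using gauss_inner_one by simp
    next
      case (Suc i) then show ?thesis using z[of i] gauss_inner_cnj[of "hpoly s 0" "hpoly s k"] by simp
    qed
  next
    case (Suc j)
    show ?case
    proof (cases k)
      case 0 then show ?thesis using z[of j] by simp
    next
      case (Suc i)
      have "gauss_inner (hpoly s (Suc j)) (hpoly s k) = of_real m * (of_nat (Suc i) * gauss_inner (hpoly s j) (hpoly s i))"
        unfolding step Suc pderiv_hpoly gauss_inner_smult by simp
      then show ?thesis unfolding Suc.IH by (simp add: Suc mult_ac)
    qed
  }
qed

end

section \<open>The one-point function as an integral of two polynomials\<close>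

lemma integral_dA:
  fixes f :: "complex \<Rightarrow> complex"
  assumes "integrable lborel f"
  shows "integrable dA f" "(LINT z|dA. f z) = of_real (1 / pi) * (LINT z|lborel. f z)"
proof -
  have f: "f \<in> borel_measurable lborel" using assms by (rule borel_measurable_integrable)
  show "integrable dA f"
    unfolding dA_def using assms f by (subst integrable_density) auto
  show "(LINT z|dA. f z) = of_real (1 / pi) * (LINT z|lborel. f z)"
    unfolding dA_def using f by (subst integral_density) (auto simp: scaleR_conv_of_real)
qed

lemma one_point_gauss_sum:
  fixes a b :: real
  defines "s \<equiv> 1 / (2 * a) - 1 / (2 * b)" and "m \<equiv> 1 / (2 * a) + 1 / (2 * b)"
  assumes ab: "a > 0" "b > 0" and n: "n > 0"
    and Q: "\<And>z. real n * Q z = a * (Re z)\<^sup>2 + b * (Im z)\<^sup>2"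
  shows "one_point n Q z = sqrt (a * b) * exp (- a * (Re z)\<^sup>2 - b * (Im z)\<^sup>2) *
      (\<Sum>k<n. (cmod (poly (hpoly s k) z))\<^sup>2 / (fact k * m ^ k))"
proof -
  have m: "m > 0" using ab by (simp add: m_def add_pos_pos)
  have ab0: "sqrt (a * b) > 0" using ab by simp
  have Q': "Q z = (a * (Re z)\<^sup>2 + b * (Im z)\<^sup>2) / real n" for z
    using Q[of z] n by (simp add: field_simps)
  have w: "exp (- real n * Q z) = exp (- a * (Re z)\<^sup>2 - b * (Im z)\<^sup>2)" for z
    using Q[of z] by simp
  have int: "integrable lborel (\<lambda>y. of_real (exp (- real n * Q y)) * (poly (hpoly s j) y * cnj (poly (hpoly s k) y)))" for j k
    unfolding w by (rule integrable_gauss_poly[OF ab])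
  have "one_point n Q z = exp (- real n * Q z) * (\<Sum>k<n. (cmod (poly (hpoly s k) z))\<^sup>2 / (fact k * m ^ k / sqrt (a * b)))"
  proof (rule one_point_eq_kernel[OF n])
    show "continuous_on UNIV Q" unfolding Q' by (intro continuous_intros) (use n in auto)
    show "degree (hpoly s k) \<le> k \<and> coeff (hpoly s k) k = 1" for k by (rule degree_hpoly)
    show "integrable dA (\<lambda>y. of_real (exp (- real n * Q y)) * (poly (hpoly s j) y * cnj (poly (hpoly s k) y)))" for j k
      by (rule integral_dA[OF int])
    show "(LINT y|dA. of_real (exp (- real n * Q y)) * (poly (hpoly s j) y * cnj (poly (hpoly s k) y)))
        = (if j = k then of_real (fact k * m ^ k / sqrt (a * b)) else 0)" for j k
      unfolding integral_dA(2)[OF int]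
      using gauss_inner_hpoly[OF ab, of j k] unfolding w gauss_inner_def[OF ab] s_def[symmetric] m_def[symmetric]
      by simp
    show "fact k * m ^ k / sqrt (a * b) > 0" for k using m ab0 by simp
  qed
  then show ?thesis unfolding w by (simp add: sum_distrib_left mult_ac)
qed

text \<open>A differential form of the Christoffel-Darboux identity. The left side is the derivative of
  \<open>\<Sum> \<bar>P\<^sub>k\<bar>\<^sup>2 / (k! m\<^sup>k)\<close> in the real direction, and the first term on the right cancels against the
  derivative of \<open>exp (- a x\<^sup>2)\<close>. In the induction step everything reduces to \<open>a (m + s) = 1\<close>.\<close>

lemma hpoly_christoffel_darboux:
  fixes a b :: real
  defines "s \<equiv> 1 / (2 * a) - 1 / (2 * b)" and "m \<equiv> 1 / (2 * a) + 1 / (2 * b)"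
  assumes ab: "a > 0" "b > 0"
  shows "(\<Sum>k<Suc n. 2 * Re (of_nat k * poly (hpoly s (k - 1)) z * cnj (poly (hpoly s k) z)) / (fact k * m ^ k))
    = 2 * a * Re z * (\<Sum>k<Suc n. (cmod (poly (hpoly s k) z))\<^sup>2 / (fact k * m ^ k))
      - 2 * a * Re (poly (hpoly s (Suc n)) z * cnj (poly (hpoly s n) z)) / (fact n * m ^ n)"
proof (induction n)
  case 0
  show ?case by simp
next
  case (Suc n)
  have m: "m > 0" using ab by (simp add: m_def add_pos_pos)
  have ms: "a * (m + s) = 1" using ab by (simp add: m_def s_def field_simps)
  define p q where "p = poly (hpoly s (Suc n)) z" and "q = poly (hpoly s n) z"
  have r: "poly (hpoly s (Suc (Suc n))) z = z * p - of_real (s * real (Suc n)) * q"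
    by (simp add: poly_hpoly_Suc[of s "Suc n"] p_def q_def)
  have zp: "Re (z * p * cnj p) = Re z * (cmod p)\<^sup>2"
    by (simp add: cmod_power2 algebra_simps) (simp add: power2_eq_square algebra_simps)
  have pq: "Re (p * cnj q) = Re (q * cnj p)" by (simp add: mult.commute)
  have R: "Re (poly (hpoly s (Suc (Suc n))) z * cnj p) = Re z * (cmod p)\<^sup>2 - s * real (Suc n) * Re (q * cnj p)"
  proof -
    have "poly (hpoly s (Suc (Suc n))) z * cnj p = z * p * cnj p - of_real (s * real (Suc n)) * (q * cnj p)"
      unfolding r by (simp add: algebra_simps)
    moreover have "Re (of_real r * w) = r * Re w" for r w by simp
    ultimately show ?thesis by (simp only: minus_complex.sel zp)
  qed
  define X c N where "X = Re (q * cnj p)" and "c = fact n * m ^ n" and "N = real (Suc n)"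
  have c: "c > 0" and N: "N > 0" using m by (auto simp: c_def N_def)
  have f: "fact (Suc n) * m ^ Suc n = N * m * c" by (simp add: c_def N_def algebra_simps)
  have t: "Re (of_nat (Suc n) * poly (hpoly s (Suc n - 1)) z * cnj (poly (hpoly s (Suc n)) z)) = N * X"
    unfolding X_def N_def p_def q_def by (simp add: algebra_simps)
  have "(\<Sum>k<Suc (Suc n). 2 * Re (of_nat k * poly (hpoly s (k - 1)) z * cnj (poly (hpoly s k) z)) / (fact k * m ^ k))
    = 2 * a * Re z * (\<Sum>k<Suc n. (cmod (poly (hpoly s k) z))\<^sup>2 / (fact k * m ^ k))
      - 2 * a * X / c + 2 * (N * X) / (N * m * c)"
    unfolding sum.lessThan_Suc[of _ "Suc n"] Suc.IH t f
    by (simp only: p_def[symmetric] q_def[symmetric] pq X_def[symmetric] c_def[symmetric] mult.assoc)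
  also have "\<dots> = 2 * a * Re z * (\<Sum>k<Suc n. (cmod (poly (hpoly s k) z))\<^sup>2 / (fact k * m ^ k))
      + (- (2 * a * X / c) + 2 * (N * X) / (N * m * c))" by linarith
  also have "- (2 * a * X / c) + 2 * (N * X) / (N * m * c)
      = 2 * a * Re z * ((cmod p)\<^sup>2 / (N * m * c)) - 2 * a * (Re z * (cmod p)\<^sup>2 - s * N * X) / (N * m * c)"
  proof -
    have "2 * (N * X) / (N * m * c) = 2 * (a * (m + s)) * X / (m * c)" unfolding ms using N by simp
    also have "\<dots> = 2 * a * X / c + 2 * a * (s * N * X) / (N * m * c)"
      using N m c by (simp add: field_simps)
    finally show ?thesis using N m c by (simp add: diff_divide_distrib algebra_simps)
  qed
  finally show ?case
    unfolding sum.lessThan_Suc[of "\<lambda>k. (cmod (poly (hpoly s k) z))\<^sup>2 / (fact k * m ^ k)" "Suc n"] f p_def[symmetric] R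
    by (simp only: X_def[symmetric] N_def[symmetric] distrib_left add_diff_eq)
qed

lemma gauss_poly_line_integrable:
  fixes p q :: "complex poly"
  assumes a: "a > 0"
  shows "integrable lborel (\<lambda>t. exp (- a * t\<^sup>2) * Re (poly p (v + of_real t) * cnj (poly q (v + of_real t))))"
    and "((\<lambda>t. exp (- a * t\<^sup>2) * Re (poly p (v + of_real t) * cnj (poly q (v + of_real t)))) \<longlongrightarrow> 0) at_top"
proof -
  obtain C B where CB: "C \<ge> 0" "B \<ge> 0" "\<And>t. cmod (poly p (v + of_real t)) * cmod (poly q (v + of_real t)) \<le> C * exp (B * \<bar>t\<bar>)"
    using poly_product_line_bound[of 1 p v q] by auto
  let ?f = "\<lambda>t. exp (- a * t\<^sup>2) * Re (poly p (v + of_real t) * cnj (poly q (v + of_real t)))"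
  have b: "norm (?f t) \<le> C * exp (B * \<bar>t\<bar> - a * t\<^sup>2)" for t
  proof -
    have "\<bar>Re (poly p (v + of_real t) * cnj (poly q (v + of_real t)))\<bar> \<le> C * exp (B * \<bar>t\<bar>)"
      using order.trans[OF abs_Re_le_cmod CB(3)[of t, folded complex_mod_cnj[of "poly q (v + of_real t)"] norm_mult]] .
    then have "norm (?f t) \<le> exp (- a * t\<^sup>2) * (C * exp (B * \<bar>t\<bar>))"
      by (simp add: abs_mult)
    also have "\<dots> = C * exp (B * \<bar>t\<bar> - a * t\<^sup>2)" by (simp add: exp_add[symmetric] algebra_simps)
    finally show ?thesis .
  qed
  show "integrable lborel ?f"
  proof (rule Bochner_Integration.integrable_bound)
    show "integrable lborel (\<lambda>t. C * exp (B * \<bar>t\<bar> - a * t\<^sup>2))"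
      using integrable_exp_linear_gauss[OF a] by simp
    have "continuous_on UNIV ?f" by (intro continuous_intros)
    then show "?f \<in> borel_measurable lborel" using borel_measurable_continuous_onI by simp
    show "AE t in lborel. norm (?f t) \<le> norm (C * exp (B * \<bar>t\<bar> - a * t\<^sup>2))"
      using b CB(1) by (auto intro!: always_eventually simp: abs_mult)
  qed
  have "((\<lambda>t. C * exp (B * \<bar>t\<bar> - a * t\<^sup>2)) \<longlongrightarrow> 0) at_top"
    by (rule tendsto_mult_right_zero[OF exp_linear_gauss_tendsto_0(1)[OF a]])
  then show "(?f \<longlongrightarrow> 0) at_top"
    by (rule Lim_null_comparison[OF always_eventually[OF allI[OF b]]])
qed

text \<open>The weighted sum vanishes at infinity, so it is the integral of minus its derivative over a
  half-line. The free parameter \<open>D\<close> is the unit of length on that half-line.\<close>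

lemma one_point_gauss_integral:
  fixes a b D :: real
  defines "s \<equiv> 1 / (2 * a) - 1 / (2 * b)" and "m \<equiv> 1 / (2 * a) + 1 / (2 * b)"
  assumes ab: "a > 0" "b > 0" and D: "D > 0"
    and Q: "\<And>z. real (Suc n) * Q z = a * (Re z)\<^sup>2 + b * (Im z)\<^sup>2"
  shows "one_point (Suc n) Q z = sqrt (a * b) * exp (- b * (Im z)\<^sup>2) * (2 * a / (D * (fact n * m ^ n))) *
     (LBINT u:{0..}. exp (- a * (Re z + u / D)\<^sup>2) *
        Re (poly (hpoly s (Suc n)) (z + of_real (u / D)) * cnj (poly (hpoly s n) (z + of_real (u / D)))))"
proof -
  define T where "T = (\<lambda>z. \<Sum>k<Suc n. (cmod (poly (hpoly s k) z))\<^sup>2 / (fact k * m ^ k))"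
  \<comment> \<open>The imaginary part stays fixed; the real part is the variable of differentiation.\<close>
  define v where "v = z - of_real (Re z)"
  define h where "h = (\<lambda>t. exp (- a * t\<^sup>2) * Re (poly (hpoly s (Suc n)) (v + of_real t) * cnj (poly (hpoly s n) (v + of_real t))))"
  have T: "(\<Sum>k<Suc n. (cmod (poly (hpoly s k) z))\<^sup>2 / (fact k * m ^ k)) = T z" for z
    by (simp only: T_def)
  define K where "K = 2 * a / (fact n * m ^ n)"
  define E where "E = (\<lambda>t. exp (- a * t\<^sup>2) * T (v + of_real t))"
  have dT: "((\<lambda>t. T (v + of_real t)) has_real_derivative
       (\<Sum>k<Suc n. 2 * Re (of_nat k * poly (hpoly s (k - 1)) (v + of_real t) * cnj (poly (hpoly s k) (v + of_real t))) / (fact k * m ^ k))) (at t)" for t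
    unfolding T_def
  proof (rule DERIV_sum)
    fix k
    have g: "((\<lambda>t. v + of_real t) has_vector_derivative 1) (at t)"
      by (auto intro!: derivative_eq_intros)
    have 1: "((\<lambda>t. Re (poly (hpoly s k) (v + of_real t) * cnj (poly (hpoly s k) (v + of_real t)))) has_real_derivative
       Re (1 * poly (pderiv (hpoly s k)) (v + of_real t) * cnj (poly (hpoly s k) (v + of_real t))
         + poly (hpoly s k) (v + of_real t) * cnj (1 * poly (pderiv (hpoly s k)) (v + of_real t)))) (at t)"
      unfolding has_real_derivative_iff_has_vector_derivative
      by (rule bounded_linear.has_vector_derivative[OF bounded_linear_Re has_vector_derivative_poly_cnj_poly[OF g]])
    have 2: "Re (P * cnj P) = (cmod P)\<^sup>2" for P by (simp add: complex_mult_cnj cmod_def)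
    have 3: "Re (1 * P * cnj R + R * cnj (1 * P)) = 2 * Re (P * cnj R)" for P R by simp
    have "((\<lambda>t. (cmod (poly (hpoly s k) (v + of_real t)))\<^sup>2) has_real_derivative
       2 * Re (of_nat k * poly (hpoly s (k - 1)) (v + of_real t) * cnj (poly (hpoly s k) (v + of_real t)))) (at t)"
      using 1 unfolding 2 3 pderiv_hpoly poly_smult by (simp only: mult.assoc)
    then show "((\<lambda>t. (cmod (poly (hpoly s k) (v + of_real t)))\<^sup>2 / (fact k * m ^ k)) has_real_derivative
       2 * Re (of_nat k * poly (hpoly s (k - 1)) (v + of_real t) * cnj (poly (hpoly s k) (v + of_real t))) / (fact k * m ^ k)) (at t)"
      by (rule DERIV_cdivide)
  qed
  have Rev: "Re (v + of_real t) = t" for t by (simp add: v_def)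
  have dE: "(E has_real_derivative - (K * h t)) (at t)" for t
  proof -
    have e: "((\<lambda>t. exp (- a * t\<^sup>2)) has_real_derivative - (2 * a * t) * exp (- a * t\<^sup>2)) (at t)"
      by (auto intro!: derivative_eq_intros)
    from DERIV_mult[OF e dT[of t]] show ?thesis
      unfolding E_def h_def K_def
        hpoly_christoffel_darboux[OF ab, of "v + of_real t" n, folded s_def m_def] Rev T
      by (rule DERIV_cong) (simp add: algebra_simps add_divide_distrib)
  qed
  have hint: "integrable lborel h" unfolding h_def by (rule gauss_poly_line_integrable(1)[OF ab(1)])
  have contE: "continuous_on UNIV h" unfolding h_def by (intro continuous_intros)
  have Elim: "(E \<longlongrightarrow> 0) at_top"
  proof -
    have "E = (\<lambda>t. \<Sum>k<Suc n. (exp (- a * t\<^sup>2) * Re (poly (hpoly s k) (v + of_real t) * cnj (poly (hpoly s k) (v + of_real t)))) / (fact k * m ^ k))"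
      unfolding E_def T_def sum_distrib_left by (intro ext sum.cong refl) (simp add: complex_mult_cnj cmod_def)
    then show ?thesis
      by (simp only:) (rule tendsto_null_sum, rule tendsto_divide_zero, rule gauss_poly_line_integrable(2)[OF ab(1)])
  qed
  have FTC: "(LBINT u=0..\<infinity>. - (K / D * h (Re z + u / D))) = 0 - E (Re z)"
  proof (rule interval_integral_FTC_integrable[where F = "\<lambda>u. E (Re z + u / D)"])
    show "((\<lambda>u. E (Re z + u / D)) has_vector_derivative - (K / D * h (Re z + u / D))) (at u)" for u
    proof -
      have "((\<lambda>u. Re z + u / D) has_real_derivative 1 / D) (at u)" using D by (auto intro!: derivative_eq_intros)
      from DERIV_chain2[OF dE this] show ?thesis
        unfolding has_real_derivative_iff_has_vector_derivative[symmetric] by (rule DERIV_cong) simp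
    qed
    have c: "continuous_on UNIV (\<lambda>u. - (K / D * h (Re z + u / D)))"
      by (intro continuous_intros continuous_on_compose2[OF contE]) (use D in auto)
    show "isCont (\<lambda>u. - (K / D * h (Re z + u / D))) u" for u
      using c by (simp add: continuous_on_eq_continuous_at)
    have "integrable lborel (\<lambda>u. h (Re z + (1 / D) * u))"
      using lborel_integrable_real_affine[OF hint, of "1 / D" "Re z"] D by simp
    then have "integrable lborel (\<lambda>u. - (K / D * h (Re z + u / D)))" by simp
    then show "set_integrable lborel (einterval 0 \<infinity>) (\<lambda>u. - (K / D * h (Re z + u / D)))"
      unfolding set_integrable_def by (intro integrable_mult_indicator) auto
    have "filterlim (\<lambda>u. Re z + u / D) at_top at_top"
      using D by real_asymp
    then show "(((\<lambda>u. E (Re z + u / D)) \<circ> real_of_ereal) \<longlongrightarrow> 0) (at_left \<infinity>)"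
      using filterlim_compose[OF Elim] by (simp add: ereal_tendsto_simps1)
    have "isCont (\<lambda>u. E (Re z + u / D)) 0"
      by (intro continuous_intros isCont_o2[OF _ DERIV_isCont[OF dE]]) (use D in auto)
    then show "(((\<lambda>u. E (Re z + u / D)) \<circ> real_of_ereal) \<longlongrightarrow> E (Re z)) (at_right 0)"
      unfolding zero_ereal_def ereal_tendsto_simps1 isCont_def
      by (auto intro: tendsto_within_subset[where S = UNIV])
  qed simp
  have hM: "(\<lambda>u. h (Re z + u / D)) \<in> borel_measurable borel"
    by (intro borel_measurable_continuous_onI continuous_on_compose2[OF contE] continuous_intros) (use D in auto)
  have "E (Re z) = (LBINT u=0..\<infinity>. K / D * h (Re z + u / D))"
    using FTC by (simp add: interval_lebesgue_integral_uminus)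
  also have "\<dots> = (LBINT u:{0<..}. K / D * h (Re z + u / D))"
    unfolding zero_ereal_def by (rule interval_integral_to_infinity_eq)
  also have "\<dots> = K / D * (LBINT u:{0<..}. h (Re z + u / D))" by (rule set_integral_mult_right)
  also have "\<dots> = K / D * (LBINT u:{0..}. h (Re z + u / D))"
    unfolding set_integral_atLeast_eq_greaterThan[OF hM] ..
  finally have Ez: "E (Re z) = K / D * (LBINT u:{0..}. h (Re z + u / D))" .
  have "one_point (Suc n) Q z = sqrt (a * b) * exp (- b * (Im z)\<^sup>2) * E (Re z)"
    unfolding one_point_gauss_sum[OF ab zero_less_Suc Q, folded s_def m_def] E_def T_def v_def
    by (simp add: exp_diff exp_minus field_simps)
  also have "\<dots> = sqrt (a * b) * exp (- b * (Im z)\<^sup>2) * (2 * a / (D * (fact n * m ^ n))) * (LBINT u:{0..}. h (Re z + u / D))"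
    unfolding Ez K_def by (simp add: mult_ac)
  finally show ?thesis
    unfolding h_def v_def by simp
qed

section \<open>Orthogonal polynomials as integrals over vertical lines\<close>

lemma vertical_gauss_norm:
  fixes s :: real and w :: complex
  assumes s: "s > 0"
  shows "cmod (exp ((of_real A + \<i> * of_real t - w)\<^sup>2 / (2 * of_real s)))
      = exp ((A - Re w)\<^sup>2 / (2 * s)) * exp (- (t - Im w)\<^sup>2 / (2 * s))"
proof -
  have "Re ((of_real A + \<i> * of_real t - w)\<^sup>2 / (2 * of_real s)) = ((A - Re w)\<^sup>2 - (t - Im w)\<^sup>2) / (2 * s)"
    by (simp add: power2_eq_square Re_divide_of_real[of _ "2 * s", simplified])
  then show ?thesis
    unfolding norm_exp_eq_Re by (simp add: exp_add[symmetric] diff_divide_distrib)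
qed

lemma vertical_bound:
  fixes s :: real and w :: complex and p :: "complex poly"
  assumes s: "s > 0"
  shows "\<exists>C B. C \<ge> 0 \<and> (\<forall>t. cmod (poly p (of_real A + \<i> * of_real t) * exp ((of_real A + \<i> * of_real t - w)\<^sup>2 / (2 * of_real s)))
      \<le> C * exp (B * \<bar>t\<bar> - 1 / (2 * s) * t\<^sup>2))"
proof -
  obtain C B where CB: "C \<ge> 0" "B \<ge> 0" "\<And>t. cmod (poly p (of_real A + \<i> * of_real t)) * cmod (poly 1 (of_real A + \<i> * of_real t)) \<le> C * exp (B * \<bar>t\<bar>)"
    using poly_product_line_bound[of \<i> p "of_real A" 1] by auto
  define K where "K = exp ((A - Re w)\<^sup>2 / (2 * s))"
  have "cmod (poly p (of_real A + \<i> * of_real t) * exp ((of_real A + \<i> * of_real t - w)\<^sup>2 / (2 * of_real s)))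
      \<le> (C * K) * exp ((B + \<bar>Im w\<bar> / s) * \<bar>t\<bar> - 1 / (2 * s) * t\<^sup>2)" for t
  proof -
    have "- (t - Im w)\<^sup>2 \<le> 2 * \<bar>Im w\<bar> * \<bar>t\<bar> - t\<^sup>2"
    proof -
      have "t * Im w \<le> \<bar>Im w\<bar> * \<bar>t\<bar>" by (metis abs_ge_self abs_mult mult.commute)
      then show ?thesis unfolding power2_diff using zero_le_power2[of "Im w"] by linarith
    qed
    then have "- (t - Im w)\<^sup>2 / (2 * s) \<le> (2 * \<bar>Im w\<bar> * \<bar>t\<bar> - t\<^sup>2) / (2 * s)"
      using s by (intro divide_right_mono) auto
    also have "\<dots> = \<bar>Im w\<bar> / s * \<bar>t\<bar> - 1 / (2 * s) * t\<^sup>2" using s by (simp add: field_simps)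
    finally have e: "exp (- (t - Im w)\<^sup>2 / (2 * s)) \<le> exp (\<bar>Im w\<bar> / s * \<bar>t\<bar> - 1 / (2 * s) * t\<^sup>2)" by simp
    have "cmod (poly p (of_real A + \<i> * of_real t) * exp ((of_real A + \<i> * of_real t - w)\<^sup>2 / (2 * of_real s)))
       = cmod (poly p (of_real A + \<i> * of_real t)) * (K * exp (- (t - Im w)\<^sup>2 / (2 * s)))"
      unfolding norm_mult vertical_gauss_norm[OF s] K_def ..
    also have "\<dots> \<le> (C * exp (B * \<bar>t\<bar>)) * (K * exp (\<bar>Im w\<bar> / s * \<bar>t\<bar> - 1 / (2 * s) * t\<^sup>2))"
      using CB(3)[of t] CB(1) e by (intro mult_mono) (auto simp: K_def)
    also have "\<dots> = (C * K) * exp (B * \<bar>t\<bar> + (\<bar>Im w\<bar> / s * \<bar>t\<bar> - 1 / (2 * s) * t\<^sup>2))"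
      unfolding exp_add by (simp only: mult_ac)
    also have "B * \<bar>t\<bar> + (\<bar>Im w\<bar> / s * \<bar>t\<bar> - 1 / (2 * s) * t\<^sup>2) = (B + \<bar>Im w\<bar> / s) * \<bar>t\<bar> - 1 / (2 * s) * t\<^sup>2"
      by (simp add: distrib_right)
    finally show ?thesis .
  qed
  then show ?thesis using CB(1) by (intro exI[of _ "C * K"] exI[of _ "B + \<bar>Im w\<bar> / s"]) (auto simp: K_def)
qed

lemma vertical_integrable:
  fixes s :: real and w :: complex and p :: "complex poly"
  defines "f \<equiv> (\<lambda>A t. poly p (of_real A + \<i> * of_real t) * exp ((of_real A + \<i> * of_real t - w)\<^sup>2 / (2 * of_real s)))"
  assumes s: "s > 0"
  shows "integrable lborel (f A)"
    and "(f A \<longlongrightarrow> 0) at_top" "(f A \<longlongrightarrow> 0) at_bot"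
proof -
  let ?f = "f A"
  obtain C B where C: "C \<ge> 0" and b: "\<And>t. norm (?f t) \<le> C * exp (B * \<bar>t\<bar> - 1 / (2 * s) * t\<^sup>2)"
    using vertical_bound[OF s, of p A w] unfolding f_def by blast
  have s': "1 / (2 * s) > 0" using s by simp
  show "integrable lborel ?f"
  proof (rule Bochner_Integration.integrable_bound)
    show "integrable lborel (\<lambda>t. C * exp (B * \<bar>t\<bar> - 1 / (2 * s) * t\<^sup>2))"
      using integrable_exp_linear_gauss[OF s'] by simp
    have "continuous_on UNIV ?f" unfolding f_def by (intro continuous_intros) (use s in auto)
    then show "?f \<in> borel_measurable lborel" using borel_measurable_continuous_onI by simp
    show "AE t in lborel. norm (?f t) \<le> norm (C * exp (B * \<bar>t\<bar> - 1 / (2 * s) * t\<^sup>2))"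
      using b C by (auto intro!: always_eventually simp: abs_mult)
  qed
  show "(?f \<longlongrightarrow> 0) at_top"
    by (rule Lim_null_comparison[OF always_eventually[OF allI[OF b]] tendsto_mult_right_zero[OF exp_linear_gauss_tendsto_0(1)[OF s']]])
  show "(?f \<longlongrightarrow> 0) at_bot"
    by (rule Lim_null_comparison[OF always_eventually[OF allI[OF b]] tendsto_mult_right_zero[OF exp_linear_gauss_tendsto_0(2)[OF s']]])
qed

text \<open>Integrating the derivative of \<open>v\<^sup>k exp ((v - w)\<^sup>2 / (2 s))\<close> along the line gives zero, which is the
  three-term recurrence for the integrals. Hence the abscissa \<open>A\<close> of the line is arbitrary.\<close>

lemma hpoly_vertical_integral:
  fixes s A :: real and w :: complex
  assumes s: "s > 0"
  shows "of_real (sqrt (2 * pi * s)) * poly (hpoly s k) w =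
     (LBINT t. (of_real A + \<i> * of_real t) ^ k * exp ((of_real A + \<i> * of_real t - w)\<^sup>2 / (2 * of_real s)))"
proof -
  define P where "P = (\<lambda>t. of_real A + \<i> * of_real t :: complex)"
  define G where "G = (\<lambda>t. exp ((P t - w)\<^sup>2 / (2 * of_real s)))"
  have G: "exp ((P t - w)\<^sup>2 / (2 * of_real s)) = G t" for t by (simp only: G_def)
  define I where "I = (\<lambda>k. LBINT t. P t ^ k * G t)"
  have int: "integrable lborel (\<lambda>t. P t ^ k * G t)" for k
    using vertical_integrable(1)[OF s, of "monom 1 k" A w] by (simp add: poly_monom P_def G_def)
  have I0: "I 0 = of_real (sqrt (2 * pi * s))"
  proof -
    have "P t - w = (of_real A - w) + \<i> * of_real t" for t by (simp add: P_def)
    then show ?thesis unfolding I_def G_def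
      by (simp only: power_0 mult_1_left integral_complex_gauss[OF s, of "of_real A - w"])
  qed
  have rec: "I (Suc k) = w * I k - of_real (s * real k) * I (k - 1)" for k
  proof -
    let ?f = "\<lambda>t. \<i> * (of_nat k * (P t ^ (k - 1) * G t) + (P t ^ Suc k * G t - w * (P t ^ k * G t)) / of_real s)"
    have "(LBINT t. ?f t) = 0"
    proof (rule integral_deriv_line_eq_0)
      show "((\<lambda>t. P t ^ k * G t) has_vector_derivative ?f t) (at t)" for t
      proof -
        have dP: "(P has_vector_derivative \<i>) (at t)"
          unfolding P_def by (auto intro!: derivative_eq_intros)
        have "((\<lambda>p. p ^ k * exp ((p - w)\<^sup>2 / (2 * of_real s))) has_field_derivative
           (of_nat k * P t ^ (k - 1) * G t + P t ^ k * (G t * ((P t - w) / of_real s)))) (at (P t))"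
          using s unfolding G_def
          by (auto intro!: derivative_eq_intros simp: field_simps)
        from field_vector_diff_chain_at[OF dP this] show ?thesis
          unfolding o_def G
          by (rule has_vector_derivative_eq_rhs) (use s in \<open>simp add: field_simps\<close>)
      qed
      show "continuous_on UNIV ?f" unfolding P_def G_def by (intro continuous_intros) (use s in auto)
      show "integrable lborel ?f" using int by (intro integrable_mult_right Bochner_Integration.integrable_add integrable_divide Bochner_Integration.integrable_diff)
      show "((\<lambda>t. P t ^ k * G t) \<longlongrightarrow> 0) at_top" "((\<lambda>t. P t ^ k * G t) \<longlongrightarrow> 0) at_bot"
        using vertical_integrable(2,3)[OF s, of "monom 1 k" A w] by (simp_all add: poly_monom P_def G_def)
    qed
    also have "(LBINT t. ?f t) = \<i> * (of_nat k * I (k - 1) + (I (Suc k) - w * I k) / of_real s)"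
      unfolding I_def by (simp only: integral_mult_right_zero integral_divide_zero Bochner_Integration.integral_add
          Bochner_Integration.integral_diff int integrable_mult_right integrable_divide Bochner_Integration.integrable_diff)
    finally have "of_nat k * I (k - 1) + (I (Suc k) - w * I k) / of_real s = 0" by (simp only: mult_eq_0_iff complex_i_not_zero simp_thms)
    then show ?thesis using s by (simp add: field_simps eq_neg_iff_add_eq_0 add_eq_0_iff)
  qed
  have "I k = of_real (sqrt (2 * pi * s)) * poly (hpoly s k) w \<and> I (Suc k) = of_real (sqrt (2 * pi * s)) * poly (hpoly s (Suc k)) w"
  proof (induction k)
    case 0
    show ?case using I0 rec[of 0] by simp
  next
    case (Suc k)
    have "I (Suc (Suc k)) = of_real (sqrt (2 * pi * s)) * poly (hpoly s (Suc (Suc k))) w"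
      unfolding rec[of "Suc k"] poly_hpoly_Suc[of s "Suc k"] using Suc by (simp add: algebra_simps)
    then show ?case using Suc by simp
  qed
  then show ?thesis by (simp add: I_def P_def G_def)
qed

section \<open>The Airy function as an integral over a vertical line\<close>

lemma set_integral_atLeast_limit:
  fixes f :: "real \<Rightarrow> complex"
  assumes "set_integrable lborel {0..} f"
  shows "((\<lambda>R. LBINT t:{0..R}. f t) \<longlongrightarrow> (LBINT t:{0..}. f t)) at_top"
  using tendsto_set_lebesgue_integral_at_top[of "0::real" lborel f] assms by simp

text \<open>The exponent of the contour integral for the Airy function.\<close>

definition airy_exponent :: "complex \<Rightarrow> complex \<Rightarrow> complex" where
  "airy_exponent z v = v ^ 3 / 3 - z * v"

lemma norm_exp_airy_vertical:
  "cmod (exp (airy_exponent z (of_real d + \<i> * of_real q))) =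
     exp (d ^ 3 / 3 - d * Re z) * exp (Im z * q - d * q\<^sup>2)"
proof -
  have "Re (airy_exponent z (of_real d + \<i> * of_real q)) = (d ^ 3 / 3 - d * Re z) + (Im z * q - d * q\<^sup>2)"
    by (simp add: airy_exponent_def power3_eq_cube power2_eq_square algebra_simps Re_divide_numeral)
       (simp add: add_divide_distrib diff_divide_distrib)
  then show ?thesis unfolding norm_exp_eq_Re by (simp add: exp_add)
qed

lemma integrable_airy_vertical:
  assumes d: "d > 0"
  shows "integrable lborel (\<lambda>q. exp (airy_exponent z (of_real d + \<i> * of_real q)))"
proof (rule Bochner_Integration.integrable_bound)
  show "integrable lborel (\<lambda>q. exp (d ^ 3 / 3 - d * Re z) * exp (\<bar>Im z\<bar> * \<bar>q\<bar> - d * q\<^sup>2))"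
    using integrable_exp_linear_gauss[OF d] by simp
  have "continuous_on UNIV (\<lambda>q. exp (airy_exponent z (of_real d + \<i> * of_real q)))"
    unfolding airy_exponent_def by (intro continuous_intros) auto
  then show "(\<lambda>q. exp (airy_exponent z (of_real d + \<i> * of_real q))) \<in> borel_measurable lborel"
    using borel_measurable_continuous_onI by simp
  show "AE q in lborel. norm (exp (airy_exponent z (of_real d + \<i> * of_real q)))
     \<le> norm (exp (d ^ 3 / 3 - d * Re z) * exp (\<bar>Im z\<bar> * \<bar>q\<bar> - d * q\<^sup>2))"
  proof (intro always_eventually allI)
    fix q
    have "Im z * q \<le> \<bar>Im z\<bar> * \<bar>q\<bar>" by (metis abs_ge_self abs_mult)
    then show "norm (exp (airy_exponent z (of_real d + \<i> * of_real q)))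
       \<le> norm (exp (d ^ 3 / 3 - d * Re z) * exp (\<bar>Im z\<bar> * \<bar>q\<bar> - d * q\<^sup>2))"
      unfolding norm_exp_airy_vertical by simp
  qed
qed

lemma integral_along_segment:
  fixes F f :: "complex \<Rightarrow> complex"
  assumes F: "\<And>v. (F has_field_derivative f v) (at v)" and f: "continuous_on UNIV f" and R: "R \<ge> 0"
  shows "(LBINT r:{0..R}. f (v + of_real r * e) * e) = F (v + of_real R * e) - F v"
proof -
  have c: "continuous_on {0..R} (\<lambda>r. f (v + of_real r * e) * e)"
    by (intro continuous_intros continuous_on_compose2[OF f]) auto
  have "((\<lambda>r. f (v + of_real r * e) * e) has_integral (F (v + of_real R * e) - F (v + of_real 0 * e))) {0..R}"
  proof (rule fundamental_theorem_of_calculus[OF R])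
    fix r
    have "((\<lambda>r. v + of_real r * e) has_vector_derivative e) (at r within {0..R})"
      by (auto intro!: derivative_eq_intros)
    from field_vector_diff_chain_within[OF this, of F "f (v + of_real r * e)"] F
    show "((\<lambda>r. F (v + of_real r * e)) has_vector_derivative f (v + of_real r * e) * e) (at r within {0..R})"
      by (simp add: o_def mult.commute has_field_derivative_at_within)
  qed
  moreover have "set_integrable lborel {0..R} (\<lambda>r. f (v + of_real r * e) * e)"
    using borel_integrable_atLeastAtMost'[OF c] .
  ultimately show ?thesis
    by (simp only: set_borel_integral_eq_integral(2) integral_unique of_real_0 mult_zero_left add_0_right)
qed

text \<open>On the horizontal segment from a vertical line to the ray the real part of \<open>v\<^sup>3 / 3\<close> is at most
  \<open>- 8/9 d Y\<^sup>2\<close>, so an antiderivative of the integrand takes asymptotically equal values at its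
  ends.\<close>

lemma airy_horizontal_bound:
  fixes z :: complex and F :: "complex \<Rightarrow> complex" and \<sigma> d Y :: real
  assumes F: "\<And>v. (F has_field_derivative exp (airy_exponent z v)) (at v)"
    and \<sigma>: "\<bar>\<sigma>\<bar> = 1" and d: "d > 0" and Y: "d * sqrt 3 \<le> Y"
  shows "cmod (F (Complex d (\<sigma> * Y)) - F (Complex (Y / sqrt 3) (\<sigma> * Y))) \<le> exp (2 * cmod z * Y - 8/9 * d * Y\<^sup>2) * Y"
proof -
  let ?a = "Complex d (\<sigma> * Y)" and ?b = "Complex (Y / sqrt 3) (\<sigma> * Y)"
  have dY: "d \<le> Y / sqrt 3" using Y by (simp add: field_simps)
  have Y0: "Y > 0" using d Y by (meson less_le_trans mult_pos_pos real_sqrt_gt_zero zero_less_numeral)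
  have Y3: "Y / sqrt 3 \<le> Y" using Y0 by (simp add: divide_le_eq)
  have "cmod (F ?a - F ?b) \<le> exp (2 * cmod z * Y - 8/9 * d * Y\<^sup>2) * cmod (?a - ?b)"
  proof (rule field_differentiable_bound[of "closed_segment ?a ?b"])
    fix v assume "v \<in> closed_segment ?a ?b"
    then obtain u where u: "0 \<le> u" "u \<le> 1" "v = (1 - u) *\<^sub>R ?a + u *\<^sub>R ?b"
      by (auto simp: in_segment)
    define x where "x = Re v"
    have im: "Im v = \<sigma> * Y" unfolding u by (simp add: algebra_simps)
    have x: "d \<le> x" "x \<le> Y / sqrt 3"
    proof -
      define T where "T = Y / sqrt 3"
      have xr: "x = (1 - u) * d + u * T" by (simp add: x_def u T_def)
      have "0 \<le> u * (T - d)" "0 \<le> (1 - u) * (T - d)" using u dY by (simp_all add: T_def)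
      then show "d \<le> x" "x \<le> Y / sqrt 3" by (simp_all add: xr T_def[symmetric] algebra_simps)
    qed
    have s2: "\<sigma>\<^sup>2 = 1" using \<sigma> by (metis power2_abs one_power2)
    have x2: "x\<^sup>2 \<le> Y\<^sup>2 / 3"
    proof -
      have "x\<^sup>2 \<le> (Y / sqrt 3)\<^sup>2" using x d by (intro power_mono) auto
      then show ?thesis by (simp add: power_divide)
    qed
    have R: "Re (v ^ 3 / 3) = x * (x\<^sup>2 / 3 - Y\<^sup>2)"
    proof -
      have v: "v = Complex x (\<sigma> * Y)" using im by (simp add: complex_eq_iff x_def)
      have "Re (v ^ 3) = x ^ 3 - 3 * x * (\<sigma>\<^sup>2 * Y\<^sup>2)" unfolding v by (simp add: power3_eq_cube power2_eq_square algebra_simps)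
      then have "Re (v ^ 3 / 3) = (x ^ 3 - 3 * x * Y\<^sup>2) / 3" by (simp only: s2 mult_1 Re_divide_numeral)
      also have "\<dots> = x * (x\<^sup>2 / 3 - Y\<^sup>2)" by (simp add: power3_eq_cube power2_eq_square field_simps)
      finally show ?thesis .
    qed
    have "x * (x\<^sup>2 / 3 - Y\<^sup>2) \<le> x * (- (8/9) * Y\<^sup>2)" using x x2 d by (intro mult_left_mono) auto
    also have "\<dots> = - (8/9 * Y\<^sup>2) * x" by simp
    also have "\<dots> \<le> - (8/9 * Y\<^sup>2) * d" using x by (intro mult_left_mono_neg) auto
    finally have 1: "Re (v ^ 3 / 3) \<le> - (8/9) * d * Y\<^sup>2" unfolding R by (simp add: mult_ac)
    have "cmod v \<le> \<bar>Re v\<bar> + \<bar>Im v\<bar>" by (rule cmod_le)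
    also have "\<dots> \<le> 2 * Y" unfolding im x_def[symmetric] abs_mult \<sigma> using x d Y0 Y3 by simp
    finally have "cmod z * cmod v \<le> cmod z * (2 * Y)" by (intro mult_left_mono) auto
    then have 2: "- Re (z * v) \<le> cmod z * (2 * Y)"
      using abs_Re_le_cmod[of "z * v"] by (simp add: norm_mult del: times_complex.sel)
    show "cmod (exp (airy_exponent z v)) \<le> exp (2 * cmod z * Y - 8/9 * d * Y\<^sup>2)"
      unfolding norm_exp_eq_Re airy_exponent_def minus_complex.sel using 1 2 by simp
    show "(F has_field_derivative exp (airy_exponent z v)) (at v within closed_segment ?a ?b)"
      using F has_field_derivative_at_within by blast
  qed auto
  also have "cmod (?a - ?b) \<le> Y"
  proof -
    have "?a - ?b = of_real (d - Y / sqrt 3)" by (simp add: complex_eq_iff)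
    then have "cmod (?a - ?b) = \<bar>d - Y / sqrt 3\<bar>" by (simp only: norm_of_real)
    then show ?thesis using dY d Y3 by simp
  qed
  finally show ?thesis by simp
qed

text \<open>The integrand has an entire antiderivative \<open>F\<close>, so the integral over a ray or over a vertical
  half-line is a difference of values of \<open>F\<close>; both end points at infinity give the same limit. The
  sign \<open>\<sigma>\<close> selects the upper or the lower half-plane.\<close>

lemma airy_ray_eq_vertical_half_line:
  fixes z :: complex and F :: "complex \<Rightarrow> complex" and \<sigma> d :: real
  assumes F: "\<And>v. (F has_field_derivative exp (airy_exponent z v)) (at v)"
    and \<sigma>: "\<sigma> = 1 \<or> \<sigma> = -1" and d: "d > 0"
  shows "airy_ray (\<sigma> * pi / 3) z + F 0 = \<i> * of_real \<sigma> * (LBINT q:{0..}. exp (airy_exponent z (of_real d + \<i> * of_real (\<sigma> * q)))) + F (of_real d)"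
proof -
  let ?f = "\<lambda>v. exp (airy_exponent z v)"
  have contf: "continuous_on UNIV ?f" unfolding airy_exponent_def by (intro continuous_intros) auto
  have s3: "sqrt 3 > 0" by simp
  \<comment> \<open>The point of the ray at height \<open>Y\<close>, to be joined horizontally to the vertical line.\<close>
  have e: "of_real (2 * Y / sqrt 3) * cis (\<sigma> * pi / 3) = Complex (Y / sqrt 3) (\<sigma> * Y)" for Y
    using \<sigma> by (auto simp: complex_eq_iff cos_60 sin_60)
  have A: "((\<lambda>R. F (of_real R * cis (\<sigma> * pi / 3)) - F 0) \<longlongrightarrow> airy_ray (\<sigma> * pi / 3) z) at_top"
  proof -
    have 1: "set_integrable lborel {0..} (\<lambda>r. ?f (0 + of_real r * cis (\<sigma> * pi / 3)) * cis (\<sigma> * pi / 3))"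
      using airy_ray_integrable[of "\<sigma> * pi / 3" z] \<sigma> by (auto simp: airy_exponent_def)
    have 2: "(LBINT r:{0..}. ?f (0 + of_real r * cis (\<sigma> * pi / 3)) * cis (\<sigma> * pi / 3)) = airy_ray (\<sigma> * pi / 3) z"
      by (simp add: airy_ray_def airy_exponent_def)
    show ?thesis
    proof (rule Lim_transform_eventually[OF set_integral_atLeast_limit[OF 1, unfolded 2]])
      show "eventually (\<lambda>R. (LBINT r:{0..R}. ?f (0 + of_real r * cis (\<sigma> * pi / 3)) * cis (\<sigma> * pi / 3)) = F (of_real R * cis (\<sigma> * pi / 3)) - F 0) at_top"
        using eventually_ge_at_top[of 0]
      proof eventually_elim
        case (elim R)
        show ?case using integral_along_segment[OF F contf elim, of 0 "cis (\<sigma> * pi / 3)"] by (simp only: add_0_left)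
      qed
    qed
  qed
  have lin: "filterlim (\<lambda>Y::real. 2 * Y / sqrt 3) at_top at_top"
    using s3 by real_asymp
  have A': "((\<lambda>Y. F (Complex (Y / sqrt 3) (\<sigma> * Y)) - F 0) \<longlongrightarrow> airy_ray (\<sigma> * pi / 3) z) at_top"
    using filterlim_compose[OF A lin] unfolding e .
  let ?V = "\<lambda>q. ?f (of_real d + \<i> * of_real (\<sigma> * q))"
  have V: "((\<lambda>Y. F (Complex d (\<sigma> * Y)) - F (of_real d)) \<longlongrightarrow> \<i> * of_real \<sigma> * (LBINT q:{0..}. ?V q)) at_top"
  proof -
    have i: "integrable lborel ?V"
      using \<sigma> integrable_airy_vertical[OF d, of z] lborel_integrable_real_affine[OF integrable_airy_vertical[OF d, of z], of "-1" 0]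
      by auto
    have q: "?V r = ?f (of_real d + of_real r * (\<i> * of_real \<sigma>))" for r
      by (simp add: mult_ac)
    have 1: "set_integrable lborel {0..} (\<lambda>q. ?V q * (\<i> * of_real \<sigma>))"
      unfolding set_integrable_def by (intro integrable_mult_indicator integrable_mult_left i) auto
    have 2: "(LBINT q:{0..}. ?V q * (\<i> * of_real \<sigma>)) = \<i> * of_real \<sigma> * (LBINT q:{0..}. ?V q)"
      by (subst mult.commute, rule set_integral_mult_left)
    show ?thesis
    proof (rule Lim_transform_eventually[OF set_integral_atLeast_limit[OF 1, unfolded 2]])
      have c: "of_real d + of_real Y * (\<i> * of_real \<sigma>) = Complex d (\<sigma> * Y)" for Y by (simp add: complex_eq_iff)
      have c2: "of_real d + \<i> * of_real (\<sigma> * Y) = Complex d (\<sigma> * Y)" for Y by (simp add: complex_eq_iff)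
      show "eventually (\<lambda>R. (LBINT q:{0..R}. ?V q * (\<i> * of_real \<sigma>)) = F (Complex d (\<sigma> * R)) - F (of_real d)) at_top"
        using eventually_ge_at_top[of 0]
      proof eventually_elim
        case (elim R)
        show ?case using integral_along_segment[OF F contf elim, of "of_real d" "\<i> * of_real \<sigma>"]
          unfolding c c2 .
      qed
    qed
  qed
  have D: "((\<lambda>Y. F (Complex d (\<sigma> * Y)) - F (Complex (Y / sqrt 3) (\<sigma> * Y))) \<longlongrightarrow> 0) at_top"
  proof (rule Lim_null_comparison)
    show "eventually (\<lambda>Y. norm (F (Complex d (\<sigma> * Y)) - F (Complex (Y / sqrt 3) (\<sigma> * Y))) \<le> exp (2 * cmod z * Y - 8/9 * d * Y\<^sup>2) * Y) at_top"
      using eventually_ge_at_top[of "d * sqrt 3"]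
      by eventually_elim (rule airy_horizontal_bound[OF F _ d], use \<sigma> in auto)
    show "((\<lambda>Y. exp (2 * cmod z * Y - 8/9 * d * Y\<^sup>2) * Y) \<longlongrightarrow> 0) at_top"
      using d by real_asymp
  qed
  have "((\<lambda>Y. (F (Complex d (\<sigma> * Y)) - F (Complex (Y / sqrt 3) (\<sigma> * Y))) + (F (Complex (Y / sqrt 3) (\<sigma> * Y)) - F 0) - (F (Complex d (\<sigma> * Y)) - F (of_real d)))
     \<longlongrightarrow> 0 + airy_ray (\<sigma> * pi / 3) z - \<i> * of_real \<sigma> * (LBINT q:{0..}. ?V q)) at_top"
    by (intro tendsto_intros D A' V)
  moreover have "(\<lambda>Y. (F (Complex d (\<sigma> * Y)) - F (Complex (Y / sqrt 3) (\<sigma> * Y))) + (F (Complex (Y / sqrt 3) (\<sigma> * Y)) - F 0) - (F (Complex d (\<sigma> * Y)) - F (of_real d)))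
     = (\<lambda>Y. F (of_real d) - F 0)" by (intro ext) simp
  ultimately have "F (of_real d) - F 0 = 0 + airy_ray (\<sigma> * pi / 3) z - \<i> * of_real \<sigma> * (LBINT q:{0..}. ?V q)"
    using tendsto_unique[OF trivial_limit_at_top_linorder tendsto_const] by simp
  then show ?thesis by (simp add: algebra_simps)
qed

lemma integral_line_split:
  fixes g :: "real \<Rightarrow> complex"
  assumes g: "integrable lborel g"
  shows "(LBINT q. g q) = (LBINT q:{0..}. g q) + (LBINT q:{0..}. g (- q))"
proof -
  have [measurable]: "g \<in> borel_measurable borel" using borel_measurable_integrable[OF g] by simp
  have s: "set_integrable lborel A g" if "A \<in> sets borel" for A
    using that g unfolding set_integrable_def by (intro integrable_mult_indicator) auto
  have "(LBINT q. g q) = (LBINT q:{0..} \<union> {..<0}. g q)"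
  proof -
    have "{0..} \<union> {..<0} = (UNIV :: real set)" by auto
    then show ?thesis by (simp add: set_lebesgue_integral_def)
  qed
  also have "\<dots> = (LBINT q:{0..}. g q) + (LBINT q:{..<0}. g q)"
    by (rule set_integral_Un) (auto intro: s)
  also have "(LBINT q:{..<0}. g q) = (LBINT q:{0<..}. g (- q))"
    unfolding set_lebesgue_integral_def
    by (subst lborel_integral_real_affine[of "-1" _ 0]) (auto simp: indicator_def intro!: Bochner_Integration.integral_cong)
  also have "\<dots> = (LBINT q:{0..}. g (- q))"
    by (rule set_integral_atLeast_eq_greaterThan[symmetric]) measurable
  finally show ?thesis .
qed

theorem Ai_vertical_integral:
  assumes d: "d > 0"
  shows "Ai z = (LBINT q. exp (airy_exponent z (of_real d + \<i> * of_real q))) / (2 * of_real pi)"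
proof -
  have "(\<lambda>v. exp (airy_exponent z v)) holomorphic_on UNIV"
    unfolding airy_exponent_def by (intro holomorphic_intros) auto
  then obtain F where F: "\<And>v. (F has_field_derivative exp (airy_exponent z v)) (at v)"
    using holomorphic_convex_primitive'[of UNIV "\<lambda>v. exp (airy_exponent z v)"] by auto
  let ?V = "\<lambda>q. exp (airy_exponent z (of_real d + \<i> * of_real q))"
  have u: "airy_ray (pi / 3) z + F 0 = \<i> * (LBINT q:{0..}. ?V q) + F (of_real d)"
    using airy_ray_eq_vertical_half_line[OF F _ d, of 1] by simp
  have l: "airy_ray (- pi / 3) z + F 0 = - \<i> * (LBINT q:{0..}. ?V (- q)) + F (of_real d)"
    using airy_ray_eq_vertical_half_line[OF F _ d, of "-1"] by simp
  have "airy_ray (pi / 3) z - airy_ray (- pi / 3) z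
     = (airy_ray (pi / 3) z + F 0) - (airy_ray (- pi / 3) z + F 0)" by simp
  also have "\<dots> = \<i> * ((LBINT q:{0..}. ?V q) + (LBINT q:{0..}. ?V (- q)))"
    unfolding u l by (simp add: algebra_simps)
  also have "\<dots> = \<i> * (LBINT q. ?V q)"
    using integral_line_split[OF integrable_airy_vertical[OF d, of z]] by simp
  finally show ?thesis by (simp add: Ai_def)
qed

section \<open>Stirling's formula\<close>

lemma integral_power_exp:
  "integrable lborel (\<lambda>t::real. indicator {0..} t * (t ^ n * exp (- t)))"
  "(LBINT t::real. indicator {0..} t * (t ^ n * exp (- t))) = fact n"
proof -
  have nn: "(\<integral>\<^sup>+t. ennreal (indicator {0..} t * (t ^ n * exp (- t))) \<partial>lborel) = ennreal (fact n)"
  proof -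
    have "(\<integral>\<^sup>+t. ennreal (indicator {0..} t * (t ^ n * exp (- t))) \<partial>lborel)
       = (\<integral>\<^sup>+t. ennreal (t ^ n * exp (- t)) * indicator {0..} t \<partial>lborel)"
      by (intro nn_integral_cong) (auto simp: indicator_def)
    also have "\<dots> = ennreal (fact n)"
      using nn_intergal_power_times_exp_Ici[of n] by simp
    finally show ?thesis .
  qed
  have "has_bochner_integral lborel (\<lambda>t::real. indicator {0..} t * (t ^ n * exp (- t))) (fact n)"
    by (rule has_bochner_integral_nn_integral[OF _ _ _ nn]) (auto simp: indicator_def)
  then show "integrable lborel (\<lambda>t::real. indicator {0..} t * (t ^ n * exp (- t)))"
    "(LBINT t::real. indicator {0..} t * (t ^ n * exp (- t))) = fact n"
    by (auto simp: has_bochner_integral_iff)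
qed

text \<open>From \<open>ln (1 + t) = 2 ln r \<le> 2 (r - 1)\<close> with \<open>r = sqrt (1 + t)\<close>.\<close>

lemma ln_minus_linear_le:
  fixes t :: real assumes "t > -1"
  shows "ln (1 + t) - t \<le> - (sqrt (1 + t) - 1)\<^sup>2"
proof -
  define r where "r = sqrt (1 + t)"
  have r: "r > 0" "r\<^sup>2 = 1 + t" using assms by (auto simp: r_def)
  have "ln (1 + t) = 2 * ln r" unfolding r(2)[symmetric] using r(1) by (simp add: ln_realpow)
  also have "\<dots> \<le> 2 * (r - 1)" using ln_le_minus_one[OF r(1)] by simp
  also have "\<dots> = t - (r - 1)\<^sup>2" using r(2) by (simp add: power2_diff)
  finally show ?thesis by (simp add: r_def)
qed

text \<open>With \<open>\<delta> = \<surd>N (\<surd>(1 + y / \<surd>N) - 1)\<close> the left side is at most \<open>exp (- \<delta>\<^sup>2)\<close> by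
  \<open>ln_minus_linear_le\<close>, and \<open>\<bar>y\<bar> \<le> 2 \<bar>\<delta>\<bar> + \<delta>\<^sup>2\<close>.\<close>

lemma gamma_integrand_bound:
  fixes y :: real
  assumes N: "N > 0" and y: "0 \<le> 1 + y / sqrt (real N)"
  shows "(1 + y / sqrt (real N)) ^ N * exp (- sqrt (real N) * y) \<le> exp (1/2 - \<bar>y\<bar> / 2)"
proof (cases "1 + y / sqrt (real N) = 0")
  case True
  then show ?thesis using N by (simp only: zero_power mult_zero_left exp_ge_zero)
next
  case False
  define t where "t = y / sqrt (real N)"
  have t: "t > -1" using False y by (simp add: t_def)
  have sN: "sqrt (real N) \<ge> 1" using N by simp
  define \<delta> where "\<delta> = sqrt (real N) * (sqrt (1 + t) - 1)"
  have yt: "y = sqrt (real N) * t" using N by (simp add: t_def)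
  have "y = \<delta> * (2 + \<delta> / sqrt (real N))"
  proof -
    have "\<delta> / sqrt (real N) = sqrt (1 + t) - 1" using N by (simp add: \<delta>_def)
    then have "\<delta> * (2 + \<delta> / sqrt (real N)) = sqrt (real N) * ((sqrt (1 + t) - 1) * (sqrt (1 + t) + 1))"
      by (simp add: \<delta>_def)
    also have "(sqrt (1 + t) - 1) * (sqrt (1 + t) + 1) = t" using t by (simp add: algebra_simps)
    finally show ?thesis using yt by simp
  qed
  then have "\<bar>y\<bar> \<le> \<bar>2 * \<delta>\<bar> + \<bar>\<delta>\<^sup>2 / sqrt (real N)\<bar>"
    using abs_triangle_ineq[of "2 * \<delta>" "\<delta>\<^sup>2 / sqrt (real N)"] by (simp add: power2_eq_square algebra_simps)
  also have "\<bar>\<delta>\<^sup>2 / sqrt (real N)\<bar> \<le> \<delta>\<^sup>2" using sN by (simp add: divide_le_eq mult_le_cancel_left1)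
  also have "\<bar>2 * \<delta>\<bar> \<le> 1 + \<delta>\<^sup>2"
    using zero_le_power2[of "\<bar>\<delta>\<bar> - 1"] by (simp add: power2_diff abs_mult)
  finally have d: "(\<bar>y\<bar> - 1) / 2 \<le> \<delta>\<^sup>2" by simp
  have "(1 + t) ^ N * exp (- sqrt (real N) * y) = exp (real N * ln (1 + t) - real N * t)"
  proof -
    have "sqrt (real N) * y = real N * t" unfolding yt by simp
    moreover have "(1 + t) ^ N = exp (real N * ln (1 + t))"
      using t by (simp add: exp_of_nat_mult)
    ultimately show ?thesis by (simp add: exp_diff exp_minus field_simps)
  qed
  also have "\<dots> \<le> exp (- \<delta>\<^sup>2)"
  proof -
    have "real N * (ln (1 + t) - t) \<le> real N * - (sqrt (1 + t) - 1)\<^sup>2"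
      using ln_minus_linear_le[OF t] by (intro mult_left_mono) auto
    also have "\<dots> = - \<delta>\<^sup>2" by (simp add: \<delta>_def power_mult_distrib)
    finally show ?thesis by (simp add: algebra_simps)
  qed
  also have "\<dots> \<le> exp (1/2 - \<bar>y\<bar> / 2)" using d by (simp add: field_simps)
  finally show ?thesis by (simp add: t_def)
qed

lemma integrable_exp_minus_abs:
  assumes "(a::real) > 0"
  shows "integrable lborel (\<lambda>y. exp (- a * \<bar>y\<bar>))"
proof -
  have "set_integrable lborel {0..} (\<lambda>r::real. exp (- a * r))"
  proof -
    have "(\<lambda>r::real. exp (- a * r)) absolutely_integrable_on {0..}"
      using integrable_on_exp_minus_to_infinity[of a 0] assms
      by (intro nonnegative_absolutely_integrable_1) auto
    then show ?thesis unfolding set_integrable_def by (simp add: integrable_completion)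
  qed
  then have 1: "integrable lborel (\<lambda>r::real. indicator {0..} r * exp (- a * r))"
    by (simp add: set_integrable_def)
  have 2: "integrable lborel (\<lambda>r::real. indicator {0..} (- r) * exp (a * r))"
    using lborel_integrable_real_affine[OF 1, of "-1" 0] by simp
  show ?thesis
    by (rule Bochner_Integration.integrable_bound[OF Bochner_Integration.integrable_add[OF 1 2]])
       (auto simp: indicator_def)
qed

text \<open>Laplace's method: after the substitution \<open>t = N + \<surd>N y\<close> in the Gamma integral the integrand
  tends to \<open>exp (- y\<^sup>2 / 2)\<close> and is dominated by \<open>gamma_integrand_bound\<close>.\<close>

theorem stirling_limit:
  "(\<lambda>N. real N ^ N * exp (- real N) * sqrt (real N) / fact N) \<longlonglongrightarrow> 1 / sqrt (2 * pi)"
proof -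
  define f where "f = (\<lambda>N y. if 0 \<le> 1 + y / sqrt (real N) then (1 + y / sqrt (real N)) ^ N * exp (- sqrt (real N) * y) else 0)"
  have F: "(LBINT y. f N y) = fact N / (real N ^ N * exp (- real N) * sqrt (real N))" if N: "N > 0" for N
  proof -
    have sN: "sqrt (real N) > 0" "sqrt (real N) * sqrt (real N) = real N" using N by auto
    have "fact N = \<bar>sqrt (real N)\<bar> *\<^sub>R (LBINT y. indicator {0..} (real N + sqrt (real N) * y)
        * ((real N + sqrt (real N) * y) ^ N * exp (- (real N + sqrt (real N) * y))))"
      using lborel_integral_real_affine[of "sqrt (real N)" "\<lambda>t. indicator {0..} t * (t ^ N * exp (- t))" "real N"] sN
      unfolding integral_power_exp(2) by simp
    also have "(\<lambda>y. indicator {0..} (real N + sqrt (real N) * y) * ((real N + sqrt (real N) * y) ^ N * exp (- (real N + sqrt (real N) * y))))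
       = (\<lambda>y. (real N ^ N * exp (- real N)) * f N y)"
    proof
      fix y
      have e: "real N + sqrt (real N) * y = real N * (1 + y / sqrt (real N))"
        using sN by (simp add: field_simps)
      have i: "(0 \<le> real N * (1 + y / sqrt (real N))) = (0 \<le> 1 + y / sqrt (real N))"
        using N by (simp add: zero_le_mult_iff)
      have x: "exp (- (real N + sqrt (real N) * y)) = exp (- real N) * exp (- sqrt (real N) * y)"
        by (simp add: exp_add[symmetric])
      show "indicator {0..} (real N + sqrt (real N) * y) * ((real N + sqrt (real N) * y) ^ N * exp (- (real N + sqrt (real N) * y)))
         = (real N ^ N * exp (- real N)) * f N y"
        unfolding x unfolding e indicator_def atLeast_iff i f_def power_mult_distrib by simp
    qed
    finally show ?thesis using N sN by (simp add: field_simps)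
  qed
  have "(\<lambda>N. LBINT y. f (Suc N) y) \<longlonglongrightarrow> (LBINT y::real. exp (- (1/2) * y\<^sup>2))"
  proof (rule integral_dominated_convergence[where w = "\<lambda>y. exp (1/2) * exp (- (1/2) * \<bar>y\<bar>)"])
    show "integrable lborel (\<lambda>y. exp (1/2) * exp (- (1/2::real) * \<bar>y\<bar>))"
      using integrable_exp_minus_abs[of "1/2"] by simp
    show "AE y in lborel. norm (f (Suc N) y) \<le> exp (1/2) * exp (- (1/2) * \<bar>y\<bar>)" for N
    proof (intro always_eventually allI)
      fix y
      show "norm (f (Suc N) y) \<le> exp (1/2) * exp (- (1/2) * \<bar>y\<bar>)"
        using gamma_integrand_bound[of "Suc N" y] by (simp add: f_def exp_add[symmetric] abs_mult)
    qed
    show "AE y in lborel. (\<lambda>N. f (Suc N) y) \<longlonglongrightarrow> exp (- (1/2) * y\<^sup>2)"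
    proof (intro always_eventually allI)
      fix y :: real
      have "(\<lambda>N. exp (real N * ln (1 + y / sqrt (real N)) - sqrt (real N) * y)) \<longlonglongrightarrow> exp (- (1/2) * y\<^sup>2)"
        by (intro tendsto_exp) (real_asymp simp: power2_eq_square)
      moreover have "eventually (\<lambda>N. exp (real N * ln (1 + y / sqrt (real N)) - sqrt (real N) * y) = f N y) sequentially"
      proof -
        have "(\<lambda>N. 1 + y / sqrt (real N)) \<longlonglongrightarrow> 1" by real_asymp
        then have "eventually (\<lambda>N. 1 + y / sqrt (real N) > 0) sequentially"
          by (rule order_tendstoD) simp
        then show ?thesis
          by eventually_elim (simp add: f_def exp_diff exp_minus exp_of_nat_mult field_simps)
      qed
      ultimately have "(\<lambda>N. f N y) \<longlonglongrightarrow> exp (- (1/2) * y\<^sup>2)" by (rule Lim_transform_eventually)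
      then show "(\<lambda>N. f (Suc N) y) \<longlonglongrightarrow> exp (- (1/2) * y\<^sup>2)" by (rule LIMSEQ_Suc)
    qed
    show "f (Suc N) \<in> borel_measurable lborel" for N unfolding f_def by measurable
  qed measurable
  then have "(\<lambda>N. inverse (LBINT y. f (Suc N) y)) \<longlonglongrightarrow> inverse (sqrt (2 * pi))"
    using integral_gauss[of "1/2"] by (intro tendsto_inverse) (auto simp: mult.commute)
  then have "(\<lambda>N. real (Suc N) ^ Suc N * exp (- real (Suc N)) * sqrt (real (Suc N)) / fact (Suc N)) \<longlonglongrightarrow> inverse (sqrt (2 * pi))"
    unfolding F[OF zero_less_Suc] by (simp only: inverse_divide)
  then show ?thesis
    by (subst (asm) filterlim_sequentially_Suc[of "\<lambda>N. real N ^ N * exp (- real N) * sqrt (real N) / fact N"]) (simp add: inverse_eq_divide)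
qed

section \<open>Convergence of the rescaled polynomials to the Airy function\<close>

text \<open>Taylor's theorem on the disc of radius one half; \<open>96 = 6 * 2\<^sup>4\<close> bounds the fourth derivative.\<close>

lemma Ln_Taylor_cubic:
  assumes "cmod z < 1/2"
  shows "cmod (Ln (1 + z) - (z - z\<^sup>2 / 2 + z ^ 3 / 3)) \<le> 96 * cmod z ^ 4"
proof -
  define f :: "nat \<Rightarrow> complex \<Rightarrow> complex" where
    "f = (\<lambda>i z. if i = 0 then Ln (1 + z) else if i = 1 then inverse (1 + z) else if i = 2 then - (inverse (1 + z))\<^sup>2
       else if i = 3 then 2 * inverse (1 + z) ^ 3 else - 6 * inverse (1 + z) ^ 4)"
  have nz: "1 + x \<noteq> 0" "1 + x \<notin> \<real>\<^sub>\<le>\<^sub>0" "cmod (1 + x) \<ge> 1/2" if "x \<in> ball 0 (1/2)" for x :: complex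
  proof -
    have "1 - cmod x \<le> cmod (1 + x)" using norm_triangle_ineq4[of "1 + x" x] by simp
    then show "cmod (1 + x) \<ge> 1/2" using that by simp
    then show "1 + x \<noteq> 0" by auto
    have "Re (1 + x) > 0" using that abs_Re_le_cmod[of x] by (simp add: abs_le_iff)
    then show "1 + x \<notin> \<real>\<^sub>\<le>\<^sub>0" by (auto simp: complex_nonpos_Reals_iff)
  qed
  have "cmod (f 0 z - (\<Sum>i\<le>3. f i 0 * (z - 0) ^ i / fact i)) \<le> 96 * cmod (z - 0) ^ Suc 3 / fact 3"
  proof (rule complex_Taylor[of "ball 0 (1/2)"])
    fix i and x :: complex assume x: "x \<in> ball 0 (1/2 :: real)" and i: "i \<le> (3::nat)"
    note nz = nz[OF x]
    have dr: "((\<lambda>z. inverse (1 + z)) has_field_derivative - (inverse (1 + x))\<^sup>2) (at x within ball 0 (1/2))"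
      using nz by (auto intro!: derivative_eq_intros simp: power2_eq_square)
    consider "i = 0" | "i = 1" | "i = 2" | "i = 3" using i by linarith
    then show "(f i has_field_derivative f (Suc i) x) (at x within ball 0 (1/2))"
    proof cases
      case 1 then show ?thesis unfolding f_def using nz by (auto intro!: derivative_eq_intros simp: field_simps)
    next
      case 2 then show ?thesis unfolding f_def using dr by simp
    next
      case 3
      have "((\<lambda>z. - (inverse (1 + z))\<^sup>2) has_field_derivative - (2 * inverse (1 + x) * - (inverse (1 + x))\<^sup>2)) (at x within ball 0 (1/2))"
        using DERIV_minus[OF DERIV_power[OF dr, of 2]] by (simp add: mult_ac)
      then show ?thesis unfolding f_def using 3 by (simp add: power3_eq_cube power2_eq_square mult_ac)
    next
      case 4
      have "((\<lambda>z. 2 * (inverse (1 + z)) ^ 3) has_field_derivative 2 * (3 * inverse (1 + x) ^ 2 * - (inverse (1 + x))\<^sup>2)) (at x within ball 0 (1/2))"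
        using DERIV_cmult[OF DERIV_power[OF dr, of 3], of 2] by (simp add: mult_ac)
      then show ?thesis unfolding f_def using 4 by (simp add: eval_nat_numeral mult_ac)
    qed
  next
    fix x :: complex assume x: "x \<in> ball 0 (1/2 :: real)"
    have "inverse (cmod (1 + x)) \<le> inverse (1/2)" using nz(3)[OF x] by (intro le_imp_inverse_le) auto
    then have "inverse (cmod (1 + x)) ^ 4 \<le> 2 ^ 4" by (intro power_mono) auto
    then show "cmod (f (Suc 3) x) \<le> 96" by (simp add: f_def norm_mult norm_inverse norm_power)
  qed (use assms in auto)
  also have "(\<Sum>i\<le>3. f i 0 * (z - 0) ^ i / fact i) = z - z\<^sup>2 / 2 + z ^ 3 / 3"
    by (simp add: f_def eval_nat_numeral field_simps)
  also have "96 * cmod (z - 0) ^ Suc 3 / fact 3 \<le> 96 * cmod z ^ 4"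
    by (simp add: fact_numeral divide_le_eq)
  finally show ?thesis by (simp add: f_def)
qed

lemma zero_less_one_real: "(0::real) < 1"
  by simp

text \<open>What becomes of \<open>v\<^sup>k exp ((v - w)\<^sup>2 / (2 s))\<close> when \<open>v\<close> and \<open>w\<close> are rescaled about the double saddle
  point; the line of integration has abscissa \<open>d\<close> in the new variable.\<close>

definition airyN_integrand :: "real \<Rightarrow> nat \<Rightarrow> real \<Rightarrow> complex \<Rightarrow> real \<Rightarrow> complex" where
  "airyN_integrand e k d \<kappa> q = (1 + of_real e * (of_real d + \<i> * of_real q)) ^ k *
     exp ((of_real d + \<i> * of_real q)\<^sup>2 / (2 * of_real e) - (of_real d + \<i> * of_real q) / (of_real e)\<^sup>2
        - \<kappa> * (of_real d + \<i> * of_real q))"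

definition airyN :: "real \<Rightarrow> nat \<Rightarrow> real \<Rightarrow> complex \<Rightarrow> complex" where
  "airyN e k d \<kappa> = (LBINT q. airyN_integrand e k d \<kappa> q)"

text \<open>The substitution \<open>v \<mapsto> b (1 + e v)\<close> in \<open>hpoly_vertical_integral\<close>. At \<open>w = 2 b\<close> with \<open>N s = b\<^sup>2\<close> and
  \<open>N = e\<^bsup>-3\<^esup>\<close> the two saddle points of \<open>v\<^sup>N exp ((v - w)\<^sup>2 / (2 s))\<close> coincide in \<open>b\<close>, and \<open>\<kappa>\<close> measures
  the distance of \<open>w\<close> from \<open>2 b\<close>.\<close>

lemma hpoly_eq_airyN:
  fixes e b d :: real
  assumes e: "e > 0" and b: "b > 0"
  shows "poly (hpoly (b\<^sup>2 * e ^ 3) k) (of_real b * (2 + \<kappa> * (of_real e)\<^sup>2)) =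
    of_real (b ^ k * e / sqrt (2 * pi * e ^ 3)) * exp ((1 + \<kappa> * (of_real e)\<^sup>2)\<^sup>2 / (2 * (of_real e) ^ 3)) * airyN e k d \<kappa>"
proof -
  define s where "s = b\<^sup>2 * e ^ 3"
  define w where "w = of_real b * (2 + \<kappa> * (of_real e)\<^sup>2)"
  define K where "K = exp ((1 + \<kappa> * (of_real e)\<^sup>2)\<^sup>2 / (2 * (of_real e) ^ 3))"
  define v where "v = (\<lambda>q. of_real d + \<i> * of_real q :: complex)"
  have s: "s > 0" using e b by (simp add: s_def)
  have be: "b * e > 0" "b * e \<noteq> 0" using e b by simp_all
  have P: "of_real (b * (1 + e * d)) + \<i> * of_real (b * e * q) = of_real b * (1 + of_real e * v q)" for q
    by (simp add: v_def algebra_simps)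
  have X: "(of_real b * (1 + of_real e * v) - w)\<^sup>2 / (2 * of_real s)
      = (1 + \<kappa> * (of_real e)\<^sup>2)\<^sup>2 / (2 * (of_real e) ^ 3) + (v\<^sup>2 / (2 * of_real e) - v / (of_real e)\<^sup>2 - \<kappa> * v)" for v
  proof -
    have "(of_real b * (1 + of_real e * v) - w)\<^sup>2 = (of_real b)\<^sup>2 * (of_real e * v - (1 + \<kappa> * (of_real e)\<^sup>2))\<^sup>2"
      unfolding w_def power_mult_distrib[symmetric] by (simp add: algebra_simps)
    then have "(of_real b * (1 + of_real e * v) - w)\<^sup>2 / (2 * of_real s)
       = (of_real e * v - (1 + \<kappa> * (of_real e)\<^sup>2))\<^sup>2 / (2 * (of_real e) ^ 3)"
      using b by (simp add: s_def)
    also have "\<dots> = (1 + \<kappa> * (of_real e)\<^sup>2)\<^sup>2 / (2 * (of_real e) ^ 3) + (v\<^sup>2 / (2 * of_real e) - v / (of_real e)\<^sup>2 - \<kappa> * v)"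
      using e by (simp add: field_simps power2_eq_square power3_eq_cube)
    finally show ?thesis .
  qed
  have "of_real (sqrt (2 * pi * s)) * poly (hpoly s k) w =
     (LBINT t. (of_real (b * (1 + e * d)) + \<i> * of_real t) ^ k * exp ((of_real (b * (1 + e * d)) + \<i> * of_real t - w)\<^sup>2 / (2 * of_real s)))"
    by (rule hpoly_vertical_integral[OF s])
  also have "\<dots> = \<bar>b * e\<bar> *\<^sub>R (LBINT q. (of_real (b * (1 + e * d)) + \<i> * of_real (b * e * q)) ^ k *
       exp ((of_real (b * (1 + e * d)) + \<i> * of_real (b * e * q) - w)\<^sup>2 / (2 * of_real s)))"
    by (subst lborel_integral_real_affine[of "b * e" _ 0]) (use be in simp_all)
  also have "\<dots> = of_real (b * e) * (LBINT q. (of_real b) ^ k * K * ((1 + of_real e * v q) ^ k *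
      exp ((v q)\<^sup>2 / (2 * of_real e) - v q / (of_real e)\<^sup>2 - \<kappa> * v q)))"
    unfolding P X exp_add K_def[symmetric] power_mult_distrib using be
    by (simp add: scaleR_conv_of_real mult_ac)
  also have "\<dots> = of_real (b * e) * ((of_real b) ^ k * K * airyN e k d \<kappa>)"
    unfolding integral_mult_right_zero airyN_def airyN_integrand_def v_def ..
  finally have "of_real (sqrt (2 * pi * s)) * poly (hpoly s k) w = of_real (b * e) * ((of_real b) ^ k * K * airyN e k d \<kappa>)" .
  moreover have "sqrt (2 * pi * s) = b * sqrt (2 * pi * e ^ 3)"
    using b by (simp add: s_def real_sqrt_mult)
  ultimately have "of_real b * (of_real (sqrt (2 * pi * e ^ 3)) * poly (hpoly s k) w) = of_real b * (of_real e * ((of_real b) ^ k * K * airyN e k d \<kappa>))"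
    by (simp add: mult_ac)
  then have "of_real (sqrt (2 * pi * e ^ 3)) * poly (hpoly s k) w = of_real e * ((of_real b) ^ k * K * airyN e k d \<kappa>)"
    using b by simp
  moreover have "sqrt (2 * pi * e ^ 3) \<noteq> 0" using e by simp
  ultimately have "poly (hpoly s k) w = of_real e * ((of_real b) ^ k * K * airyN e k d \<kappa>) / of_real (sqrt (2 * pi * e ^ 3))"
    by (simp only: eq_divide_eq of_real_eq_0_iff) (simp add: mult.commute)
  then show ?thesis unfolding s_def w_def K_def by (simp add: mult_ac)
qed

text \<open>The other side of \<open>hpoly_eq_airyN\<close> does not contain the abscissa.\<close>

lemma airyN_indep:
  assumes e: "e > 0"
  shows "airyN e k d \<kappa> = airyN e k d' \<kappa>"
  using hpoly_eq_airyN[OF e zero_less_one_real, of k \<kappa> d] hpoly_eq_airyN[OF e zero_less_one_real, of k \<kappa> d'] e by simp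

lemma ln_cubic_bound:
  fixes x :: real assumes "x \<ge> 0"
  shows "ln (1 + x) - x + x\<^sup>2 / 2 \<le> x ^ 3 / 3"
proof -
  define f where "f = (\<lambda>x::real. x ^ 3 / 3 - (ln (1 + x) - x + x\<^sup>2 / 2))"
  have "f 0 \<le> f x"
  proof (rule DERIV_nonneg_imp_nondecreasing[OF assms])
    fix y :: real assume y: "0 \<le> y" "y \<le> x"
    have "(f has_real_derivative (y\<^sup>2 - (1 / (1 + y) - 1 + y))) (at y)"
      unfolding f_def using y by (auto intro!: derivative_eq_intros simp: power2_eq_square)
    moreover have "y\<^sup>2 - (1 / (1 + y) - 1 + y) = y ^ 3 / (1 + y)"
      using y by (simp add: field_simps power2_eq_square power3_eq_cube)
    ultimately show "\<exists>D. (f has_real_derivative D) (at y) \<and> 0 \<le> D" using y by (auto intro!: exI)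
  qed
  then show ?thesis by (simp add: f_def)
qed

text \<open>On a vertical line \<open>\<bar>1 + e v\<bar>\<^sup>2 = (1 + e d)\<^sup>2 + (e q)\<^sup>2\<close>. The growth in \<open>q\<close> of its power is slower,
  by the factor \<open>(1 + e d)\<^bsup>-2\<^esup>\<close> in the exponent, than the Gaussian decay of the exponential.\<close>

lemma airyN_integrand_bound:
  fixes e d :: real
  assumes e: "e > 0" and N: "real N * e ^ 3 = 1" and d: "d > 0" and k: "k \<le> N"
  shows "cmod (airyN_integrand e k d \<kappa> q) \<le>
    exp ((ln (1 + e * d) - e * d + (e * d)\<^sup>2 / 2) / e ^ 3 - d * Re \<kappa>) *
    exp (\<bar>Im \<kappa>\<bar> * \<bar>q\<bar> - (1 - 1 / (1 + e * d)\<^sup>2) / (2 * e) * q\<^sup>2)"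
proof -
  define v where "v = of_real d + \<i> * of_real q"
  define X where "X = e * d"
  have X: "X > 0" using e d by (simp add: X_def)
  have v: "Re v = d" "Im v = q" by (simp_all add: v_def)
  have N': "real N = 1 / e ^ 3" using N e by (simp add: field_simps)
  have m2: "(cmod (1 + of_real e * v))\<^sup>2 = (1 + X)\<^sup>2 + (e * q)\<^sup>2"
    by (simp add: cmod_power2 v X_def)
  have "(1 + X)\<^sup>2 + (e * q)\<^sup>2 = (1 + X)\<^sup>2 * (1 + (e * q)\<^sup>2 / (1 + X)\<^sup>2)"
    using X by (simp add: field_simps)
  also have "\<dots> \<le> (1 + X)\<^sup>2 * exp ((e * q)\<^sup>2 / (1 + X)\<^sup>2)"
    by (intro mult_left_mono exp_ge_add_one_self) auto
  also have "\<dots> = ((1 + X) * exp ((e * q)\<^sup>2 / (2 * (1 + X)\<^sup>2)))\<^sup>2"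
    by (simp add: power_mult_distrib exp_double[symmetric])
  finally have "(cmod (1 + of_real e * v))\<^sup>2 \<le> ((1 + X) * exp ((e * q)\<^sup>2 / (2 * (1 + X)\<^sup>2)))\<^sup>2"
    unfolding m2 .
  then have le: "cmod (1 + of_real e * v) \<le> (1 + X) * exp ((e * q)\<^sup>2 / (2 * (1 + X)\<^sup>2))"
    by (rule power2_le_imp_le) (rule mult_nonneg_nonneg, use X in simp, rule exp_ge_zero)
  have "Re (1 + of_real e * v) \<ge> 1" using X by (simp add: v X_def)
  then have ge1: "cmod (1 + of_real e * v) \<ge> 1" using complex_Re_le_cmod[of "1 + of_real e * v"] by linarith
  have "cmod (1 + of_real e * v) ^ k \<le> cmod (1 + of_real e * v) ^ N"
    using ge1 k by (rule power_increasing[rotated])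
  also have "\<dots> \<le> ((1 + X) * exp ((e * q)\<^sup>2 / (2 * (1 + X)\<^sup>2))) ^ N"
    using le by (intro power_mono) auto
  also have "\<dots> = exp (real N * ln (1 + X)) * exp (real N * ((e * q)\<^sup>2 / (2 * (1 + X)\<^sup>2)))"
    unfolding power_mult_distrib exp_of_nat_mult using X by simp
  finally have 1: "cmod (1 + of_real e * v) ^ k \<le> exp (real N * ln (1 + X)) * exp (real N * ((e * q)\<^sup>2 / (2 * (1 + X)\<^sup>2)))" .
  have R: "Re (v\<^sup>2 / (2 * of_real e) - v / (of_real e)\<^sup>2 - \<kappa> * v) = (d\<^sup>2 - q\<^sup>2) / (2 * e) - d / e\<^sup>2 - (Re \<kappa> * d - Im \<kappa> * q)"
  proof -
    have a: "v\<^sup>2 / (2 * of_real e) = v\<^sup>2 / of_real (2 * e)" "v / (of_real e)\<^sup>2 = v / of_real (e\<^sup>2)" by simp_all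
    show ?thesis unfolding a minus_complex.sel Re_divide_of_real by (simp add: v power2_eq_square)
  qed
  have "Im \<kappa> * q \<le> \<bar>Im \<kappa>\<bar> * \<bar>q\<bar>" by (metis abs_ge_self abs_mult)
  then have 2: "cmod (exp (v\<^sup>2 / (2 * of_real e) - v / (of_real e)\<^sup>2 - \<kappa> * v)) \<le> exp ((d\<^sup>2 - q\<^sup>2) / (2 * e) - d / e\<^sup>2 - Re \<kappa> * d + \<bar>Im \<kappa>\<bar> * \<bar>q\<bar>)"
    unfolding norm_exp_eq_Re R by simp
  have "cmod (airyN_integrand e k d \<kappa> q) \<le> (exp (real N * ln (1 + X)) * exp (real N * ((e * q)\<^sup>2 / (2 * (1 + X)\<^sup>2))))
      * exp ((d\<^sup>2 - q\<^sup>2) / (2 * e) - d / e\<^sup>2 - Re \<kappa> * d + \<bar>Im \<kappa>\<bar> * \<bar>q\<bar>)"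
    unfolding airyN_integrand_def v_def[symmetric] norm_mult norm_power
    by (intro mult_mono 1 2) auto
  also have "\<dots> = exp ((ln (1 + X) - X + X\<^sup>2 / 2) / e ^ 3 - d * Re \<kappa>) * exp (\<bar>Im \<kappa>\<bar> * \<bar>q\<bar> - (1 - 1 / (1 + X)\<^sup>2) / (2 * e) * q\<^sup>2)"
  proof -
    have a: "real N * ln (1 + X) + (d\<^sup>2 / (2 * e) - d / e\<^sup>2) = (ln (1 + X) - X + X\<^sup>2 / 2) / e ^ 3"
      unfolding N' X_def using e by (simp add: field_simps power2_eq_square power3_eq_cube)
    have b: "real N * ((e * q)\<^sup>2 / (2 * (1 + X)\<^sup>2)) - q\<^sup>2 / (2 * e) = - ((1 - 1 / (1 + X)\<^sup>2) / (2 * e) * q\<^sup>2)"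
    proof -
      have "real N * (e * q)\<^sup>2 = q\<^sup>2 / e" unfolding N' using e by (simp add: field_simps power2_eq_square power3_eq_cube)
      then have 1: "real N * ((e * q)\<^sup>2 / (2 * (1 + X)\<^sup>2)) = q\<^sup>2 / e / (2 * (1 + X)\<^sup>2)"
        by (simp only: times_divide_eq_right)
      have "q\<^sup>2 / e / (2 * Y) - q\<^sup>2 / (2 * e) = - ((1 - 1 / Y) / (2 * e) * q\<^sup>2)" if "Y \<noteq> 0" for Y
        using that e by (simp add: field_simps)
      from this[of "(1 + X)\<^sup>2"] show ?thesis unfolding 1 using X by simp
    qed
    have c: "(d\<^sup>2 - q\<^sup>2) / (2 * e) = d\<^sup>2 / (2 * e) - q\<^sup>2 / (2 * e)" by (rule diff_divide_distrib)
    have "real N * ln (1 + X) + real N * ((e * q)\<^sup>2 / (2 * (1 + X)\<^sup>2)) + ((d\<^sup>2 - q\<^sup>2) / (2 * e) - d / e\<^sup>2 - Re \<kappa> * d + \<bar>Im \<kappa>\<bar> * \<bar>q\<bar>)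
       = ((ln (1 + X) - X + X\<^sup>2 / 2) / e ^ 3 - d * Re \<kappa>) + (\<bar>Im \<kappa>\<bar> * \<bar>q\<bar> - (1 - 1 / (1 + X)\<^sup>2) / (2 * e) * q\<^sup>2)"
    proof -
      have "t1 + t2 + ((t3 - t4) - t5 - t6 + t7) = (t9 - t6) + (t7 - t8)"
        if "t1 + (t3 - t5) = t9" "t2 - t4 = - t8" for t1 t2 t3 t4 t5 t6 t7 t8 t9 :: real
        using that by linarith
      from this[OF a b] show ?thesis unfolding c mult.commute[of d "Re \<kappa>"] .
    qed
    then show ?thesis unfolding exp_add[symmetric] by simp
  qed
  finally show ?thesis by (simp add: X_def)
qed

lemma airyN_integrand_measurable: "airyN_integrand e k d \<kappa> \<in> borel_measurable lborel"
proof -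
  have "continuous_on UNIV (airyN_integrand e k d \<kappa>)"
    unfolding airyN_integrand_def[abs_def] divide_inverse by (intro continuous_intros)
  then show ?thesis using borel_measurable_continuous_onI by simp
qed

lemma airyN_bound:
  fixes e d \<mu> M :: real
  assumes e: "e > 0" and N: "real N * e ^ 3 = 1" and d: "d > 0" and k: "k \<le> N"
    and \<mu>: "\<mu> > 0" "\<mu> \<le> (1 - 1 / (1 + e * d)\<^sup>2) / (2 * e)" and M: "\<bar>Im \<kappa>\<bar> \<le> M"
  shows "cmod (airyN e k d \<kappa>) \<le> exp ((ln (1 + e * d) - e * d + (e * d)\<^sup>2 / 2) / e ^ 3 - d * Re \<kappa>) *
      (LBINT q. exp (M * \<bar>q\<bar> - \<mu> * q\<^sup>2))"
proof -
  let ?K = "exp ((ln (1 + e * d) - e * d + (e * d)\<^sup>2 / 2) / e ^ 3 - d * Re \<kappa>)"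
  have b: "cmod (airyN_integrand e k d \<kappa> q) \<le> ?K * exp (M * \<bar>q\<bar> - \<mu> * q\<^sup>2)" for q
  proof (rule order.trans[OF airyN_integrand_bound[OF e N d k]])
    have "\<bar>Im \<kappa>\<bar> * \<bar>q\<bar> \<le> M * \<bar>q\<bar>" using M by (intro mult_right_mono) auto
    moreover have "\<mu> * q\<^sup>2 \<le> (1 - 1 / (1 + e * d)\<^sup>2) / (2 * e) * q\<^sup>2" using \<mu> by (intro mult_right_mono) auto
    ultimately show "?K * exp (\<bar>Im \<kappa>\<bar> * \<bar>q\<bar> - (1 - 1 / (1 + e * d)\<^sup>2) / (2 * e) * q\<^sup>2) \<le> ?K * exp (M * \<bar>q\<bar> - \<mu> * q\<^sup>2)"
      unfolding mult_le_cancel_left_pos[OF exp_gt_zero] exp_le_cancel_iff by linarith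
  qed
  have i: "integrable lborel (\<lambda>q. ?K * exp (M * \<bar>q\<bar> - \<mu> * q\<^sup>2))"
    using integrable_exp_linear_gauss[OF \<mu>(1), of M] by simp
  have b': "norm (airyN_integrand e k d \<kappa> q) \<le> norm (?K * exp (M * \<bar>q\<bar> - \<mu> * q\<^sup>2))" for q
    by (rule order.trans[OF b]) (simp only: real_norm_def abs_ge_self)
  have i2: "integrable lborel (airyN_integrand e k d \<kappa>)"
    by (rule Bochner_Integration.integrable_bound[OF i airyN_integrand_measurable always_eventually[OF allI[OF b']]])
  have "cmod (airyN e k d \<kappa>) \<le> (LBINT q. ?K * exp (M * \<bar>q\<bar> - \<mu> * q\<^sup>2))"
    unfolding airyN_def
    by (rule Bochner_Integration.integral_norm_bound_integral[OF i2 i b])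
  then show ?thesis by (simp only: integral_mult_right_zero)
qed

text \<open>If \<open>x\<close> is of the order of \<open>e\<close>, then this bounds the rate of the Gaussian decay in
  \<open>airyN_integrand_bound\<close> from below, uniformly in \<open>e\<close>.\<close>

lemma airyN_rate_lower:
  fixes e d x :: real
  assumes e: "e > 0" and x: "0 < x" "x \<le> 1" "x \<le> e * d"
  shows "3/8 * x / e \<le> (1 - 1 / (1 + e * d)\<^sup>2) / (2 * e)"
proof -
  have "1 / (1 + e * d)\<^sup>2 \<le> 1 / (1 + x)\<^sup>2" using x by (intro divide_left_mono power_mono) auto
  moreover have "3/4 * x \<le> 1 - 1 / (1 + x)\<^sup>2"
  proof -
    have "3/4 * x * (1 + x)\<^sup>2 \<le> (1 + x)\<^sup>2 - 1"
    proof -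
      have "(1 + x)\<^sup>2 - 1 - 3/4 * x * (1 + x)\<^sup>2 = x * (1 - x) * (3 * x + 5) / 4"
        by (simp add: power2_eq_square field_simps)
      also have "\<dots> \<ge> 0" using x by (intro divide_nonneg_pos mult_nonneg_nonneg) auto
      finally show ?thesis by linarith
    qed
    then show ?thesis using x by (simp add: field_simps)
  qed
  ultimately have "3/4 * x / (2 * e) \<le> (1 - 1 / (1 + e * d)\<^sup>2) / (2 * e)"
    using e by (intro divide_right_mono) auto
  then show ?thesis by simp
qed

text \<open>The degrees \<open>N - j\<close> with fixed \<open>j\<close> cover both polynomials of the edge formula; the missing
  factors \<open>1 + e v\<close> tend to one.\<close>

lemma airyN_tendsto:
  fixes e :: "nat \<Rightarrow> real" and N k :: "nat \<Rightarrow> nat" and \<kappa> :: "nat \<Rightarrow> complex"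
  assumes e: "\<And>n. e n > 0" "\<And>n. e n \<le> 1" "e \<longlonglongrightarrow> 0" and N: "\<And>n. real (N n) * e n ^ 3 = 1"
    and k: "\<And>n. k n + j = N n" and \<kappa>: "\<kappa> \<longlonglongrightarrow> \<kappa>0"
  shows "(\<lambda>n. airyN (e n) (k n) 1 (\<kappa> n)) \<longlonglongrightarrow> 2 * of_real pi * Ai \<kappa>0"
proof -
  obtain M where M: "\<And>n. cmod (\<kappa> n) \<le> M" using convergent_imp_Bseq[OF convergentI[OF \<kappa>]] by (auto simp: Bseq_def)
  have "(\<lambda>n. LBINT q. airyN_integrand (e n) (k n) 1 (\<kappa> n) q) \<longlonglongrightarrow> (LBINT q. exp (airy_exponent \<kappa>0 (of_real 1 + \<i> * of_real q)))"
  proof (rule integral_dominated_convergence[where w = "\<lambda>q. exp (1/3 + M) * exp (M * \<bar>q\<bar> - 3/8 * q\<^sup>2)"])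
    show "integrable lborel (\<lambda>q. exp (1/3 + M) * exp (M * \<bar>q\<bar> - 3/8 * q\<^sup>2))"
      using integrable_exp_linear_gauss[of "3/8" M] by simp
    show "(\<lambda>q. exp (airy_exponent \<kappa>0 (of_real 1 + \<i> * of_real q))) \<in> borel_measurable lborel"
      using borel_measurable_integrable[OF integrable_airy_vertical[OF zero_less_one_real]] .
    show "AE q in lborel. norm (airyN_integrand (e n) (k n) 1 (\<kappa> n) q) \<le> exp (1/3 + M) * exp (M * \<bar>q\<bar> - 3/8 * q\<^sup>2)" for n
    proof (intro always_eventually allI)
      fix q
      have kN: "k n \<le> N n" using k[of n] by simp
      have i: "\<bar>Im (\<kappa> n)\<bar> * \<bar>q\<bar> \<le> M * \<bar>q\<bar>" using abs_Im_le_cmod[of "\<kappa> n"] M[of n] by (intro mult_right_mono) auto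
      have r: "- Re (\<kappa> n) \<le> M" using abs_Re_le_cmod[of "\<kappa> n"] M[of n] by linarith
      have l: "(ln (1 + e n * 1) - e n * 1 + (e n * 1)\<^sup>2 / 2) / e n ^ 3 \<le> 1/3"
        using ln_cubic_bound[of "e n"] e(1)[of n] by (simp add: divide_le_eq)
      have m: "3/8 * q\<^sup>2 \<le> (1 - 1 / (1 + e n * 1)\<^sup>2) / (2 * e n) * q\<^sup>2"
        using airyN_rate_lower[of "e n" "e n" 1] e(1,2)[of n] by (intro mult_right_mono) auto
      show "norm (airyN_integrand (e n) (k n) 1 (\<kappa> n) q) \<le> exp (1/3 + M) * exp (M * \<bar>q\<bar> - 3/8 * q\<^sup>2)"
        by (rule order.trans[OF airyN_integrand_bound[OF e(1) N zero_less_one_real kN]])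
           (unfold exp_add[symmetric] exp_le_cancel_iff, use i r l m in linarith)
    qed
    show "AE q in lborel. (\<lambda>n. airyN_integrand (e n) (k n) 1 (\<kappa> n) q) \<longlonglongrightarrow> exp (airy_exponent \<kappa>0 (of_real 1 + \<i> * of_real q))"
    proof (intro always_eventually allI)
      fix q
      define v where "v = of_real 1 + \<i> * complex_of_real q"
      \<comment> \<open>The remainder of the logarithm after three terms is of the order of \<open>e\<^sup>4\<close>, and \<open>N = e\<^bsup>-3\<^esup>\<close>.\<close>
      define T where "T = (\<lambda>n. Ln (1 + of_real (e n) * v) - (of_real (e n) * v - (of_real (e n) * v)\<^sup>2 / 2 + (of_real (e n) * v) ^ 3 / 3))"
      have ev: "(\<lambda>n. of_real (e n) * v) \<longlonglongrightarrow> 0"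
        using tendsto_mult_left_zero[OF tendsto_of_real[OF e(3), where ?'a = complex, simplified]] .
      then have small: "eventually (\<lambda>n. cmod (of_real (e n) * v) < 1/2) sequentially"
        using order_tendstoD(2)[OF tendsto_norm[OF ev], of "1/2"] by simp
      have nz: "1 + of_real (e n) * v \<noteq> 0" for n
      proof -
        have "Re (1 + of_real (e n) * v) > 0" using e(1)[of n] by (simp add: v_def)
        then show ?thesis by (metis less_irrefl zero_complex.sel(1))
      qed
      have "(\<lambda>n. of_nat (N n) * T n) \<longlonglongrightarrow> 0"
      proof (rule Lim_null_comparison)
        show "eventually (\<lambda>n. norm (of_nat (N n) * T n) \<le> 96 * cmod v ^ 4 * e n) sequentially"
          using small
        proof eventually_elim
          case (elim n)
          have "norm (of_nat (N n) * T n) \<le> real (N n) * (96 * cmod (of_real (e n) * v) ^ 4)"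
            unfolding norm_mult[of "of_nat (N n)"] norm_of_nat T_def
            by (rule mult_left_mono[OF Ln_Taylor_cubic[OF elim]]) simp
          also have "\<dots> = 96 * cmod v ^ 4 * e n * (real (N n) * e n ^ 3)"
            using e(1)[of n] by (simp add: norm_mult power_mult_distrib power3_eq_cube eval_nat_numeral mult_ac)
          finally show ?case unfolding N by simp
        qed
        show "(\<lambda>n. 96 * cmod v ^ 4 * e n) \<longlonglongrightarrow> 0" by (rule tendsto_mult_right_zero[OF e(3)])
      qed
      then have "(\<lambda>n. exp (of_nat (N n) * T n + v ^ 3 / 3 - \<kappa> n * v) / (1 + of_real (e n) * v) ^ j) \<longlonglongrightarrow> exp (0 + v ^ 3 / 3 - \<kappa>0 * v) / (1 + 0) ^ j"
        by (intro tendsto_intros \<kappa> ev) auto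
      moreover have "exp (of_nat (N n) * T n + v ^ 3 / 3 - \<kappa> n * v) / (1 + of_real (e n) * v) ^ j = airyN_integrand (e n) (k n) 1 (\<kappa> n) q" for n
      proof -
        let ?e = "of_real (e n) :: complex"
        have ne: "?e \<noteq> 0" using e(1)[of n] by simp
        have Nn: "of_nat (N n) = 1 / ?e ^ 3"
        proof -
          have "real (N n) = 1 / e n ^ 3" using N[of n] e(1)[of n] by (simp add: field_simps)
          then have "complex_of_real (real (N n)) = complex_of_real (1 / e n ^ 3)" by simp
          then show ?thesis by simp
        qed
        have "of_nat (N n) * T n + v ^ 3 / 3 - \<kappa> n * v
          = of_nat (N n) * Ln (1 + ?e * v) + (v\<^sup>2 / (2 * ?e) - v / ?e\<^sup>2 - \<kappa> n * v)"
          unfolding T_def right_diff_distrib Nn using ne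
          by (simp add: field_simps power2_eq_square power3_eq_cube)
        moreover have "exp (of_nat (N n) * Ln (1 + ?e * v)) = (1 + ?e * v) ^ N n"
          using nz[of n] by (simp add: exp_of_nat_mult)
        moreover have "(1 + ?e * v) ^ N n / (1 + ?e * v) ^ j = (1 + ?e * v) ^ k n"
          unfolding k[symmetric] power_add using nz[of n] by simp
        ultimately have "exp (of_nat (N n) * T n + v ^ 3 / 3 - \<kappa> n * v) / (1 + ?e * v) ^ j
           = (1 + ?e * v) ^ k n * exp (v\<^sup>2 / (2 * ?e) - v / ?e\<^sup>2 - \<kappa> n * v)"
          by (simp only: exp_add times_divide_eq_left[symmetric])
        then show ?thesis by (simp only: airyN_integrand_def v_def)
      qed
      ultimately show "(\<lambda>n. airyN_integrand (e n) (k n) 1 (\<kappa> n) q) \<longlonglongrightarrow> exp (airy_exponent \<kappa>0 (of_real 1 + \<i> * of_real q))"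
        by (simp add: airy_exponent_def v_def)
    qed
  qed (rule airyN_integrand_measurable)
  then show ?thesis
    unfolding airyN_def
    by (simp add: Ai_vertical_integral[OF zero_less_one_real])
qed

section \<open>An exact formula at the edge\<close>

definition edge_scale :: "real \<Rightarrow> real \<Rightarrow> real" where
  "edge_scale c e = 1 / sqrt (1 - (c\<^sup>2 * e)\<^sup>2)"

text \<open>The parameter \<open>\<kappa>\<close> of \<open>hpoly_eq_airyN\<close> that belongs to the rescaled coordinate \<open>z\<close>; it tends to
  \<open>2 c z + c\<^sup>4\<close>. The shift \<open>c\<^sup>4\<close> is the distance between the end-point of the droplet and the point
  \<open>2 b\<close>, measured in the scale of \<open>\<kappa>\<close>.\<close>

definition scaled_edge :: "real \<Rightarrow> real \<Rightarrow> complex \<Rightarrow> complex" where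
  "scaled_edge c e z = of_real (2 * (edge_scale c e - 1) / e\<^sup>2) + of_real (2 * c * edge_scale c e) * z"

text \<open>The factor in front collects what the weight and the Gaussian prefactors of the two polynomials
  leave after the part that is constant in \<open>\<kappa>\<close> has been split off.\<close>

definition edge_integrand :: "real \<Rightarrow> real \<Rightarrow> nat \<Rightarrow> complex \<Rightarrow> real" where
  "edge_integrand c e n \<kappa> =
     exp (2 * c\<^sup>2 * Re \<kappa> + (1 + c\<^sup>2 * e) * e * (Re \<kappa>)\<^sup>2 / 2 - e * (Im \<kappa>)\<^sup>2) *
     Re (airyN e (Suc n) 1 \<kappa> * cnj (airyN e n 1 \<kappa>))"

text \<open>With \<open>N = e\<^bsup>-3\<^esup>\<close> the weight contributes \<open>- N (Re w)\<^sup>2 / 2\<close> to the exponent and the two polynomials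
  \<open>N Re ((1 + \<kappa> e\<^sup>2)\<^sup>2)\<close>; at \<open>b\<^sup>2 = 1 - c\<^sup>2 e\<close> the terms that are linear in \<open>\<kappa>\<close> cancel up to
  \<open>2 c\<^sup>2 Re \<kappa>\<close>.\<close>

lemma gauss_hpoly_product_eq:
  fixes e b c :: real and \<kappa> w :: complex
  assumes e: "e > 0" and b: "b > 0" "b\<^sup>2 = 1 - c\<^sup>2 * e" and w: "w = of_real b * (2 + \<kappa> * (of_real e)\<^sup>2)"
  shows "exp (- (Re w)\<^sup>2 / (2 * e ^ 3)) * Re (poly (hpoly (b\<^sup>2 * e ^ 3) (Suc n)) w * cnj (poly (hpoly (b\<^sup>2 * e ^ 3) n) w))
    = b ^ (2 * n + 1) / (2 * pi * e) * exp ((2 * c\<^sup>2 * e - 1) / e ^ 3) * edge_integrand c e n \<kappa>"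
proof -
  let ?H = "\<lambda>k. poly (hpoly (b\<^sup>2 * e ^ 3) k) w"
  let ?G = "2 * c\<^sup>2 * Re \<kappa> + (1 + c\<^sup>2 * e) * e * (Re \<kappa>)\<^sup>2 / 2 - e * (Im \<kappa>)\<^sup>2"
  define C where "C = (\<lambda>k. b ^ k * e / sqrt (2 * pi * e ^ 3))"
  define K where "K = exp ((1 + \<kappa> * (of_real e)\<^sup>2)\<^sup>2 / (2 * (of_real e) ^ 3))"
  define A where "A = (\<lambda>k. airyN e k 1 \<kappa>)"
  have P: "?H k = of_real (C k) * K * A k" for k
    unfolding w C_def K_def A_def by (rule hpoly_eq_airyN[OF e b(1)])
  have re: "Re (of_real x * (of_real y * u)) = x * (y * Re u)" for x y u by simp
  have CC: "C (Suc n) * C n = b ^ (2 * n + 1) / (2 * pi * e)"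
  proof -
    have "sqrt (2 * pi * e ^ 3) * sqrt (2 * pi * e ^ 3) = 2 * pi * e ^ 3" using e by simp
    then have "C (Suc n) * C n = b ^ Suc n * b ^ n * e\<^sup>2 / (2 * pi * e ^ 3)"
      unfolding C_def by (simp add: power2_eq_square mult_ac)
    also have "b ^ Suc n * b ^ n = b ^ (2 * n + 1)" by (simp add: power_add[symmetric] mult_2)
    finally show ?thesis using e by (simp add: power2_eq_square power3_eq_cube)
  qed
  have "?H (Suc n) * cnj (?H n)
     = of_real (C (Suc n) * C n) * ((K * cnj K) * (A (Suc n) * cnj (A n)))"
    unfolding P by (simp add: mult_ac)
  also have "K * cnj K = of_real ((cmod K)\<^sup>2)" by (rule complex_norm_square[symmetric])
  finally have PP: "Re (?H (Suc n) * cnj (?H n))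
     = C (Suc n) * C n * ((cmod K)\<^sup>2 * Re (A (Suc n) * cnj (A n)))"
    by (simp only: re)
  have KK: "(cmod K)\<^sup>2 = exp (((1 + Re \<kappa> * e\<^sup>2)\<^sup>2 - (Im \<kappa> * e\<^sup>2)\<^sup>2) / e ^ 3)"
  proof -
    have "(1 + \<kappa> * (of_real e)\<^sup>2)\<^sup>2 / (2 * (of_real e) ^ 3) = (1 + \<kappa> * of_real (e\<^sup>2))\<^sup>2 / of_real (2 * e ^ 3)" by simp
    then have "Re ((1 + \<kappa> * (of_real e)\<^sup>2)\<^sup>2 / (2 * (of_real e) ^ 3)) = ((1 + Re \<kappa> * e\<^sup>2)\<^sup>2 - (Im \<kappa> * e\<^sup>2)\<^sup>2) / (2 * e ^ 3)"
      unfolding Re_divide_of_real by (simp add: power2_eq_square)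
    moreover have "(exp (t / (2 * y)))\<^sup>2 = exp (t / y)" for t y :: real
      using exp_double[of "t / (2 * y)"] by simp
    ultimately show ?thesis unfolding K_def norm_exp_eq_Re by simp
  qed
  have Rw: "Re w = b * (2 + Re \<kappa> * e\<^sup>2)"
    unfolding w by (simp flip: of_real_power)
  have ex: "- (Re w)\<^sup>2 / (2 * e ^ 3) + ((1 + Re \<kappa> * e\<^sup>2)\<^sup>2 - (Im \<kappa> * e\<^sup>2)\<^sup>2) / e ^ 3
     = (2 * c\<^sup>2 * e - 1) / e ^ 3 + ?G"
    unfolding Rw power_mult_distrib b(2) using e by (simp add: field_simps power2_eq_square power3_eq_cube)
  have "exp (- (Re w)\<^sup>2 / (2 * e ^ 3)) * (cmod K)\<^sup>2 = exp ((2 * c\<^sup>2 * e - 1) / e ^ 3) *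
     exp ?G"
    unfolding KK exp_add[symmetric] ex ..
  then have "exp (- (Re w)\<^sup>2 / (2 * e ^ 3)) * (C (Suc n) * C n * ((cmod K)\<^sup>2 * R))
     = C (Suc n) * C n * (exp ((2 * c\<^sup>2 * e - 1) / e ^ 3) *
     exp ?G) * R" for R
  proof -
    have "x * (y * (k * R)) = y * t * R" if "x * k = t" for x y k t :: real
      unfolding that[symmetric] by (simp only: mult_ac)
    then show ?thesis using \<open>exp (- (Re w)\<^sup>2 / (2 * e ^ 3)) * (cmod K)\<^sup>2 = _\<close> by blast
  qed
  then show ?thesis unfolding PP CC edge_integrand_def A_def by (simp only: mult.assoc)
qed

text \<open>The power of \<open>N\<close> that is left is exactly the one in Stirling's formula.\<close>

lemma one_point_prefactor:
  fixes c e :: real and n :: nat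
  defines "N \<equiv> real (Suc n)" and "h \<equiv> c\<^sup>2 * e"
  assumes c: "c > 0" and e: "e > 0" and Ne: "N * e ^ 3 = 1" and h: "h < 1"
    and D: "D = sqrt (1 + h) / (2 * c * e\<^sup>2)"
  shows "sqrt (N / 2 * (N / (2 * h))) * (2 * (N / 2) / (D * (fact n * ((1 + h) * e ^ 3) ^ n)))
      * (sqrt (1 - h) ^ (2 * n + 1) / (2 * pi * e) * exp ((2 * h - 1) / e ^ 3)) / D\<^sup>2
    = 2 * c\<^sup>2 / pi * (1 / sqrt (1 - h\<^sup>2)) * exp (N * (ln (1 - h) - ln (1 + h) + 2 * h)) *
      (N ^ Suc n * exp (- N) * sqrt N / fact (Suc n))"
proof -
  \<comment> \<open>In terms of \<open>q\<close> all quantities are rational: \<open>N = q\<^bsup>-6\<^esup>\<close> and \<open>h = (c q)\<^sup>2\<close>.\<close>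
  define q where "q = sqrt e"
  define S where "S = sqrt (1 + h)"
  define b where "b = sqrt (1 - h)"
  have q: "q > 0" "e = q\<^sup>2" using e by (auto simp: q_def)
  have h0: "h > 0" using c e by (simp add: h_def)
  have S: "S > 0" "S\<^sup>2 = 1 + h" using h0 by (auto simp: S_def)
  have b: "b > 0" "b\<^sup>2 = 1 - h" using h by (auto simp: b_def)
  have Nq: "N = 1 / q ^ 6"
  proof -
    have "e ^ 3 = q ^ 6" unfolding q(2) power_mult[symmetric] by simp
    then show ?thesis using Ne q(1) by (simp add: eq_divide_eq)
  qed
  have sN: "sqrt N = 1 / q ^ 3"
  proof -
    have "N = (1 / q ^ 3)\<^sup>2" unfolding Nq by (simp add: power_divide power_mult[symmetric])
    then show ?thesis using q(1) by (simp add: real_sqrt_divide)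
  qed
  have sab: "sqrt (N / 2 * (N / (2 * h))) = N / (2 * (c * q))"
  proof -
    have "N / 2 * (N / (2 * h)) = (N / (2 * (c * q)))\<^sup>2"
      unfolding h_def q(2) by (simp add: power2_eq_square field_simps)
    then show ?thesis using c q by (simp add: N_def)
  qed
  have sh: "sqrt (1 - h\<^sup>2) = b * S"
  proof -
    have "1 - h\<^sup>2 = (1 - h) * (1 + h)" by (simp add: power2_eq_square algebra_simps)
    then show ?thesis by (simp add: b_def S_def real_sqrt_mult)
  qed
  have f: "fact (Suc n) = N * fact n" by (simp add: N_def)
  have bp: "b ^ (2 * n + 1) = (1 - h) ^ n * b" unfolding power_add power_mult b(2) by simp
  have E: "exp (N * (ln (1 - h) - ln (1 + h) + 2 * h)) = (1 - h) ^ Suc n / (1 + h) ^ Suc n * exp (2 * h * N)"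
  proof -
    have "exp (N * ln (1 - h)) = (1 - h) ^ Suc n" unfolding N_def exp_of_nat_mult using h by simp
    moreover have "exp (N * ln (1 + h)) = (1 + h) ^ Suc n" unfolding N_def exp_of_nat_mult using h0 by simp
    ultimately show ?thesis by (simp add: exp_add exp_diff distrib_left right_diff_distrib mult_ac)
  qed
  have X: "exp ((2 * h - 1) / e ^ 3) = exp (2 * h * N) * exp (- N)"
  proof -
    have "(2 * h - 1) / e ^ 3 = (2 * h - 1) * N" using Ne e by (simp add: field_simps)
    then show ?thesis by (simp add: exp_add[symmetric] algebra_simps)
  qed
  have mp: "((1 + h) * e ^ 3) ^ n = (1 + h) ^ n / N ^ n"
  proof -
    have "e ^ 3 = 1 / N" using Ne e by (simp add: field_simps N_def)
    then show ?thesis by (simp add: power_divide)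
  qed
  define U V W F Y Z where "U = (1 - h) ^ n" "V = (1 + h) ^ n" "W = N ^ n" "F = (fact n :: real)" "Y = exp (2 * h * N)" "Z = exp (- N)"
  have pos: "V > 0" "W > 0" "F > 0" using h0 by (auto simp: U_V_W_F_Y_Z_def N_def)
  have "sqrt (N / 2 * (N / (2 * h))) * (2 * (N / 2) / (D * (fact n * ((1 + h) * e ^ 3) ^ n)))
      * (sqrt (1 - h) ^ (2 * n + 1) / (2 * pi * e) * exp ((2 * h - 1) / e ^ 3)) / D\<^sup>2
    = N / (2 * (c * q)) * (2 * (N / 2) / (S / (2 * c * q ^ 4) * (F * (V / W)))) * (U * b / (2 * pi * q\<^sup>2) * (Y * Z)) / (S / (2 * c * q ^ 4))\<^sup>2"
  proof -
    have "e\<^sup>2 = q ^ 4" unfolding q(2) power_mult[symmetric] by simp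
    then show ?thesis unfolding sab b_def[symmetric] bp X mp D S_def[symmetric] U_V_W_F_Y_Z_def using q(2) by simp
  qed
  also have "\<dots> = 2 * c\<^sup>2 / pi * (1 / (b * S)) * (U * b\<^sup>2 / (V * S\<^sup>2) * Y) * (N * W * Z * (1 / q ^ 3) / (N * F))"
  proof -
    have Nc: "N * N * q ^ 9 = 1 / q ^ 3"
      unfolding Nq using q(1) by (simp add: divide_simps power_add[symmetric])
    have "N / (2 * (c * q)) * (2 * (N / 2) / (S / (2 * c * q ^ 4) * (F * (V / W)))) * (U * b / (2 * pi * q\<^sup>2) * (Y * Z)) / (S / (2 * c * q ^ 4))\<^sup>2
      = (N * N * q ^ 9) * (2 * c\<^sup>2 / pi * (U * b * W * Y * Z / (S * S\<^sup>2 * V * F)))"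
    proof -
      have "q ^ 9 = q ^ 4 * q ^ 4 * q" by (simp add: power_add[symmetric] power_Suc2[symmetric] del: power_Suc)
      moreover have "q ^ 4 = q\<^sup>2 * q\<^sup>2" by (simp add: power_add[symmetric])
      ultimately show ?thesis using pos S(1) b(1) q(1) c by (simp add: divide_simps power2_eq_square)
    qed
    also have "\<dots> = 2 * c\<^sup>2 / pi * (1 / (b * S)) * (U * b\<^sup>2 / (V * S\<^sup>2) * Y) * (N * W * Z * (1 / q ^ 3) / (N * F))"
      unfolding Nc using pos S(1) b(1) q(1) c by (simp add: N_def power2_eq_square mult_ac)
    finally show ?thesis .
  qed
  also have "\<dots> = 2 * c\<^sup>2 / pi * (1 / sqrt (1 - h\<^sup>2)) * exp (N * (ln (1 - h) - ln (1 + h) + 2 * h)) *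
      (N ^ Suc n * exp (- N) * sqrt N / fact (Suc n))"
    unfolding sh E f sN b(2) S(2) U_V_W_F_Y_Z_def by (simp add: mult_ac)
  finally show ?thesis .
qed

lemma cube_powr_minus_third:
  "real (Suc n) * (real (Suc n) powr (-1/3)) ^ 3 = 1"
proof -
  have "(real (Suc n) powr (-1/3)) ^ 3 = (real (Suc n) powr (-1/3)) powr real 3"
    by (rule powr_realpow[symmetric]) simp
  also have "\<dots> = real (Suc n) powr (-1/3 * 3)" unfolding powr_powr by simp
  also have "\<dots> = 1 / real (Suc n)" by (simp add: powr_minus_divide)
  finally show ?thesis by simp
qed

text \<open>For the potential at hand \<open>a = N / 2\<close> and \<open>b = N / (2 h)\<close>, hence the means of \<open>z\<^sup>2\<close> and \<open>\<bar>z\<bar>\<^sup>2\<close> are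
  \<open>s = (1 - h) / N\<close> and \<open>m = (1 + h) / N\<close>; the unit \<open>D\<close> of length is that of the rescaling.\<close>

lemma rescaled_one_point_formula:
  fixes c :: real and n :: nat and z :: complex
  defines "N \<equiv> real (Suc n)" and "e \<equiv> real (Suc n) powr (-1/3)" and "h \<equiv> c\<^sup>2 * real (Suc n) powr (-1/3)"
  assumes c: "c > 0" and h: "h < 1"
  shows "rescaled_one_point (Suc n) (potential c (Suc n)) (of_real (right_endpoint c (Suc n))) z =
    2 * c\<^sup>2 / pi * (1 / sqrt (1 - h\<^sup>2)) * exp (N * (ln (1 - h) - ln (1 + h) + 2 * h)) *
      (N ^ Suc n * exp (- N) * sqrt N / fact (Suc n)) * exp (- 2 * (Im z)\<^sup>2 / (1 + h)) *
      (LBINT u:{0..}. edge_integrand c e n (scaled_edge c e (z + of_real u)))"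
proof -
  let ?F = "\<lambda>u. edge_integrand c e n (scaled_edge c e (z + of_real u))"
  have N: "N > 0" by (simp add: N_def)
  have e: "e > 0" by (simp add: e_def)
  have h_eq: "h = c\<^sup>2 * e" by (simp add: h_def e_def)
  have Ne: "N * e ^ 3 = 1" unfolding N_def e_def by (rule cube_powr_minus_third)
  have h0: "h > 0" using c e by (simp add: h_eq)
  have N13: "real (Suc n) powr (1/3) = 1 / e" by (simp add: e_def powr_minus_divide)
  define Q where "Q = potential c (Suc n)"
  define p where "p = right_endpoint c (Suc n)"
  define S where "S = sqrt (1 + h)"
  define b where "b = sqrt (1 - h)"
  define D where "D = sqrt (real (Suc n) * quarter_laplacian Q (of_real p))"
  have S: "S > 0" "S\<^sup>2 = 1 + h" using h0 by (auto simp: S_def)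
  have b: "b > 0" "b\<^sup>2 = 1 - h" using h by (auto simp: b_def)
  have L: "real (Suc n) * quarter_laplacian Q (of_real p) = (1 + h) / (4 * c\<^sup>2 * e ^ 4)"
  proof -
    have "real (Suc n) * quarter_laplacian Q (of_real p) = N * (1/4 * (1 + 1 / (c\<^sup>2 * e)))"
      unfolding Q_def quarter_laplacian_potential N13 N_def by (simp add: mult.commute)
    also have "N = 1 / e ^ 3" using Ne e by (simp add: eq_divide_eq)
    also have "1 / e ^ 3 * (1/4 * (1 + 1 / (c\<^sup>2 * e))) = (1 + h) / (4 * c\<^sup>2 * e ^ 4)"
      unfolding h_eq using c e by (simp add: field_simps eval_nat_numeral)
    finally show ?thesis .
  qed
  have D: "D = S / (2 * c * e\<^sup>2)"
  proof -
    have "(1 + h) / (4 * c\<^sup>2 * e ^ 4) = (S / (2 * c * e\<^sup>2))\<^sup>2"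
      unfolding S(2)[symmetric] by (simp add: power_divide power_mult_distrib power_mult[symmetric])
    then show ?thesis unfolding D_def L using S c e by simp
  qed
  have D0: "D > 0" unfolding D using S c e by simp
  have D2: "real (Suc n) * quarter_laplacian Q (of_real p) = D\<^sup>2"
    unfolding D_def L using h0 c e by simp
  have p: "p = 2 / S"
    unfolding p_def right_endpoint_def S_def h_def
    by (simp add: powr_minus_divide powr_half_sqrt)
  define A where "A = N / 2"
  define B where "B = N / (2 * h)"
  have AB: "A > 0" "B > 0" using N h0 by (simp_all add: A_def B_def)
  have s: "1 / (2 * A) - 1 / (2 * B) = b\<^sup>2 * e ^ 3" "1 / (2 * A) + 1 / (2 * B) = (1 + h) * e ^ 3"
  proof -
    have "e ^ 3 = 1 / N" using Ne N by (simp add: eq_divide_eq mult.commute)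
    then show "1 / (2 * A) - 1 / (2 * B) = b\<^sup>2 * e ^ 3" "1 / (2 * A) + 1 / (2 * B) = (1 + h) * e ^ 3"
      unfolding A_def B_def b(2) using N h0 by (simp_all add: field_simps)
  qed
  have Q: "real (Suc n) * Q w = A * (Re w)\<^sup>2 + B * (Im w)\<^sup>2" for w
    unfolding Q_def potential_def N13 A_def B_def N_def h_eq using c e by (simp add: field_simps)
  define \<zeta> where "\<zeta> = of_real p + z / of_real D"
  have Imz: "Im \<zeta> = Im z / D" by (simp add: \<zeta>_def)
  define H where "H = b ^ (2 * n + 1) / (2 * pi * e) * exp ((2 * h - 1) / e ^ 3)"
  have w: "\<zeta> + of_real (u / D) = of_real b * (2 + scaled_edge c e (z + of_real u) * (of_real e)\<^sup>2)" for u
  proof -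
    have sh: "sqrt (1 - (c\<^sup>2 * e)\<^sup>2) = b * S"
    proof -
      have "1 - (c\<^sup>2 * e)\<^sup>2 = (1 - h) * (1 + h)" unfolding h_eq by (simp add: power2_eq_square algebra_simps)
      then show ?thesis by (simp add: b_def S_def real_sqrt_mult)
    qed
    have ne: "complex_of_real b \<noteq> 0" "complex_of_real S \<noteq> 0" "complex_of_real e \<noteq> 0" "complex_of_real c \<noteq> 0"
      using b S e c by auto
    show ?thesis
      unfolding \<zeta>_def p D scaled_edge_def edge_scale_def sh using ne by (simp add: field_simps power2_eq_square)
  qed
  have I: "exp (- A * (Re \<zeta> + u / D)\<^sup>2) * Re (poly (hpoly (b\<^sup>2 * e ^ 3) (Suc n)) (\<zeta> + of_real (u / D)) * cnj (poly (hpoly (b\<^sup>2 * e ^ 3) n) (\<zeta> + of_real (u / D))))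
     = H * ?F u" for u
  proof -
    have "- A * (Re \<zeta> + u / D)\<^sup>2 = - (Re (\<zeta> + of_real (u / D)))\<^sup>2 / (2 * e ^ 3)"
    proof -
      have "A = 1 / (2 * e ^ 3)" unfolding A_def using Ne e by (simp add: field_simps)
      then show ?thesis by simp
    qed
    then show ?thesis
      using gauss_hpoly_product_eq[OF e b(1) b(2)[unfolded h_eq] w[of u], of n]
      unfolding H_def h_eq mult.assoc by simp
  qed
  have "rescaled_one_point (Suc n) Q (of_real p) z = one_point (Suc n) Q \<zeta> / D\<^sup>2"
    unfolding rescaled_one_point_def D2 \<zeta>_def D_def[symmetric] using D0 by simp
  also have "one_point (Suc n) Q \<zeta> = sqrt (A * B) * exp (- B * (Im \<zeta>)\<^sup>2) * (2 * A / (D * (fact n * ((1 + h) * e ^ 3) ^ n))) *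
     (LBINT u:{0..}. H * ?F u)"
    using one_point_gauss_integral[OF AB D0 Q, of \<zeta>] unfolding s I .
  also have "(LBINT u:{0..}. H * ?F u)
     = H * (LBINT u:{0..}. ?F u)"
    by (rule set_integral_mult_right)
  also have "- B * (Im \<zeta>)\<^sup>2 = - 2 * (Im z)\<^sup>2 / (1 + h)"
  proof -
    have "B / D\<^sup>2 = 2 / (1 + h)"
    proof -
      have "N = 1 / e ^ 3" using Ne e by (simp add: eq_divide_eq)
      then have "B / D\<^sup>2 = 1 / e ^ 3 / (2 * (c\<^sup>2 * e)) / ((1 + h) / (4 * c\<^sup>2 * e ^ 4))"
        unfolding B_def D2[symmetric] L by (simp add: h_eq)
      also have "\<dots> = 2 / (1 + h)" using c e h0 by (simp add: field_simps eval_nat_numeral)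
      finally show ?thesis .
    qed
    then have "- (B / D\<^sup>2) * (Im z)\<^sup>2 = - 2 * (Im z)\<^sup>2 / (1 + h)" by simp
    then show ?thesis unfolding Imz by (simp add: power_divide)
  qed
  finally have "rescaled_one_point (Suc n) Q (of_real p) z
     = (sqrt (A * B) * (2 * A / (D * (fact n * ((1 + h) * e ^ 3) ^ n))) * H / D\<^sup>2) * exp (- 2 * (Im z)\<^sup>2 / (1 + h)) *
       (LBINT u:{0..}. ?F u)"
    by (simp add: mult_ac)
  also have "sqrt (A * B) * (2 * A / (D * (fact n * ((1 + h) * e ^ 3) ^ n))) * H / D\<^sup>2
     = 2 * c\<^sup>2 / pi * (1 / sqrt (1 - h\<^sup>2)) * exp (N * (ln (1 - h) - ln (1 + h) + 2 * h)) *
      (N ^ Suc n * exp (- N) * sqrt N / fact (Suc n))"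
    unfolding A_def B_def H_def b_def N_def h_eq
    by (rule one_point_prefactor[OF c e]) (use Ne h D in \<open>simp_all add: N_def h_eq S_def\<close>)
  finally show ?thesis by (simp only: Q_def p_def)
qed

section \<open>Passage to the limit under the integral\<close>

text \<open>Here \<open>d = e \<delta>\<close> and \<open>g = e\<^sup>2 Re \<kappa>\<close>. The left side is \<open>e\<^sup>3\<close> times the exponent of the bound for the
  product of the two polynomials, together with the quadratic term that the weight leaves, when
  the line of integration has abscissa \<open>\<delta> + e Re \<kappa> / 2\<close>, so that \<open>1 + d + g / 2\<close> is the real part
  of the base of the power there. Shifting by \<open>g / 2\<close> lowers the quadratic part from \<open>(1 + h) g\<^sup>2 / 2\<close>
  to \<open>(2 h - 1) g\<^sup>2 / 4 \<le> 0\<close>, while \<open>ln (1 + d + g / 2) \<le> ln (1 + d) + g / (2 (1 + d))\<close> costs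
  no quadratic term.\<close>

lemma shifted_line_exponent_bound:
  fixes d g l h :: real
  assumes d: "d > 0" and g: "- l \<le> g" and l: "0 \<le> l" "l \<le> d" and h: "h \<le> 1/2"
  shows "2 * (ln (1 + (d + g / 2)) - (d + g / 2) + (d + g / 2)\<^sup>2 / 2) - 2 * g * (d + g / 2) + (1 + h) * g\<^sup>2 / 2
     \<le> 2/3 * d ^ 3 - d * g + d * l"
proof -
  define t where "t = d / (1 + d)"
  have t: "0 \<le> t" "t \<le> d" using d by (auto simp: t_def divide_le_eq algebra_simps)
  have pos: "1 + (d + g / 2) > 0" using d g l by linarith
  have "1 + (d + g / 2) = (1 + d) * (1 + g / 2 / (1 + d))" using d by (simp add: field_simps)
  moreover from this have pos2: "1 + g / 2 / (1 + d) > 0" using pos d by (simp add: zero_less_mult_iff)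
  ultimately have "ln (1 + (d + g / 2)) = ln (1 + d) + ln (1 + g / 2 / (1 + d))" using d by (simp add: ln_mult)
  also have "\<dots> \<le> ln (1 + d) + g / 2 / (1 + d)" using ln_le_minus_one[OF pos2] by simp
  also have "g / 2 / (1 + d) = (g - g * t) / 2" using d by (simp add: t_def field_simps)
  finally have "2 * ln (1 + (d + g / 2)) \<le> 2 * (ln (1 + d) + (g - g * t) / 2)" by (rule mult_left_mono) simp
  then have 1: "2 * ln (1 + (d + g / 2)) \<le> 2 * ln (1 + d) + (g - g * t)" 
    unfolding distrib_left times_divide_eq_right by (simp only: nonzero_mult_div_cancel_left[OF zero_neq_numeral[symmetric]])
  have 3: "2 * ln (1 + d) - 2 * d + d\<^sup>2 \<le> 2/3 * d ^ 3" using ln_cubic_bound[OF less_imp_le[OF d]] by linarith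
  have 4: "- (g * t) \<le> d * l"
  proof -
    have "- g * t \<le> l * t" using g t by (intro mult_right_mono) auto
    also have "\<dots> \<le> l * d" using l t by (intro mult_left_mono) auto
    finally show ?thesis by (simp add: mult.commute)
  qed
  have "h * g\<^sup>2 \<le> 1/2 * g\<^sup>2" using h by (intro mult_right_mono) auto
  then have 5: "h * g\<^sup>2 / 2 \<le> g\<^sup>2 / 4" by linarith
  have "2 * (ln (1 + (d + g / 2)) - (d + g / 2) + (d + g / 2)\<^sup>2 / 2) - 2 * g * (d + g / 2) + (1 + h) * g\<^sup>2 / 2
     = 2 * ln (1 + (d + g / 2)) - 2 * d - g + d\<^sup>2 - d * g - g\<^sup>2 / 4 + h * g\<^sup>2 / 2"
    by (simp add: power2_eq_square field_simps)
  also have "\<dots> \<le> 2/3 * d ^ 3 - d * g + d * l"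
    using 1 3 4 5 by linarith
  finally show ?thesis .
qed

text \<open>The choice \<open>\<delta> = 2 c\<^sup>2 + 1\<close> turns the growth \<open>exp (2 c\<^sup>2 Re \<kappa>)\<close> of the edge factor into the decay
  \<open>exp (- Re \<kappa>)\<close>.\<close>

lemma edge_integrand_bound:
  fixes c e L M \<delta> :: real and n :: nat and \<kappa> :: complex
  defines "\<delta> \<equiv> 2 * c\<^sup>2 + 1"
  assumes e: "e > 0" and N: "real (Suc n) * e ^ 3 = 1" and h: "c\<^sup>2 * e \<le> 1/2"
    and ed: "e * \<delta> \<le> 1" and L: "L \<ge> 0" "e * L \<le> \<delta>" and re: "- L \<le> Re \<kappa>" and im: "\<bar>Im \<kappa>\<bar> \<le> M"
  shows "\<bar>edge_integrand c e n \<kappa>\<bar> \<le> exp (2/3 * \<delta> ^ 3 + \<delta> * L - Re \<kappa>) * (LBINT q. exp (M * \<bar>q\<bar> - 3/16 * \<delta> * q\<^sup>2))\<^sup>2"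
proof -
  define I where "I = (LBINT q. exp (M * \<bar>q\<bar> - 3/16 * \<delta> * q\<^sup>2))"
  \<comment> \<open>The abscissa of the line of integration for both polynomials.\<close>
  define d where "d = \<delta> + e * Re \<kappa> / 2"
  define B where "B = (ln (1 + e * d) - e * d + (e * d)\<^sup>2 / 2) / e ^ 3 - d * Re \<kappa>"
  define G where "G = 2 * c\<^sup>2 * Re \<kappa> + (1 + c\<^sup>2 * e) * e * (Re \<kappa>)\<^sup>2 / 2"
  have \<delta>: "\<delta> > 0" by (simp add: \<delta>_def add_nonneg_pos)
  have "- (e * L) \<le> e * Re \<kappa>" using re e mult_left_mono[of "- L" "Re \<kappa>" e] by simp
  then have d2: "\<delta> / 2 \<le> d" using L unfolding d_def by linarith
  then have d0: "d > 0" using \<delta> by linarith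
  have rate: "3/16 * \<delta> \<le> (1 - 1 / (1 + e * d)\<^sup>2) / (2 * e)"
  proof -
    have "e * \<delta> / 2 \<le> e * d" using d2 e mult_left_mono[of "\<delta> / 2" d e] by simp
    then have "3/8 * (e * \<delta> / 2) / e \<le> (1 - 1 / (1 + e * d)\<^sup>2) / (2 * e)"
      using e \<delta> ed by (intro airyN_rate_lower) auto
    then show ?thesis using e by simp
  qed
  have A: "cmod (airyN e k 1 \<kappa>) \<le> exp B * I" if "k \<le> Suc n" for k
    unfolding airyN_indep[OF e, of k 1 \<kappa> d] B_def I_def
    by (rule airyN_bound[OF e N d0 that _ rate im]) (use \<delta> in simp)
  have "\<bar>Re (airyN e (Suc n) 1 \<kappa> * cnj (airyN e n 1 \<kappa>))\<bar> \<le> cmod (airyN e (Suc n) 1 \<kappa>) * cmod (airyN e n 1 \<kappa>)"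
    by (metis abs_Re_le_cmod norm_mult complex_mod_cnj)
  also have "\<dots> \<le> (exp B * I) * (exp B * I)"
    by (intro mult_mono A) (auto intro: order.trans[OF norm_ge_zero A])
  finally have R: "\<bar>Re (airyN e (Suc n) 1 \<kappa> * cnj (airyN e n 1 \<kappa>))\<bar> \<le> exp (2 * B) * I\<^sup>2"
    unfolding mult_2 exp_add power2_eq_square by (simp only: mult_ac)
  have G: "exp (2 * c\<^sup>2 * Re \<kappa> + (1 + c\<^sup>2 * e) * e * (Re \<kappa>)\<^sup>2 / 2 - e * (Im \<kappa>)\<^sup>2) \<le> exp G"
    unfolding G_def using e by simp
  have "\<bar>edge_integrand c e n \<kappa>\<bar> \<le> exp G * (exp (2 * B) * I\<^sup>2)"
    unfolding edge_integrand_def abs_mult abs_exp_cancel by (rule mult_mono[OF G R]) auto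
  also have "\<dots> = exp (G + 2 * B) * I\<^sup>2" by (simp add: exp_add)
  also have "\<dots> \<le> exp (2/3 * \<delta> ^ 3 + \<delta> * L - Re \<kappa>) * I\<^sup>2"
  proof -
    define g where "g = e\<^sup>2 * Re \<kappa>"
    have e3: "e ^ 3 > 0" using e by simp
    have X: "e * d = e * \<delta> + g / 2" by (simp add: d_def g_def power2_eq_square algebra_simps)
    have *: "2 * (ln (1 + (e * \<delta> + g / 2)) - (e * \<delta> + g / 2) + (e * \<delta> + g / 2)\<^sup>2 / 2) - 2 * g * (e * \<delta> + g / 2) + (1 + c\<^sup>2 * e) * g\<^sup>2 / 2
      \<le> 2/3 * (e * \<delta>) ^ 3 - (e * \<delta>) * g + (e * \<delta>) * (e\<^sup>2 * L)"
    proof (rule shifted_line_exponent_bound)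
      show "e * \<delta> > 0" using e \<delta> by simp
      show "- (e\<^sup>2 * L) \<le> g" using re mult_left_mono[of "- L" "Re \<kappa>" "e\<^sup>2"] by (simp add: g_def)
      show "0 \<le> e\<^sup>2 * L" using L by simp
      show "e\<^sup>2 * L \<le> e * \<delta>" using L e mult_left_mono[of "e * L" \<delta> e] by (simp add: power2_eq_square mult.assoc)
      show "c\<^sup>2 * e \<le> 1/2" by (rule h)
    qed
    have "2 * B + (1 + c\<^sup>2 * e) * e * (Re \<kappa>)\<^sup>2 / 2
      = (2 * (ln (1 + e * d) - e * d + (e * d)\<^sup>2 / 2) - 2 * g * (e * d) + (1 + c\<^sup>2 * e) * g\<^sup>2 / 2) / e ^ 3"
    proof -
      have "2 * g * (e * d) / e ^ 3 = 2 * (d * Re \<kappa>)" using e by (simp add: g_def power2_eq_square power3_eq_cube)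
      moreover have "(1 + c\<^sup>2 * e) * g\<^sup>2 / 2 / e ^ 3 = (1 + c\<^sup>2 * e) * e * (Re \<kappa>)\<^sup>2 / 2"
        using e by (simp add: g_def power2_eq_square power3_eq_cube)
      moreover have "2 * B = 2 * (ln (1 + e * d) - e * d + (e * d)\<^sup>2 / 2) / e ^ 3 - 2 * (d * Re \<kappa>)"
        unfolding B_def by (simp only: right_diff_distrib[of 2 "_ / e ^ 3"] times_divide_eq_right)
      ultimately show ?thesis by (simp only: add_divide_distrib[of _ _ "e ^ 3"] diff_divide_distrib[of _ _ "e ^ 3"])
    qed
    also have "\<dots> \<le> (2/3 * (e * \<delta>) ^ 3 - (e * \<delta>) * g + (e * \<delta>) * (e\<^sup>2 * L)) / e ^ 3"
      unfolding X by (rule divide_right_mono[OF * less_imp_le[OF e3]])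
    also have "\<dots> = 2/3 * \<delta> ^ 3 - \<delta> * Re \<kappa> + \<delta> * L"
      using e by (simp add: g_def field_simps power2_eq_square power3_eq_cube)
    finally have "G + 2 * B \<le> 2 * c\<^sup>2 * Re \<kappa> + (2/3 * \<delta> ^ 3 - \<delta> * Re \<kappa> + \<delta> * L)" unfolding G_def by linarith
    also have "\<dots> = 2/3 * \<delta> ^ 3 + \<delta> * L - Re \<kappa>"
    proof -
      have "\<delta> * Re \<kappa> = 2 * c\<^sup>2 * Re \<kappa> + Re \<kappa>" by (simp add: \<delta>_def distrib_right)
      then show ?thesis by linarith
    qed
    finally show ?thesis by (intro mult_right_mono) auto
  qed
  finally show ?thesis unfolding I_def .
qed

text \<open>Up to an explicit factor without zeros it is a polynomial.\<close>

lemma continuous_airyN: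
  assumes e: "e > 0"
  shows "continuous_on UNIV (airyN e k 1)"
proof -
  have C: "complex_of_real (e / sqrt (2 * pi * e ^ 3)) \<noteq> 0" using e by simp
  have "airyN e k 1 = (\<lambda>\<kappa>. poly (hpoly (1\<^sup>2 * e ^ 3) k) (2 + \<kappa> * (of_real e)\<^sup>2) /
      (of_real (e / sqrt (2 * pi * e ^ 3)) * exp ((1 + \<kappa> * (of_real e)\<^sup>2)\<^sup>2 / (2 * (of_real e) ^ 3))))"
  proof
    fix \<kappa>
    have P: "poly (hpoly (1\<^sup>2 * e ^ 3) k) (2 + \<kappa> * (of_real e)\<^sup>2) = of_real (e / sqrt (2 * pi * e ^ 3)) * exp ((1 + \<kappa> * (of_real e)\<^sup>2)\<^sup>2 / (2 * (of_real e) ^ 3)) * airyN e k 1 \<kappa>"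
      using hpoly_eq_airyN[OF e zero_less_one_real, of k \<kappa> 1] by (simp only: of_real_1 mult_1 power_one)
    have "of_real (e / sqrt (2 * pi * e ^ 3)) * exp ((1 + \<kappa> * (of_real e)\<^sup>2)\<^sup>2 / (2 * (of_real e) ^ 3)) \<noteq> (0::complex)"
      using C by (simp only: mult_eq_0_iff exp_not_eq_zero simp_thms)
    from nonzero_mult_div_cancel_left[OF this, of "airyN e k 1 \<kappa>"] show "airyN e k 1 \<kappa> = poly (hpoly (1\<^sup>2 * e ^ 3) k) (2 + \<kappa> * (of_real e)\<^sup>2) /
      (of_real (e / sqrt (2 * pi * e ^ 3)) * exp ((1 + \<kappa> * (of_real e)\<^sup>2)\<^sup>2 / (2 * (of_real e) ^ 3)))"
      unfolding P by (rule sym)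
  qed
  moreover have "continuous_on UNIV (\<lambda>\<kappa>. poly (hpoly (1\<^sup>2 * e ^ 3) k) (2 + \<kappa> * (of_real e)\<^sup>2) /
      (of_real (e / sqrt (2 * pi * e ^ 3)) * exp ((1 + \<kappa> * (of_real e)\<^sup>2)\<^sup>2 / (2 * (of_real e) ^ 3))))"
    using C e by (intro continuous_intros) (simp_all only: mult_eq_0_iff exp_not_eq_zero simp_thms ball_UNIV of_real_eq_0_iff power_eq_0_iff, simp)
  ultimately show ?thesis by (simp only:)
qed

lemma continuous_edge_integrand:
  assumes e: "e > 0"
  shows "continuous_on UNIV (\<lambda>u. edge_integrand c e n (scaled_edge c e (z + of_real u)))"
proof -
  have k: "continuous_on UNIV (\<lambda>u. scaled_edge c e (z + of_real u))"
    unfolding scaled_edge_def by (intro continuous_intros)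
  show ?thesis
    unfolding edge_integrand_def
    by (intro continuous_intros k continuous_on_compose2[OF continuous_airyN[OF e] k]) auto
qed

lemma edge_scale_bounds:
  assumes "c\<^sup>2 * e \<le> 1/2" "e \<ge> 0"
  shows "1 \<le> edge_scale c e" "edge_scale c e \<le> 2"
proof -
  have h: "0 \<le> c\<^sup>2 * e" using assms by simp
  have "(c\<^sup>2 * e)\<^sup>2 \<le> (1/2)\<^sup>2" using assms h by (intro power_mono) auto
  then have q: "1 / 4 \<le> 1 - (c\<^sup>2 * e)\<^sup>2" by (simp add: power2_eq_square)
  define r where "r = sqrt (1 - (c\<^sup>2 * e)\<^sup>2)"
  have "sqrt (1/4) \<le> r" unfolding r_def using q by (rule real_sqrt_le_mono)
  then have s: "1/2 \<le> r" by (simp add: real_sqrt_divide)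
  have "r \<le> 1" unfolding r_def by simp
  with s show "1 \<le> edge_scale c e" "edge_scale c e \<le> 2"
    unfolding edge_scale_def r_def[symmetric] by (simp_all add: field_simps)
qed

lemma edge_scale_tendsto:
  assumes e: "e \<longlonglongrightarrow> 0" "\<And>n. e n > 0"
  shows "(\<lambda>n. edge_scale c (e n)) \<longlonglongrightarrow> 1" "(\<lambda>n. 2 * (edge_scale c (e n) - 1) / (e n)\<^sup>2) \<longlonglongrightarrow> c ^ 4"
proof -
  have f: "filterlim e (at_right 0) sequentially"
    by (intro tendsto_imp_filterlim_at_right[OF e(1)] always_eventually allI e(2))
  have "((\<lambda>x. edge_scale c x) \<longlongrightarrow> 1) (at_right 0)"
  proof -
    have "((\<lambda>x. 1 / sqrt (1 - (c\<^sup>2 * x)\<^sup>2)) \<longlongrightarrow> 1 / sqrt (1 - (c\<^sup>2 * 0)\<^sup>2)) (at_right 0)"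
      by (intro tendsto_intros) simp
    then show ?thesis by (simp add: edge_scale_def)
  qed
  from filterlim_compose[OF this f] show "(\<lambda>n. edge_scale c (e n)) \<longlonglongrightarrow> 1" .
  have "((\<lambda>x. 2 * (edge_scale c x - 1) / x\<^sup>2) \<longlongrightarrow> c ^ 4) (at_right 0)"
  proof (cases "c = 0")
    case True then show ?thesis by (simp add: edge_scale_def)
  next
    case False
    then have "c\<^sup>2 > 0" by simp
    then have "((\<lambda>x. 2 * (1 / sqrt (1 - (k * x)\<^sup>2) - 1) / x\<^sup>2) \<longlongrightarrow> k\<^sup>2) (at_right 0)" if "k > 0" for k :: real
      using that by real_asymp
    from this[OF \<open>c\<^sup>2 > 0\<close>] show ?thesis by (simp add: edge_scale_def power_mult[symmetric])
  qed
  from filterlim_compose[OF this f] show "(\<lambda>n. 2 * (edge_scale c (e n) - 1) / (e n)\<^sup>2) \<longlonglongrightarrow> c ^ 4" .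
qed

lemma edge_integral_tendsto:
  fixes c :: real and e :: "nat \<Rightarrow> real" and N :: "nat \<Rightarrow> nat" and z :: "nat \<Rightarrow> complex"
  assumes c: "c > 0" and e: "\<And>n. e n > 0" "e \<longlonglongrightarrow> 0" and N: "\<And>n. real (Suc (N n)) * e n ^ 3 = 1"
    and K: "\<And>n. cmod (z n) \<le> K" and z: "z \<longlonglongrightarrow> z0"
    and small: "\<And>n. c\<^sup>2 * e n \<le> 1/2" "\<And>n. e n \<le> 1" "\<And>n. e n * (2 * c\<^sup>2 + 1) \<le> 1" "\<And>n. e n * (4 * c * K) \<le> 2 * c\<^sup>2 + 1"
  shows "(\<lambda>n. LBINT u:{0..}. edge_integrand c (e n) (N n) (scaled_edge c (e n) (z n + of_real u))) \<longlonglongrightarrow>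
    (LBINT u:{0..}. 4 * pi\<^sup>2 * exp (2 * c ^ 6) * (exp (4 * c ^ 3 * (u + Re z0)) * (cmod (Ai (2 * of_real c * (z0 + of_real u) + of_real (c ^ 4))))\<^sup>2))"
proof -
  define \<kappa> where "\<kappa> = (\<lambda>n u. scaled_edge c (e n) (z n + of_real u))"
  define \<kappa>0 where "\<kappa>0 = (\<lambda>u. 2 * of_real c * (z0 + of_real u) + of_real (c ^ 4))"
  define \<delta> where "\<delta> = 2 * c\<^sup>2 + 1"
  define L where "L = 4 * c * K"
  define I where "I = (LBINT q. exp (L * \<bar>q\<bar> - 3/16 * \<delta> * q\<^sup>2))"
  define g where "g = (\<lambda>u. 4 * pi\<^sup>2 * exp (2 * c ^ 6) * (exp (4 * c ^ 3 * (u + Re z0)) * (cmod (Ai (\<kappa>0 u)))\<^sup>2))"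
  have K0: "K \<ge> 0" by (rule order.trans[OF norm_ge_zero K[of 0]])
  have L0: "L \<ge> 0" using c K0 by (simp add: L_def)
  have \<kappa>_lim: "(\<lambda>n. \<kappa> n u) \<longlonglongrightarrow> \<kappa>0 u" for u
  proof -
    have "(\<lambda>n. of_real (2 * (edge_scale c (e n) - 1) / (e n)\<^sup>2) + of_real (2 * c * edge_scale c (e n)) * (z n + of_real u)) \<longlonglongrightarrow>
       of_real (c ^ 4) + of_real (2 * c * 1) * (z0 + of_real u)"
      by (intro tendsto_intros edge_scale_tendsto e z)
    then show ?thesis unfolding \<kappa>_def \<kappa>0_def scaled_edge_def by (simp add: add.commute)
  qed
  have Rek: "2 * c * u - L \<le> Re (\<kappa> n u)" and Imk: "\<bar>Im (\<kappa> n u)\<bar> \<le> L" if u: "u \<ge> 0" for n u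
  proof -
    let ?k = "edge_scale c (e n)"
    have k: "1 \<le> ?k" "?k \<le> 2"
      using edge_scale_bounds[OF small(1) less_imp_le[OF e(1)]] by blast+
    have R: "Re (\<kappa> n u) = 2 * (?k - 1) / (e n)\<^sup>2 + (2 * c * ?k * Re (z n) + 2 * c * ?k * u)"
      unfolding \<kappa>_def scaled_edge_def by (simp add: distrib_left)
    have I: "Im (\<kappa> n u) = 2 * c * ?k * Im (z n)" unfolding \<kappa>_def scaled_edge_def by simp
    have b: "\<bar>2 * c * ?k * x\<bar> \<le> L" if "\<bar>x\<bar> \<le> cmod (z n)" for x
    proof -
      have x: "\<bar>x\<bar> \<le> K" using that K[of n] by linarith
      have "\<bar>2 * c * ?k * x\<bar> = 2 * c * (?k * \<bar>x\<bar>)" using c k by (simp add: abs_mult)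
      also have "\<dots> \<le> 2 * c * (2 * K)"
        using c by (intro mult_left_mono mult_mono[OF k(2) x]) simp_all
      finally show ?thesis by (simp add: L_def)
    qed
    have 1: "0 \<le> 2 * (?k - 1) / (e n)\<^sup>2" using k by simp
    have "(2 * c * u) * 1 \<le> (2 * c * u) * ?k" using k c u by (intro mult_left_mono) simp_all
    then have 2: "2 * c * u \<le> 2 * c * ?k * u" by (simp only: mult_1_right mult_ac)
    have 3: "- L \<le> 2 * c * ?k * Re (z n)" using b[OF abs_Re_le_cmod] by (simp only: abs_le_iff) linarith
    show "2 * c * u - L \<le> Re (\<kappa> n u)" unfolding R using 1 2 3 by linarith
    show "\<bar>Im (\<kappa> n u)\<bar> \<le> L" unfolding I by (rule b[OF abs_Im_le_cmod])
  qed
  have bound: "\<bar>edge_integrand c (e n) (N n) (\<kappa> n u)\<bar> \<le> exp (2/3 * \<delta> ^ 3 + \<delta> * L + L) * I\<^sup>2 * exp (- (2 * c) * \<bar>u\<bar>)"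
    if u: "u \<ge> 0" for n u
  proof -
    have re: "- L \<le> Re (\<kappa> n u)" using Rek[OF u, of n] c u mult_nonneg_nonneg[of "2 * c" u] by linarith
    have "\<bar>edge_integrand c (e n) (N n) (\<kappa> n u)\<bar> \<le> exp (2/3 * \<delta> ^ 3 + \<delta> * L - Re (\<kappa> n u)) * I\<^sup>2"
      unfolding \<delta>_def I_def
      by (rule edge_integrand_bound[OF e(1) N small(1) small(3) L0 _ re Imk[OF u]]) (use small(4) in \<open>simp add: L_def\<close>)
    also have "\<dots> \<le> exp (2/3 * \<delta> ^ 3 + \<delta> * L + L - 2 * c * u) * I\<^sup>2"
      using Rek[OF u, of n] by (intro mult_right_mono) auto
    also have "\<dots> = exp (2/3 * \<delta> ^ 3 + \<delta> * L + L) * I\<^sup>2 * exp (- (2 * c) * \<bar>u\<bar>)"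
    proof -
      have "exp (2/3 * \<delta> ^ 3 + \<delta> * L + L - 2 * c * u) = exp (2/3 * \<delta> ^ 3 + \<delta> * L + L) * exp (- (2 * c) * \<bar>u\<bar>)"
        using u by (simp add: exp_add[symmetric])
      then show ?thesis by (simp only: mult_ac)
    qed
    finally show ?thesis .
  qed
  have lim: "(\<lambda>n. edge_integrand c (e n) (N n) (\<kappa> n u)) \<longlonglongrightarrow> g u" for u
  proof -
    have A1: "(\<lambda>n. airyN (e n) (Suc (N n)) 1 (\<kappa> n u)) \<longlonglongrightarrow> 2 * of_real pi * Ai (\<kappa>0 u)"
      by (rule airyN_tendsto[where N = "\<lambda>n. Suc (N n)" and j = 0, OF e(1) small(2) e(2) N _ \<kappa>_lim]) simp
    have A2: "(\<lambda>n. airyN (e n) (N n) 1 (\<kappa> n u)) \<longlonglongrightarrow> 2 * of_real pi * Ai (\<kappa>0 u)"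
      by (rule airyN_tendsto[where N = "\<lambda>n. Suc (N n)" and j = 1, OF e(1) small(2) e(2) N _ \<kappa>_lim]) simp
    have "(\<lambda>n. edge_integrand c (e n) (N n) (\<kappa> n u)) \<longlonglongrightarrow>
      exp (2 * c\<^sup>2 * Re (\<kappa>0 u) + (1 + c\<^sup>2 * 0) * 0 * (Re (\<kappa>0 u))\<^sup>2 / 2 - 0 * (Im (\<kappa>0 u))\<^sup>2) *
      Re ((2 * of_real pi * Ai (\<kappa>0 u)) * cnj (2 * of_real pi * Ai (\<kappa>0 u)))"
      unfolding edge_integrand_def by (intro tendsto_intros A1 A2 \<kappa>_lim e(2)) simp
    also have "Re ((2 * of_real pi * Ai (\<kappa>0 u)) * cnj (2 * of_real pi * Ai (\<kappa>0 u))) = 4 * pi\<^sup>2 * (cmod (Ai (\<kappa>0 u)))\<^sup>2"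
      unfolding complex_norm_square[symmetric] Re_complex_of_real by (simp add: norm_mult power_mult_distrib)
    also have "2 * c\<^sup>2 * Re (\<kappa>0 u) + (1 + c\<^sup>2 * 0) * 0 * (Re (\<kappa>0 u))\<^sup>2 / 2 - 0 * (Im (\<kappa>0 u))\<^sup>2 = 2 * c ^ 6 + 4 * c ^ 3 * (u + Re z0)"
      unfolding \<kappa>0_def by (simp add: algebra_simps eval_nat_numeral)
    finally show ?thesis by (simp add: g_def exp_add mult_ac)
  qed
  have meas: "(\<lambda>u. edge_integrand c (e n) (N n) (\<kappa> n u)) \<in> borel_measurable borel" for n
    unfolding \<kappa>_def by (rule borel_measurable_continuous_onI[OF continuous_edge_integrand[OF e(1)]])
  have measg: "g \<in> borel_measurable borel"
    by (rule borel_measurable_LIMSEQ_real[OF lim meas])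
  have "(\<lambda>n. LBINT u. indicator {0..} u *\<^sub>R edge_integrand c (e n) (N n) (\<kappa> n u)) \<longlonglongrightarrow> (LBINT u. indicator {0..} u *\<^sub>R g u)"
  proof (rule integral_dominated_convergence[where w = "\<lambda>u. exp (2/3 * \<delta> ^ 3 + \<delta> * L + L) * I\<^sup>2 * exp (- (2 * c) * \<bar>u\<bar>)"])
    show "integrable lborel (\<lambda>u. exp (2/3 * \<delta> ^ 3 + \<delta> * L + L) * I\<^sup>2 * exp (- (2 * c) * \<bar>u\<bar>))"
      using integrable_exp_minus_abs[of "2 * c"] c by simp
    show "AE u in lborel. norm (indicator {0..} u *\<^sub>R edge_integrand c (e n) (N n) (\<kappa> n u)) \<le> exp (2/3 * \<delta> ^ 3 + \<delta> * L + L) * I\<^sup>2 * exp (- (2 * c) * \<bar>u\<bar>)" for n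
      using bound[of _ n] by (intro always_eventually allI) (simp add: indicator_def)
    show "AE u in lborel. (\<lambda>n. indicator {0..} u *\<^sub>R edge_integrand c (e n) (N n) (\<kappa> n u)) \<longlonglongrightarrow> indicator {0..} u *\<^sub>R g u"
      by (intro always_eventually allI tendsto_scaleR tendsto_const lim)
    show "(\<lambda>u. indicator {0..} u *\<^sub>R g u) \<in> borel_measurable lborel"
      using measg by (simp add: borel_measurable_indicator)
    show "(\<lambda>u. indicator {0..} u *\<^sub>R edge_integrand c (e n) (N n) (\<kappa> n u)) \<in> borel_measurable lborel" for n
      using meas by (simp add: borel_measurable_indicator)
  qed
  then show ?thesis unfolding set_lebesgue_integral_def \<kappa>_def g_def \<kappa>0_def .
qed

section \<open>Locally uniform convergence\<close>

text \<open>If uniformity fails at points \<open>x\<^sub>k\<close> and indices \<open>n\<^sub>k\<close>, then pointwise convergence provides larger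
  indices \<open>m\<^sub>k\<close> at which \<open>f\<close> is close to \<open>g\<close> in \<open>x\<^sub>k\<close>. Along a convergent subsequence of the points both
  families have the same limit, a contradiction.\<close>

lemma uniform_limit_compact_if_continuous_convergence:
  fixes f :: "nat \<Rightarrow> 'a::metric_space \<Rightarrow> 'b::metric_space"
  assumes K: "compact K"
    and H: "\<And>N z z0. filterlim N at_top sequentially \<Longrightarrow> (\<And>n. z n \<in> K) \<Longrightarrow> z0 \<in> K \<Longrightarrow> z \<longlonglongrightarrow> z0
      \<Longrightarrow> (\<lambda>n. f (N n) (z n)) \<longlonglongrightarrow> g z0"
  shows "uniform_limit K f g sequentially"
proof (rule ccontr)
  assume "\<not> ?thesis"
  then obtain e where e: "e > 0" and "\<And>k. \<exists>n\<ge>k. \<exists>x\<in>K. \<not> dist (f n x) (g x) < e"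
    unfolding uniform_limit_sequentially_iff by blast
  then have "\<forall>k. \<exists>n x. n \<ge> k \<and> x \<in> K \<and> \<not> dist (f n x) (g x) < e" by blast
  then obtain n x where nx: "\<And>k. n k \<ge> k" "\<And>k. x k \<in> K" "\<And>k. \<not> dist (f (n k) (x k)) (g (x k)) < e"
    by metis
  have "\<exists>m\<ge>k. dist (f m (x k)) (g (x k)) < e / 2" for k
  proof -
    have "(\<lambda>m. f m (x k)) \<longlonglongrightarrow> g (x k)"
      using H[of "\<lambda>n. n" "\<lambda>_. x k" "x k"] nx(2) by (simp add: filterlim_ident)
    then have "eventually (\<lambda>m. dist (f m (x k)) (g (x k)) < e / 2) sequentially"
      using e by (intro tendstoD) auto
    then show ?thesis unfolding eventually_sequentially by (meson le_cases order_refl)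
  qed
  then obtain m where m: "\<And>k. m k \<ge> k" "\<And>k. dist (f (m k) (x k)) (g (x k)) < e / 2" by metis
  obtain l r where l: "l \<in> K" "strict_mono (r :: nat \<Rightarrow> nat)" "(x \<circ> r) \<longlonglongrightarrow> l"
    using K nx(2) unfolding compact_def by metis
  have top: "filterlim (\<lambda>k. q (r k)) at_top sequentially" if "\<And>k. k \<le> q k" for q :: "nat \<Rightarrow> nat"
  proof (rule filterlim_at_top_mono[OF filterlim_subseq[OF l(2)]])
    show "eventually (\<lambda>k. r k \<le> q (r k)) sequentially" using that by simp
  qed
  have "(\<lambda>k. f (n (r k)) (x (r k))) \<longlonglongrightarrow> g l" "(\<lambda>k. f (m (r k)) (x (r k))) \<longlonglongrightarrow> g l"
    using H[OF top[OF nx(1)] _ l(1), of "\<lambda>k. x (r k)"] H[OF top[OF m(1)] _ l(1), of "\<lambda>k. x (r k)"] nx(2) l(3)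
    by (simp_all add: o_def)
  then have "(\<lambda>k. dist (f (n (r k)) (x (r k))) (f (m (r k)) (x (r k)))) \<longlonglongrightarrow> dist (g l) (g l)"
    by (rule tendsto_dist)
  then have "eventually (\<lambda>k. dist (f (n (r k)) (x (r k))) (f (m (r k)) (x (r k))) < e / 2) sequentially"
    using e by (intro order_tendstoD) auto
  then obtain k where "dist (f (n (r k)) (x (r k))) (f (m (r k)) (x (r k))) < e / 2"
    using eventually_happens trivial_limit_sequentially by blast
  moreover note m(2)[of "r k"] nx(3)[of "r k"]
  ultimately show False
    using dist_triangle[of "f (n (r k)) (x (r k))" "g (x (r k))" "f (m (r k)) (x (r k))"] by simp
qed

definition edge_density :: "real \<Rightarrow> complex \<Rightarrow> real" where
  "edge_density c z = sqrt (2 * pi) * 4 * c\<^sup>2 * exp (4/3 * c ^ 6 - 2 * (Im z)\<^sup>2) *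
        (LBINT u:{0..}. exp (4 * c ^ 3 * (u + Re z)) *
          (cmod (Ai (2 * of_real c * (z + of_real u) + of_real (c ^ 4))))\<^sup>2)"

text \<open>The odd part of \<open>ln (1 - x)\<close> starts with \<open>- x - x\<^sup>3 / 3\<close>, and \<open>N (c\<^sup>2 e)\<^sup>3 = c\<^sup>6\<close>.\<close>

lemma cubic_log_ratio_tendsto:
  fixes c :: real and e N :: "nat \<Rightarrow> real"
  assumes c: "c > 0" and e: "\<And>n. e n > 0" "e \<longlonglongrightarrow> 0" and N: "\<And>n. N n * e n ^ 3 = 1"
  shows "(\<lambda>n. exp (N n * (ln (1 - c\<^sup>2 * e n) - ln (1 + c\<^sup>2 * e n) + 2 * (c\<^sup>2 * e n)))) \<longlonglongrightarrow> exp (- (2/3) * c ^ 6)"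
proof (rule tendsto_exp)
  have c2: "c\<^sup>2 > 0" using c by simp
  have f: "filterlim (\<lambda>n. c\<^sup>2 * e n) (at_right 0) sequentially"
  proof (rule tendsto_imp_filterlim_at_right)
    show "(\<lambda>n. c\<^sup>2 * e n) \<longlonglongrightarrow> 0" by (rule tendsto_mult_right_zero[OF e(2)])
    show "eventually (\<lambda>n. 0 < c\<^sup>2 * e n) sequentially" using c2 e(1) by (intro always_eventually allI mult_pos_pos)
  qed
  have "((\<lambda>x::real. (ln (1 - x) - ln (1 + x) + 2 * x) / x ^ 3) \<longlongrightarrow> - (2/3)) (at_right 0)"
    by real_asymp
  from filterlim_compose[OF this f]
  have "(\<lambda>n. (ln (1 - c\<^sup>2 * e n) - ln (1 + c\<^sup>2 * e n) + 2 * (c\<^sup>2 * e n)) / (c\<^sup>2 * e n) ^ 3 * c ^ 6) \<longlonglongrightarrow> - (2/3) * c ^ 6"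
    by (rule tendsto_mult_right)
  moreover have "(ln (1 - c\<^sup>2 * e n) - ln (1 + c\<^sup>2 * e n) + 2 * (c\<^sup>2 * e n)) / (c\<^sup>2 * e n) ^ 3 * c ^ 6
     = N n * (ln (1 - c\<^sup>2 * e n) - ln (1 + c\<^sup>2 * e n) + 2 * (c\<^sup>2 * e n))" for n
  proof -
    have "N n = 1 / e n ^ 3" using N[of n] e(1)[of n] by (simp add: eq_divide_eq)
    then have "N n = c ^ 6 / (c\<^sup>2 * e n) ^ 3" using c by (simp add: power_mult_distrib power_mult[symmetric])
    then show ?thesis by simp
  qed
  ultimately show "(\<lambda>n. N n * (ln (1 - c\<^sup>2 * e n) - ln (1 + c\<^sup>2 * e n) + 2 * (c\<^sup>2 * e n))) \<longlonglongrightarrow> - (2/3) * c ^ 6"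
    by simp
qed

text \<open>The smallness conditions hold for all large \<open>N\<close>; they make the bounds above available for every
  member of the sequence, as dominated convergence requires.\<close>

lemma rescaled_tendsto_edge_density:
  fixes c :: real and N :: "nat \<Rightarrow> nat" and z :: "nat \<Rightarrow> complex"
  assumes c: "c > 0" and N: "filterlim N at_top sequentially"
    and small: "\<And>n. c\<^sup>2 * real (Suc (N n)) powr (-1/3) \<le> 1/2"
      "\<And>n. real (Suc (N n)) powr (-1/3) * (2 * c\<^sup>2 + 1) \<le> 1"
      "\<And>n. real (Suc (N n)) powr (-1/3) * (4 * c * K) \<le> 2 * c\<^sup>2 + 1"
    and K: "\<And>n. cmod (z n) \<le> K" and z: "z \<longlonglongrightarrow> z0"
  shows "(\<lambda>n. rescaled_one_point (Suc (N n)) (potential c (Suc (N n))) (of_real (right_endpoint c (Suc (N n)))) (z n))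
     \<longlonglongrightarrow> edge_density c z0"
proof -
  let ?A = "\<lambda>u. exp (4 * c ^ 3 * (u + Re z0)) * (cmod (Ai (2 * of_real c * (z0 + of_real u) + of_real (c ^ 4))))\<^sup>2"
  let ?L = "2 * c\<^sup>2 / pi * (1 / sqrt (1 - 0\<^sup>2)) * exp (- (2/3) * c ^ 6)"
  define e where "e = (\<lambda>n. real (Suc (N n)) powr (-1/3))"
  have e: "e n > 0" for n by (simp add: e_def)
  have SN: "filterlim (\<lambda>n. Suc (N n)) at_top sequentially"
    by (rule filterlim_compose[OF filterlim_Suc N])
  have e0: "e \<longlonglongrightarrow> 0"
  proof -
    have "(\<lambda>n. real n powr (-1/3)) \<longlonglongrightarrow> 0" by real_asymp
    from filterlim_compose[OF this SN] show ?thesis unfolding e_def .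
  qed
  have Ne: "real (Suc (N n)) * e n ^ 3 = 1" for n
    unfolding e_def by (rule cube_powr_minus_third)
  have e1: "e n \<le> 1" for n
  proof -
    have "e n * 1 \<le> e n * (2 * c\<^sup>2 + 1)" using e[of n] by (intro mult_left_mono) auto
    then show ?thesis using small(2)[of n] unfolding e_def by linarith
  qed
  have h1: "c\<^sup>2 * e n < 1" for n using small(1)[of n] by (simp add: e_def)
  let ?h = "\<lambda>n. c\<^sup>2 * e n"
  have h0: "?h \<longlonglongrightarrow> 0" by (rule tendsto_mult_right_zero[OF e0])
  let ?I0 = "LBINT u:{0..}. ?A u"
  have I: "(\<lambda>n. LBINT u:{0..}. edge_integrand c (e n) (N n) (scaled_edge c (e n) (z n + of_real u))) \<longlonglongrightarrow>
    (LBINT u:{0..}. 4 * pi\<^sup>2 * exp (2 * c ^ 6) * (?A u))"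
    by (rule edge_integral_tendsto[OF c e e0 Ne K z])
       (use small e1 in \<open>simp_all only: e_def\<close>)
  have S: "(\<lambda>n. real (Suc (N n)) ^ Suc (N n) * exp (- real (Suc (N n))) * sqrt (real (Suc (N n))) / fact (Suc (N n))) \<longlonglongrightarrow> 1 / sqrt (2 * pi)"
    by (rule filterlim_compose[OF stirling_limit SN])
  have E: "(\<lambda>n. exp (real (Suc (N n)) * (ln (1 - ?h n) - ln (1 + ?h n) + 2 * ?h n))) \<longlonglongrightarrow> exp (- (2/3) * c ^ 6)"
    by (rule cubic_log_ratio_tendsto[OF c e e0 Ne])
  have "(\<lambda>n. 2 * c\<^sup>2 / pi * (1 / sqrt (1 - (?h n)\<^sup>2)) * exp (real (Suc (N n)) * (ln (1 - ?h n) - ln (1 + ?h n) + 2 * ?h n)) *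
      (real (Suc (N n)) ^ Suc (N n) * exp (- real (Suc (N n))) * sqrt (real (Suc (N n))) / fact (Suc (N n))) * exp (- 2 * (Im (z n))\<^sup>2 / (1 + ?h n)) *
      (LBINT u:{0..}. edge_integrand c (e n) (N n) (scaled_edge c (e n) (z n + of_real u))))
    \<longlonglongrightarrow> ?L * (1 / sqrt (2 * pi)) * exp (- 2 * (Im z0)\<^sup>2 / (1 + 0)) *
      (LBINT u:{0..}. 4 * pi\<^sup>2 * exp (2 * c ^ 6) * (?A u))"
    by (intro tendsto_mult[OF tendsto_mult[OF tendsto_mult[OF tendsto_mult]]] I S E tendsto_intros h0 z) simp_all
  also have "(LBINT u:{0..}. 4 * pi\<^sup>2 * exp (2 * c ^ 6) * (?A u))
     = 4 * pi\<^sup>2 * exp (2 * c ^ 6) * ?I0"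
    by (rule set_integral_mult_right)
  also have "?L * (1 / sqrt (2 * pi)) * exp (- 2 * (Im z0)\<^sup>2 / (1 + 0)) * (4 * pi\<^sup>2 * exp (2 * c ^ 6) * ?I0)
     = edge_density c z0"
  proof -
    have x: "exp (4/3 * c ^ 6 - 2 * (Im z0)\<^sup>2) = exp (- (2/3) * c ^ 6) * exp (- 2 * (Im z0)\<^sup>2) * exp (2 * c ^ 6)"
      unfolding exp_add[symmetric] by simp
    define q where "q = 1 / sqrt (2 * pi)"
    have s: "sqrt (2 * pi) = 2 * pi * q"
      unfolding q_def by (simp add: real_div_sqrt)
    have p: "2 * c\<^sup>2 / pi * (4 * pi\<^sup>2) = 4 * c\<^sup>2 * (2 * pi)" by (simp add: power2_eq_square)
    have "?L * q * exp (- 2 * (Im z0)\<^sup>2 / (1 + 0)) * (4 * pi\<^sup>2 * exp (2 * c ^ 6) * ?I0)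
       = (2 * c\<^sup>2 / pi * (4 * pi\<^sup>2)) * q * (exp (- (2/3) * c ^ 6) * exp (- 2 * (Im z0)\<^sup>2) * exp (2 * c ^ 6)) * ?I0"
      unfolding power_zero_numeral diff_0_right add_0_right real_sqrt_one div_by_1 mult_1_right by (simp only: mult_ac)
    also have "\<dots> = 4 * c\<^sup>2 * (2 * pi) * q * exp (4/3 * c ^ 6 - 2 * (Im z0)\<^sup>2) * ?I0"
      unfolding p x ..
    also have "\<dots> = edge_density c z0"
      unfolding edge_density_def s by (simp only: mult_ac)
    finally have "?L * q * exp (- 2 * (Im z0)\<^sup>2 / (1 + 0)) * (4 * pi\<^sup>2 * exp (2 * c ^ 6) * ?I0)
       = edge_density c z0" .
    then show ?thesis unfolding q_def .
  qed
  finally show ?thesis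
    using rescaled_one_point_formula[OF c h1[unfolded e_def]] unfolding e_def by (simp only:)
qed

theorem theorem1p5:
  fixes c :: real
  assumes "c > 0"
  shows "\<forall>K. compact K \<longrightarrow>
    uniform_limit K
      (\<lambda>N z. rescaled_one_point N (potential c N) (of_real (right_endpoint c N)) z)
      (\<lambda>z. sqrt (2 * pi) * 4 * c\<^sup>2 * exp (4/3 * c ^ 6 - 2 * (Im z)\<^sup>2) *
        (LBINT u:{0..}. exp (4 * c ^ 3 * (u + Re z)) *
          (cmod (Ai (2 * of_real c * (z + of_real u) + of_real (c ^ 4))))\<^sup>2))
      sequentially"
  unfolding edge_density_def[symmetric]
proof (intro allI impI uniform_limit_compact_if_continuous_convergence)
  fix K :: "complex set" and N :: "nat \<Rightarrow> nat" and z :: "nat \<Rightarrow> complex" and z0 :: complex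
  assume K: "compact K" and N: "filterlim N at_top sequentially" and zK: "\<And>n. z n \<in> K" and z: "z \<longlonglongrightarrow> z0"
  obtain B where B: "\<And>w. w \<in> K \<Longrightarrow> cmod w \<le> B"
    using compact_imp_bounded[OF K] by (auto simp: bounded_iff)
  have p: "(\<lambda>n. real (N n) powr (-1/3)) \<longlonglongrightarrow> 0"
  proof -
    have "(\<lambda>n. real n powr (-1/3)) \<longlonglongrightarrow> 0" by real_asymp
    from filterlim_compose[OF this N] show ?thesis .
  qed
  have "eventually (\<lambda>n. c\<^sup>2 * real (N n) powr (-1/3) < 1/2) sequentially"
    by (rule order_tendstoD(2)[OF tendsto_mult_right_zero[OF p]]) simp
  moreover have "eventually (\<lambda>n. real (N n) powr (-1/3) * (2 * c\<^sup>2 + 1) < 1) sequentially"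
    by (rule order_tendstoD(2)[OF tendsto_mult_left_zero[OF p]]) simp
  moreover have "eventually (\<lambda>n. real (N n) powr (-1/3) * (4 * c * B) < 2 * c\<^sup>2 + 1) sequentially"
    by (rule order_tendstoD(2)[OF tendsto_mult_left_zero[OF p]]) (simp add: add_nonneg_pos)
  moreover have "eventually (\<lambda>n. N n \<ge> 1) sequentially"
    using N by (simp add: filterlim_at_top)
  ultimately have "eventually (\<lambda>n. c\<^sup>2 * real (N n) powr (-1/3) < 1/2 \<and> real (N n) powr (-1/3) * (2 * c\<^sup>2 + 1) < 1
      \<and> real (N n) powr (-1/3) * (4 * c * B) < 2 * c\<^sup>2 + 1 \<and> N n \<ge> 1) sequentially"
    by eventually_elim simp
  then obtain k where k: "\<And>n. n \<ge> k \<Longrightarrow> c\<^sup>2 * real (N n) powr (-1/3) < 1/2 \<and> real (N n) powr (-1/3) * (2 * c\<^sup>2 + 1) < 1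
      \<and> real (N n) powr (-1/3) * (4 * c * B) < 2 * c\<^sup>2 + 1 \<and> N n \<ge> 1"
    unfolding eventually_sequentially by blast
  \<comment> \<open>Dropping the first \<open>k\<close> terms makes all smallness conditions hold for every index.\<close>
  define M where "M = (\<lambda>n. N (n + k) - 1)"
  have M: "Suc (M n) = N (n + k)" for n using k[of "n + k"] by (simp add: M_def)
  have Ntop: "filterlim (\<lambda>n. N (n + k)) at_top sequentially"
    by (rule filterlim_compose[OF N]) (rule filterlim_add_const_nat_at_top)
  have "filterlim (\<lambda>n. Suc (M n)) at_top sequentially" unfolding M by (rule Ntop)
  then have Mtop: "filterlim M at_top sequentially"
    unfolding filterlim_at_top eventually_sequentially by (metis Suc_le_mono)
  have "(\<lambda>n. rescaled_one_point (Suc (M n)) (potential c (Suc (M n))) (of_real (right_endpoint c (Suc (M n)))) (z (n + k)))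
     \<longlonglongrightarrow> edge_density c z0"
  proof (rule rescaled_tendsto_edge_density[OF assms Mtop, where K = B])
    show "(\<lambda>n. z (n + k)) \<longlonglongrightarrow> z0" using z by (rule LIMSEQ_ignore_initial_segment)
    show "cmod (z (n + k)) \<le> B" for n by (rule B[OF zK])
  qed (use k in \<open>simp_all only: M le_add2 less_imp_le\<close>)
  then show "(\<lambda>n. rescaled_one_point (N n) (potential c (N n)) (of_real (right_endpoint c (N n))) (z n)) \<longlonglongrightarrow> edge_density c z0"
    unfolding M by (rule LIMSEQ_offset)
qed

end
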